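(* Let $F$ be a free group of finite rank $d(F)$. (1) If $d(F) \ge 3$, then for every prime $p$ the group $\operatorname{Out}(\widehat{F}^{(p)})$ contains a free pro-$p$ group of rank $d(F)-1$. (2) If $d(F) = 2$, then $\operatorname{Out}(\widehat{F}^{(2)})$ contains a free pro-$2$ group of rank $2$.
   Context: For a group $G$, $\widehat{G}^{(p)}$ denotes its pro-$p$ completion, i.e. the inverse limit of all quotients of $G$ that are finite $p$-groups, and $d(G)$ denotes the cardinality of a minimal set of generators of $G$. For a free group $F$ of finite rank, $\widehat{F}^{(p)}$ is the free pro-$p$ group of rank $d(F)$. For a pro-$p$ group $P$ that is topologically finitely generated, $\operatorname{Aut}(P)$ is the group of continuous automorphisms of $P$, a profinite group with its natural topology (in which the subgroups of automorphisms acting trivially on $P/U$, for $U$ an open characteristic subgroup of $P$, form a basis of neighbourhoods of the identity), and $\operatorname{Out}(P) = \operatorname{Aut}(P)/\operatorname{Inn}(P)$ carries the quotient profinite topology. "Contains a free pro-$p$ group of rank $r$" means that there is a closed subgroup of $\operatorname{Out}(P)$ that is isomorphic, as a topological group, to the free pro-$p$ group of rank $r$. *)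

theory Defs
  imports "HOL-Analysis.Analysis" "HOL-Algebra.Algebra"
begin

section \<open>Free groups\<close>

text \<open>
  A letter is a generator together with a sign (\<open>(x, True)\<close> is \<open>x\<close>, \<open>(x, False)\<close> is its inverse).
  The free group on \<open>S\<close> consists of the reduced words in these letters, multiplied by
  concatenation followed by free reduction.
\<close>

definition letter_inv :: "'a \<times> bool \<Rightarrow> 'a \<times> bool"
  where "letter_inv x = (fst x, \<not> snd x)"

fun reduced :: "('a \<times> bool) list \<Rightarrow> bool" where
  "reduced (x # y # w) \<longleftrightarrow> y \<noteq> letter_inv x \<and> reduced (y # w)"
| "reduced _ \<longleftrightarrow> True"

fun cancel_cons :: "'a \<times> bool \<Rightarrow> ('a \<times> bool) list \<Rightarrow> ('a \<times> bool) list" where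
  "cancel_cons x [] = [x]"
| "cancel_cons x (y # w) = (if y = letter_inv x then w else x # y # w)"

definition free_group :: "'a set \<Rightarrow> ('a \<times> bool) list monoid"
  where "free_group S =
    \<lparr>carrier = {w. reduced w \<and> set w \<subseteq> S \<times> UNIV},
     monoid.mult = foldr cancel_cons,
     one = []\<rparr>"

lemma letter_inv_letter_inv [simp]: "letter_inv (letter_inv x) = x"
  by (simp add: letter_inv_def)

lemma reduced_Cons: "reduced (x # w) \<Longrightarrow> reduced w"
  by (cases w) auto

lemma reduced_cancel_cons: "reduced w \<Longrightarrow> reduced (cancel_cons x w)"
  by (cases w) (auto dest: reduced_Cons)

lemma reduced_foldr_cancel_cons: "reduced v \<Longrightarrow> reduced (foldr cancel_cons u v)"
  by (induction u) (auto intro: reduced_cancel_cons)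

lemma set_cancel_cons: "set (cancel_cons x w) \<subseteq> insert x (set w)"
  by (cases w) auto

lemma set_foldr_cancel_cons: "set (foldr cancel_cons u v) \<subseteq> set u \<union> set v"
proof (induction u)
  case (Cons a u)
  then show ?case using set_cancel_cons[of a "foldr cancel_cons u v"] by auto
qed auto

lemma cancel_cons_cancel:
  "reduced w \<Longrightarrow> cancel_cons x (cancel_cons (letter_inv x) w) = w"
  by (cases w rule: reduced.cases) auto

lemma foldr_cancel_cons_reduced: "reduced w \<Longrightarrow> foldr cancel_cons w [] = w"
proof (induction w)
  case (Cons a w)
  then show ?case by (cases w) auto
qed auto

lemma foldr_cancel_cons_cancel_cons:
  assumes "reduced w"
  shows "foldr cancel_cons (cancel_cons x v) w = cancel_cons x (foldr cancel_cons v w)"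
proof (cases v)
  case (Cons y ys)
  then show ?thesis
    using cancel_cons_cancel[OF reduced_foldr_cancel_cons[OF assms]] by auto
qed auto

lemma foldr_cancel_cons_assoc:
  assumes "reduced w"
  shows "foldr cancel_cons (foldr cancel_cons u v) w
       = foldr cancel_cons u (foldr cancel_cons v w)"
  by (induction u) (auto simp: foldr_cancel_cons_cancel_cons[OF assms])

lemma foldr_cancel_cons_inverse:
  "reduced w \<Longrightarrow> foldr cancel_cons (rev (map letter_inv u)) (foldr cancel_cons u w) = w"
proof (induction u)
  case (Cons a u)
  then show ?case
    using cancel_cons_cancel[of "foldr cancel_cons u w" "letter_inv a"]
    by (auto simp: reduced_foldr_cancel_cons)
qed auto

lemma group_free_group: "group (free_group S)"
proof (rule groupI)
  fix u assume u: "u \<in> carrier (free_group S)"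
  define v where "v = foldr cancel_cons (rev (map letter_inv u)) []"
  have "set v \<subseteq> S \<times> UNIV"
    using u set_foldr_cancel_cons[of "rev (map letter_inv u)" "[]"]
    unfolding v_def free_group_def letter_inv_def by fastforce
  moreover have "reduced v"
    unfolding v_def by (rule reduced_foldr_cancel_cons) simp
  moreover have "foldr cancel_cons v u = []"
    using u foldr_cancel_cons_assoc[of u "rev (map letter_inv u)" "[]"]
      foldr_cancel_cons_inverse[of "[]" u] foldr_cancel_cons_reduced[of u]
    unfolding v_def free_group_def by simp
  ultimately show "\<exists>v\<in>carrier (free_group S). v \<otimes>\<^bsub>free_group S\<^esub> u = \<one>\<^bsub>free_group S\<^esub>"
    unfolding free_group_def by auto
qed (use set_foldr_cancel_cons in
      \<open>fastforce simp: free_group_def reduced_foldr_cancel_cons foldr_cancel_cons_assoc\<close>)+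

definition free_of_finite_rank :: "('a, 'b) monoid_scheme \<Rightarrow> bool"
  where "free_of_finite_rank G \<longleftrightarrow> group G \<and> (\<exists>n::nat. G \<cong> free_group {..<n})"

text \<open>Only meaningful for finitely generated \<open>G\<close>.\<close>

definition gen_rank :: "('a, 'b) monoid_scheme \<Rightarrow> nat"
  where "gen_rank G =
    (LEAST n. \<exists>S. S \<subseteq> carrier G \<and> finite S \<and> generate G S = carrier G \<and> card S = n)"


section \<open>Pro-\<open>p\<close> completions\<close>

definition p_quotient_kernels :: "nat \<Rightarrow> ('a, 'b) monoid_scheme \<Rightarrow> 'a set set"
  where "p_quotient_kernels p G =
    {N. N \<lhd> G \<and> finite (carrier (G Mod N)) \<and> (\<exists>k. card (carrier (G Mod N)) = p ^ k)}"

text \<open>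
  For \<open>N \<subseteq> M\<close> the transition map \<open>G/N \<rightarrow> G/M\<close> sends a coset \<open>C\<close> of \<open>N\<close> to the coset \<open>M C\<close> of \<open>M\<close>.
\<close>

definition pro_p_completion :: "nat \<Rightarrow> ('a, 'b) monoid_scheme \<Rightarrow> ('a set \<Rightarrow> 'a set) monoid"
  where "pro_p_completion p G =
    (product_group (p_quotient_kernels p G) (\<lambda>N. G Mod N))
      \<lparr>carrier := {x \<in> carrier (product_group (p_quotient_kernels p G) (\<lambda>N. G Mod N)).
         \<forall>N \<in> p_quotient_kernels p G. \<forall>M \<in> p_quotient_kernels p G.
           N \<subseteq> M \<longrightarrow> x M = M <#>\<^bsub>G\<^esub> x N}\<rparr>"

definition pro_p_topology :: "nat \<Rightarrow> ('a, 'b) monoid_scheme \<Rightarrow> ('a set \<Rightarrow> 'a set) topology"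
  where "pro_p_topology p G =
    subtopology
      (product_topology (\<lambda>N. discrete_topology (carrier (G Mod N))) (p_quotient_kernels p G))
      (carrier (pro_p_completion p G))"

lemma group_pro_p_completion:
  fixes G (structure)
  assumes "group G"
  shows "group (pro_p_completion p G)"
proof -
  interpret group G by fact
  let ?K = "p_quotient_kernels p G"
  let ?Q = "product_group ?K (\<lambda>N. G Mod N)"
  have N: "N \<lhd> G" if "N \<in> ?K" for N
    using that by (simp add: p_quotient_kernels_def)
  have Q: "group (G Mod N)" if "N \<in> ?K" for N
    using N[OF that] by (simp add: normal.factorgroup_is_group)
  interpret Q: group ?Q by (simp add: Q)
  have push: "M <#> (N #> a) = M #> a" if "M \<in> ?K" "N \<in> ?K" "N \<subseteq> M" "a \<in> carrier G" for M N a
  proof -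
    have MN: "subgroup M G" "subgroup N G" "N \<subseteq> carrier G" "M \<subseteq> carrier G"
      using N that by (auto simp: normal_imp_subgroup subgroup.subset)
    have "M <#> N = M"
      using set_mult_subgroup_idem[OF MN(1)] that MN by (simp add: subgroup_incl)
    then show ?thesis
      using that MN by (simp add: setmult_rcos_assoc)
  qed
  have invMod: "inv\<^bsub>G Mod N\<^esub> (N #> a) = N #> inv a" if "N \<in> ?K" "a \<in> carrier G" for N a
  proof -
    interpret N: normal N G using N that by blast
    have "N #> a \<in> carrier (G Mod N)"
      using that by (auto simp: FactGroup_def RCOSETS_def)
    then show ?thesis
      using that by (simp add: N.inv_FactGroup N.rcos_inv)
  qed
  have invQ: "(inv\<^bsub>?Q\<^esub> x) N = inv\<^bsub>G Mod N\<^esub> (x N)" if "x \<in> carrier ?Q" "N \<in> ?K" for x N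
    using that by (subst inv_product_group) (simp_all add: Q)
  have "subgroup {x \<in> carrier ?Q. \<forall>N \<in> ?K. \<forall>M \<in> ?K. N \<subseteq> M \<longrightarrow> x M = M <#> x N} ?Q"
  proof (rule Q.subgroupI)
    show "{x \<in> carrier ?Q. \<forall>N\<in>?K. \<forall>M\<in>?K. N \<subseteq> M \<longrightarrow> x M = M <#> x N} \<noteq> {}"
    proof -
      have "\<one>\<^bsub>?Q\<^esub> M = M <#> \<one>\<^bsub>?Q\<^esub> N" if "M \<in> ?K" "N \<in> ?K" "N \<subseteq> M" for M N
        using push[OF that one_closed] that N[OF that(1)] N[OF that(2)]
        by (simp add: FactGroup_def normal_imp_subgroup subgroup.subset coset_mult_one)
      then show ?thesis using Q.one_closed by blast
    qed
  next
    fix x assume x: "x \<in> {x \<in> carrier ?Q. \<forall>N\<in>?K. \<forall>M\<in>?K. N \<subseteq> M \<longrightarrow> x M = M <#> x N}"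
    then have x': "x \<in> carrier ?Q" by blast
    have "(inv\<^bsub>?Q\<^esub> x) M = M <#> (inv\<^bsub>?Q\<^esub> x) N" if MN: "M \<in> ?K" "N \<in> ?K" "N \<subseteq> M" for M N
    proof -
      interpret M: normal M G using N MN by blast
      interpret N: normal N G using N MN by blast
      have "x N \<in> carrier (G Mod N)" using PiE_mem[of x ?K] x' MN by simp
      then obtain a where a: "a \<in> carrier G" "x N = N #> a"
        by (auto simp: FactGroup_def RCOSETS_def)
      have "x M = M <#> x N" using x MN by blast
      then have xM: "x M = M #> a" using a push MN by simp
      have "(inv\<^bsub>?Q\<^esub> x) M = M #> inv a" "(inv\<^bsub>?Q\<^esub> x) N = N #> inv a"
        using invQ[OF x' MN(1)] invQ[OF x' MN(2)] invMod[OF MN(1) a(1)] invMod[OF MN(2) a(1)] a xM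
        by simp_all
      then show ?thesis using push MN a by simp
    qed
    then show "inv\<^bsub>?Q\<^esub> x \<in> {x \<in> carrier ?Q. \<forall>N\<in>?K. \<forall>M\<in>?K. N \<subseteq> M \<longrightarrow> x M = M <#> x N}"
      using Q.inv_closed[OF x'] by (intro CollectI conjI ballI impI)
  next
    fix x y
    assume x: "x \<in> {x \<in> carrier ?Q. \<forall>N\<in>?K. \<forall>M\<in>?K. N \<subseteq> M \<longrightarrow> x M = M <#> x N}"
      and y: "y \<in> {x \<in> carrier ?Q. \<forall>N\<in>?K. \<forall>M\<in>?K. N \<subseteq> M \<longrightarrow> x M = M <#> x N}"
    then have x': "x \<in> carrier ?Q" and y': "y \<in> carrier ?Q" by blast+
    have "(x \<otimes>\<^bsub>?Q\<^esub> y) M = M <#> (x \<otimes>\<^bsub>?Q\<^esub> y) N" if MN: "M \<in> ?K" "N \<in> ?K" "N \<subseteq> M" for M N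
    proof -
      interpret M: normal M G using N MN by blast
      interpret N: normal N G using N MN by blast
      have "x N \<in> carrier (G Mod N)" "y N \<in> carrier (G Mod N)"
        using PiE_mem[of x ?K] PiE_mem[of y ?K] x' y' MN by simp_all
      then obtain a b where ab: "a \<in> carrier G" "x N = N #> a" "b \<in> carrier G" "y N = N #> b"
        by (auto simp: FactGroup_def RCOSETS_def)
      have "x M = M <#> x N" "y M = M <#> y N" using x y MN by blast+
      then have "x M = M #> a" "y M = M #> b" using ab push MN by simp_all
      then show ?thesis
        using MN ab push by (simp add: FactGroup_def M.rcos_sum N.rcos_sum)
    qed
    then show "x \<otimes>\<^bsub>?Q\<^esub> y \<in> {x \<in> carrier ?Q. \<forall>N\<in>?K. \<forall>M\<in>?K. N \<subseteq> M \<longrightarrow> x M = M <#> x N}"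
      using Q.m_closed[OF x' y'] by (intro CollectI conjI ballI impI)
  qed blast
  then show ?thesis
    unfolding pro_p_completion_def by (rule Q.subgroup_imp_group)
qed


section \<open>Automorphisms and outer automorphisms of a topological group\<close>

text \<open>
  A topological group is given by a group \<open>P\<close> and a topology \<open>T\<close> on its carrier.
  If \<open>T\<close> is compact Hausdorff, the inverse of a continuous automorphism is again continuous.
\<close>

definition cont_auto :: "('a, 'b) monoid_scheme \<Rightarrow> 'a topology \<Rightarrow> ('a \<Rightarrow> 'a) set"
  where "cont_auto P T = {f \<in> auto P. continuous_map T T f}"

definition ContAutoGroup :: "('a, 'b) monoid_scheme \<Rightarrow> 'a topology \<Rightarrow> ('a \<Rightarrow> 'a) monoid"
  where "ContAutoGroup P T = (AutoGroup P)\<lparr>carrier := cont_auto P T\<rparr>"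

definition open_characteristic :: "('a, 'b) monoid_scheme \<Rightarrow> 'a topology \<Rightarrow> 'a set \<Rightarrow> bool"
  where "open_characteristic P T U \<longleftrightarrow>
    subgroup U P \<and> openin T U \<and> (\<forall>f \<in> cont_auto P T. f ` U = U)"

definition trivial_on_quotient ::
    "('a, 'b) monoid_scheme \<Rightarrow> 'a topology \<Rightarrow> 'a set \<Rightarrow> ('a \<Rightarrow> 'a) set"
  where "trivial_on_quotient P T U =
    {f \<in> cont_auto P T. \<forall>C \<in> carrier (P Mod U). f ` C = C}"

definition auto_topology :: "('a, 'b) monoid_scheme \<Rightarrow> 'a topology \<Rightarrow> ('a \<Rightarrow> 'a) topology"
  where "auto_topology P T = topology_generated_by
    {f <#\<^bsub>ContAutoGroup P T\<^esub> trivial_on_quotient P T U | f U.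
       f \<in> cont_auto P T \<and> open_characteristic P T U}"

definition inner_auto :: "('a, 'b) monoid_scheme \<Rightarrow> ('a \<Rightarrow> 'a) set"
  where "inner_auto P =
    (\<lambda>g. \<lambda>x \<in> carrier P. g \<otimes>\<^bsub>P\<^esub> x \<otimes>\<^bsub>P\<^esub> inv\<^bsub>P\<^esub> g) ` carrier P"

definition OutGroup :: "('a, 'b) monoid_scheme \<Rightarrow> 'a topology \<Rightarrow> ('a \<Rightarrow> 'a) set monoid"
  where "OutGroup P T = ContAutoGroup P T Mod inner_auto P"

definition quotient_topology :: "'a topology \<Rightarrow> ('a \<Rightarrow> 'b) \<Rightarrow> 'b topology"
  where "quotient_topology T q =
    topology (\<lambda>V. V \<subseteq> q ` topspace T \<and> openin T {x \<in> topspace T. q x \<in> V})"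

lemma openin_quotient_topology:
  "openin (quotient_topology T q) V \<longleftrightarrow>
     V \<subseteq> q ` topspace T \<and> openin T {x \<in> topspace T. q x \<in> V}"
proof -
  have "istopology (\<lambda>V. V \<subseteq> q ` topspace T \<and> openin T {x \<in> topspace T. q x \<in> V})"
    unfolding istopology_def
  proof (intro conjI allI impI)
    fix V W
    assume *: "V \<subseteq> q ` topspace T \<and> openin T {x \<in> topspace T. q x \<in> V}"
      "W \<subseteq> q ` topspace T \<and> openin T {x \<in> topspace T. q x \<in> W}"
    then show "V \<inter> W \<subseteq> q ` topspace T" by blast
    have "{x \<in> topspace T. q x \<in> V \<inter> W}
        = {x \<in> topspace T. q x \<in> V} \<inter> {x \<in> topspace T. q x \<in> W}" by blast
    then show "openin T {x \<in> topspace T. q x \<in> V \<inter> W}" using * by auto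
  next
    fix \<K>
    assume *: "\<forall>K\<in>\<K>. K \<subseteq> q ` topspace T \<and> openin T {x \<in> topspace T. q x \<in> K}"
    then show "\<Union> \<K> \<subseteq> q ` topspace T" by blast
    have "{x \<in> topspace T. q x \<in> \<Union> \<K>} = (\<Union>K\<in>\<K>. {x \<in> topspace T. q x \<in> K})" by blast
    then show "openin T {x \<in> topspace T. q x \<in> \<Union> \<K>}" using * by auto
  qed
  then show ?thesis
    by (simp add: quotient_topology_def)
qed

lemma topspace_quotient_topology [simp]: "topspace (quotient_topology T q) = q ` topspace T"
proof -
  have "{x \<in> topspace T. q x \<in> q ` topspace T} = topspace T" by auto
  then have "openin (quotient_topology T q) (q ` topspace T)"
    by (simp add: openin_quotient_topology)
  then show ?thesis
    by (metis openin_quotient_topology openin_subset openin_topspace subset_antisym)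
qed

lemma quotient_map_quotient_topology: "quotient_map T (quotient_topology T q) q"
  by (auto simp: quotient_map_def openin_quotient_topology)

definition out_topology :: "('a, 'b) monoid_scheme \<Rightarrow> 'a topology \<Rightarrow> ('a \<Rightarrow> 'a) set topology"
  where "out_topology P T =
    quotient_topology (auto_topology P T) (\<lambda>f. inner_auto P #>\<^bsub>ContAutoGroup P T\<^esub> f)"


section \<open>Free pro-\<open>p\<close> subgroups\<close>

text \<open>The free pro-\<open>p\<close> group of rank \<open>r\<close> is the pro-\<open>p\<close> completion of the free group of rank \<open>r\<close>.\<close>

definition contains_free_pro_p ::
    "nat \<Rightarrow> nat \<Rightarrow> ('a, 'b) monoid_scheme \<Rightarrow> 'a topology \<Rightarrow> bool"
  where "contains_free_pro_p p r G T \<longleftrightarrow>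
    (\<exists>H h. subgroup H G \<and> closedin T H \<and>
       h \<in> iso (G\<lparr>carrier := H\<rparr>) (pro_p_completion p (free_group {..<r})) \<and>
       homeomorphic_map (subtopology T H) (pro_p_topology p (free_group {..<r})) h)"

end

theory Submission
  imports Defs
begin

text \<open>
  Let \<open>P\<close> be the pro-\<open>p\<close> completion of the free group on \<open>x, y, \<dots>\<close> and let \<open>\<alpha>\<^sub>j\<close> be the endomorphism that
  sends \<open>y\<close> to \<open>y [b\<^sub>1\<^bsup>j+1\<^esup>, b\<^sub>3]\<close>, where \<open>b\<^sub>i\<close> is the conjugate of \<open>y\<close> by \<open>x\<^sup>i\<close>, and fixes the other basis
  elements. It acts trivially modulo commutators, hence bijectively on finite \<open>p\<close>-quotients by
  Burnside's basis theorem, and the \<open>\<alpha>\<^sub>j\<close> generate finite \<open>p\<close>-groups of automorphisms of the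
  characteristic finite \<open>p\<close>-quotients. So the \<open>\<alpha>\<^sub>j\<close> with \<open>j < r\<close> define a continuous homomorphism to
  \<open>Aut P\<close> from the free pro-\<open>p\<close> group of rank \<open>r\<close>, and compactness reduces the claim to its
  injectivity modulo inner automorphisms.

  This is detected in wreath products of a finite \<open>p\<close>-group \<open>Q\<close> with a cyclic group of order \<open>q = p\<^sup>m\<close>. Send
  \<open>x\<close> to the shift and \<open>y\<close> to the function with values \<open>a, b, c\<close> at \<open>0, 1, 3\<close> and \<open>1\<close> elsewhere. As only
  one shift of \<open>{1, 3}\<close> fits into \<open>{0, 1, 3}\<close>, applying \<open>\<alpha>\<^sub>j\<close> amounts to replacing \<open>a\<close> by \<open>a [b\<^bsup>j+1\<^esup>, c]\<close>.
  Starting from \<open>a = 1\<close>, a word \<open>w\<close> in the \<open>\<alpha>\<^sub>j\<close> thus changes \<open>a\<close> to the same word in the elements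
  \<open>[b\<^bsup>j+1\<^esup>, c]\<close>, and if \<open>w\<close> is inner, then that value is \<open>1\<close>, because the size of the support of a function
  is a conjugacy invariant. Finally \<open>b\<close> and \<open>c\<close> are taken in a second wreath product so that the
  elements \<open>[b\<^bsup>j+1\<^esup>, c]\<close> have prescribed values at \<open>0\<close>.
\<close>

section \<open>Finite \<open>p\<close>-groups\<close>

text \<open>Freeness of the discrete group generated by the \<open>\<alpha> j\<close> would not be
  enough: injectivity on the completion means that every finite \<open>p\<close>-quotient of the
  free group of words is recovered from the action on some finite \<open>p\<close>-quotient of
  \<open>P\<close>, and this up to conjugation. Wreath products serve this purpose because they can
  be built over any prescribed \<open>p\<close>-group. A homomorphism with parameters
  \<open>a, b, c\<close> is turned by each \<open>\<alpha> j\<close> into one with the same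
  \<open>b\<close> and \<open>c\<close>. The commutators that multiply \<open>a\<close> are
  therefore constants during the iteration, and a word acts on \<open>a\<close> by a plain right
  multiplication. The exponents \<open>j + 1\<close> extract independent elements from the single
  pair \<open>b, c\<close>: if \<open>b\<close> is a shift and \<open>c\<close> a function, then
  \<open>[b^(j+1), c]\<close> takes the value \<open>c (j+1) * c 0 ^ -1\<close> at 0, and the values
  of \<open>c\<close> at different positions can be chosen freely. The places 1 and 3 are chosen
  since their difference 2 occurs only once in \<open>{0, 1, 3}\<close> modulo \<open>q\<close>,
  provided that \<open>q\<close> is at least 6.\<close>

definition finite_p_group :: "nat \<Rightarrow> ('a, 'b) monoid_scheme \<Rightarrow> bool"
  where "finite_p_group p G \<longleftrightarrow> group G \<and> finite (carrier G) \<and> (\<exists>k. card (carrier G) = p ^ k)"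

section \<open>Orbit counting for actions of finite groups\<close>

locale acting_group = group G for G (structure) +
  fixes A :: "'c set" and act :: "'a \<Rightarrow> 'c \<Rightarrow> 'c"
  assumes finite_carrier: "finite (carrier G)" and finite_set: "finite A"
    and act_closed: "\<And>g x. g \<in> carrier G \<Longrightarrow> x \<in> A \<Longrightarrow> act g x \<in> A"
    and act_one: "\<And>x. x \<in> A \<Longrightarrow> act \<one> x = x"
    and act_mult: "\<And>g h x. g \<in> carrier G \<Longrightarrow> h \<in> carrier G \<Longrightarrow> x \<in> A \<Longrightarrow>
      act (g \<otimes> h) x = act g (act h x)"
begin

definition orbit_rel :: "('c \<times> 'c) set"
  where "orbit_rel = {(x, y). x \<in> A \<and> (\<exists>g \<in> carrier G. y = act g x)}"

lemma act_inv: "g \<in> carrier G \<Longrightarrow> x \<in> A \<Longrightarrow> act (inv g) (act g x) = x"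
  using act_mult[of "inv g" g x] act_one by simp

lemma equiv_orbit_rel: "equiv A orbit_rel"
proof (rule equivI)
  show "orbit_rel \<subseteq> A \<times> A" using act_closed by (auto simp: orbit_rel_def)
  show "refl_on A orbit_rel"
    using act_one by (auto simp: refl_on_def orbit_rel_def intro!: bexI[of _ \<one>])
  show "sym orbit_rel"
  proof (rule symI)
    fix x y assume "(x, y) \<in> orbit_rel"
    then obtain g where g: "x \<in> A" "g \<in> carrier G" "y = act g x" by (auto simp: orbit_rel_def)
    then have "x = act (inv g) y" "y \<in> A" "inv g \<in> carrier G" using act_inv act_closed by simp_all
    then show "(y, x) \<in> orbit_rel" unfolding orbit_rel_def by blast
  qed
  show "trans orbit_rel"
    unfolding trans_def
  proof (intro allI impI)
    fix x y z assume "(x, y) \<in> orbit_rel" "(y, z) \<in> orbit_rel"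
    then obtain g h where gh: "g \<in> carrier G" "h \<in> carrier G" "x \<in> A" "y = act g x" "z = act h y"
      by (auto simp: orbit_rel_def)
    then have "z = act (h \<otimes> g) x" using act_mult by simp
    then show "(x, z) \<in> orbit_rel" using gh by (auto simp: orbit_rel_def)
  qed
qed

lemma orbit_class: "x \<in> A \<Longrightarrow> orbit_rel `` {x} = (\<lambda>g. act g x) ` carrier G"
  by (auto simp: orbit_rel_def)

text \<open>Trivial stabilizers make every orbit a copy of \<open>G\<close>, and the orbits
  partition \<open>A\<close>.\<close>

lemma card_carrier_dvd_if_free:
  assumes free: "\<And>g x. g \<in> carrier G \<Longrightarrow> x \<in> A \<Longrightarrow> act g x = x \<Longrightarrow> g = \<one>"
  shows "card (carrier G) dvd card A"
proof (rule equiv_imp_dvd_card[OF finite_set equiv_orbit_rel])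
  fix Y assume "Y \<in> A // orbit_rel"
  then obtain x where x: "x \<in> A" "Y = orbit_rel `` {x}" by (auto elim: quotientE)
  have "inj_on (\<lambda>g. act g x) (carrier G)"
  proof (rule inj_onI)
    fix g h assume gh: "g \<in> carrier G" "h \<in> carrier G" "act g x = act h x"
    then have "act (inv h \<otimes> g) x = x" using act_mult[of "inv h" g x] act_inv x by simp
    then have "inv h \<otimes> g = \<one>" using free[of "inv h \<otimes> g" x] gh(1,2) x(1) by simp
    then have "inv g = inv h" using inv_equality[of "inv h" g] gh by simp
    then show "g = h" using gh inv_inv by metis
  qed
  then show "card (carrier G) dvd card Y" using x by (simp add: orbit_class card_image)
qed

text \<open>Orbit-stabilizer: the fibres of the orbit map at \<open>x\<close> are the left cosets of
  the stabilizer of \<open>x\<close> and so have equal size.\<close>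

lemma card_orbit_dvd:
  assumes x: "x \<in> A"
  shows "card ((\<lambda>g. act g x) ` carrier G) dvd card (carrier G)"
proof -
  let ?f = "\<lambda>g. act g x"
  let ?S = "{g \<in> carrier G. ?f g = x}"
  have fib: "card {g \<in> carrier G. ?f g = y} = card ?S" if y: "y \<in> ?f ` carrier G" for y
  proof -
    obtain h where h: "y = ?f h" "h \<in> carrier G" using y by (rule imageE)
    have "bij_betw (\<lambda>s. h \<otimes> s) ?S {g \<in> carrier G. ?f g = y}"
    proof (rule bij_betwI[where g = "\<lambda>g. inv h \<otimes> g"])
      show "(\<lambda>s. h \<otimes> s) \<in> ?S \<rightarrow> {g \<in> carrier G. ?f g = y}"
        using h act_mult[OF h(2) _ x] by simp
      show "(\<lambda>g. inv h \<otimes> g) \<in> {g \<in> carrier G. ?f g = y} \<rightarrow> ?S"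
        using h act_mult[OF inv_closed[OF h(2)] _ x] act_inv[OF h(2) x] by simp
    qed (simp_all add: h(2) m_assoc[symmetric])
    then show ?thesis by (simp add: bij_betw_same_card)
  qed
  have "card (carrier G) = (\<Sum>y\<in>?f ` carrier G. card {g \<in> carrier G. ?f g = y})"
    using sum.image_gen[OF finite_carrier, of "\<lambda>_. 1::nat" ?f] by simp
  also have "\<dots> = card (?f ` carrier G) * card ?S" using fib by simp
  finally show ?thesis by simp
qed

text \<open>The moved points form a union of orbits with more than one element, and the size of such
  an orbit is a nontrivial power of \<open>p\<close>.\<close>

lemma prime_dvd_card_moved:
  assumes p: "Factorial_Ring.prime p" and G: "finite_p_group p G"
  shows "p dvd card {x \<in> A. \<exists>g\<in>carrier G. act g x \<noteq> x}"
proof (rule equiv_imp_dvd_card)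
  let ?M = "{x \<in> A. \<exists>g\<in>carrier G. act g x \<noteq> x}"
  \<comment> \<open>An orbit that contains a fixed point consists of that point alone, so the
    restricted relation still has full orbits as classes.\<close>
  have closed: "y \<in> ?M" if xM: "x \<in> ?M" and xy: "(x, y) \<in> orbit_rel" for x y
  proof (rule ccontr)
    assume y: "y \<notin> ?M"
    obtain g where g: "x \<in> A" "g \<in> carrier G" "y = act g x"
      using xy by (auto simp: orbit_rel_def)
    obtain h where h: "h \<in> carrier G" "act h x \<noteq> x" using xM by blast
    have "y \<in> A" using g act_closed by simp
    then have "\<forall>k\<in>carrier G. act k y = y" using y by simp
    moreover from this have "x = y" using act_inv[of g x] g by (metis inv_closed)
    ultimately show False using h by simp
  qed
  have sym: "sym orbit_rel" and trans: "trans orbit_rel"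
    using equiv_orbit_rel by (simp_all add: equiv_def)
  show "finite ?M" using finite_set by simp
  show "equiv ?M (orbit_rel \<inter> ?M \<times> ?M)"
  proof (rule equivI)
    show "refl_on ?M (orbit_rel \<inter> ?M \<times> ?M)"
      using equiv_class_self[OF equiv_orbit_rel] by (auto simp: refl_on_def)
    show "sym (orbit_rel \<inter> ?M \<times> ?M)"
      using symD[OF sym] by (intro symI) blast
    show "trans (orbit_rel \<inter> ?M \<times> ?M)"
      using transD[OF trans] by (intro transI) blast
  qed auto
  fix Y assume "Y \<in> ?M // (orbit_rel \<inter> ?M \<times> ?M)"
  then obtain x where x: "x \<in> ?M" "Y = (orbit_rel \<inter> ?M \<times> ?M) `` {x}" by (rule quotientE)
  have "(orbit_rel \<inter> ?M \<times> ?M) `` {x} = orbit_rel `` {x}"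
    using closed[OF x(1)] x(1) by (intro equalityI subsetI) (simp_all only: Image_singleton_iff Int_iff mem_Sigma_iff simp_thms)
  then have Y: "Y = (\<lambda>g. act g x) ` carrier G"
    using orbit_class[of x] x by simp
  obtain k where "card (carrier G) = p ^ k" using G by (auto simp: finite_p_group_def)
  then have "card Y dvd p ^ k" using card_orbit_dvd[of x] x(1) unfolding Y by simp
  then obtain m where m: "card Y = p ^ m" using p divides_primepow_nat by blast
  have "x \<in> Y" unfolding Y using x(1) act_one by (intro image_eqI[of _ _ \<one>]) simp_all
  moreover obtain g where g: "g \<in> carrier G" "act g x \<noteq> x" using x(1) by blast
  moreover have "act g x \<in> Y" unfolding Y using g(1) by (rule imageI)
  ultimately have "card Y \<noteq> 1" by (metis card_1_singletonE singletonD)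
  then show "p dvd card Y" using m by (cases m) auto
qed

end

lemma finite_p_group_subgroup:
  assumes p: "Factorial_Ring.prime p" and "finite_p_group p G" "subgroup H G"
  shows "finite_p_group p (G\<lparr>carrier := H\<rparr>)"
proof -
  interpret group G using assms by (simp add: finite_p_group_def)
  obtain k where k: "finite (carrier G)" "card (carrier G) = p ^ k"
    using assms by (auto simp: finite_p_group_def)
  have "card H dvd p ^ k"
    using lagrange[OF assms(3)] k by (metis dvd_triv_right order_def)
  moreover have "finite H" using k subgroup.subset[OF assms(3)] finite_subset by blast
  ultimately show ?thesis
    using p divides_primepow_nat subgroup.subgroup_is_group[OF assms(3)]
    by (auto simp: finite_p_group_def is_group)
qed

text \<open>
  Let \<open>H\<close> act on its cosets by right multiplication: \<open>p\<close> divides the number of fixed cosets, so \<open>H\<close> is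
  not the only one.
\<close>

lemma (in group) proper_subgroup_normalizer:
  assumes p: "Factorial_Ring.prime p" and G: "finite_p_group p G"
    and H: "subgroup H G" "H \<noteq> carrier G"
  shows "\<exists>g \<in> carrier G - H. \<forall>h\<in>H. g \<otimes> h \<otimes> inv g \<in> H"
proof (rule ccontr)
  assume neg: "\<not> ?thesis"
  have fin: "finite (carrier G)" using G by (simp add: finite_p_group_def)
  interpret H: subgroup H G by fact
  \<comment> \<open>The inverse turns right multiplication into a left action.\<close>
  let ?a = "\<lambda>h C. C #> inv h"
  have sub: "C \<subseteq> carrier G" if "C \<in> rcosets H" for C
    using that H.rcosets_carrier[OF is_group] by blast
  have finr: "finite (rcosets H)" using fin by (simp add: RCOSETS_def)
  have cl: "?a h C \<in> rcosets H" if "h \<in> H" "C \<in> rcosets H" for h C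
    using that H.subset by (auto simp: RCOSETS_def coset_mult_assoc)
  interpret act: acting_group "G\<lparr>carrier := H\<rparr>" "rcosets H" ?a
    using fin finite_subset[OF H.subset] finr cl sub H.subset
    by (intro acting_group.intro acting_group_axioms.intro H.subgroup_is_group[OF is_group])
      (auto simp: coset_mult_assoc inv_mult_group)
  \<comment> \<open>The coset \<open>H #> g\<close> is fixed by all of \<open>H\<close> exactly if
    \<open>g \<otimes> h \<otimes> inv g\<close> lies in \<open>H\<close> for all \<open>h\<close>
    in \<open>H\<close>; by \<open>neg\<close> this leaves only the coset \<open>H\<close>
    itself.\<close>
  have "{C \<in> rcosets H. \<exists>g\<in>H. ?a g C \<noteq> C} = rcosets H - {H}"
  proof (intro equalityI subsetI)
    fix C assume C: "C \<in> {C \<in> rcosets H. \<exists>g\<in>H. ?a g C \<noteq> C}"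
    have "?a h H = H" if "h \<in> H" for h
      using that H.rcos_const[OF is_group, of "inv h"] by simp
    then show "C \<in> rcosets H - {H}" using C by auto
  next
    fix C assume C: "C \<in> rcosets H - {H}"
    then obtain g where g: "g \<in> carrier G" "C = H #> g" by (auto simp: RCOSETS_def)
    have "g \<notin> H" using g C coset_join2[OF _ H(1)] by auto
    then obtain h where h: "h \<in> H" "g \<otimes> h \<otimes> inv g \<notin> H" using neg g by blast
    have "?a (inv h) C \<noteq> C"
    proof
      assume "?a (inv h) C = C"
      then have "H #> (g \<otimes> h) = H #> g" using g h H.subset by (simp add: coset_mult_assoc)
      moreover have "g \<otimes> h \<in> H #> (g \<otimes> h)" using g h H.subset by (intro rcos_self H(1)) auto
      ultimately have "g \<otimes> h \<in> H #> g" by simp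
      then show False
        using H.rcos_module_imp[OF is_group g(1)] h by blast
    qed
    then show "C \<in> {C \<in> rcosets H. \<exists>g\<in>H. ?a g C \<noteq> C}" using C h by blast
  qed
  then have "p dvd card (rcosets H - {H})"
    using act.prime_dvd_card_moved[OF p finite_p_group_subgroup[OF p G H(1)]] by simp
  moreover have "card (rcosets H) = card (rcosets H - {H}) + 1"
    using finr H.subgroup_in_rcosets[OF is_group] by (metis One_nat_def Suc_eq_plus1 card_Suc_Diff1)
  \<comment> \<open>The index is a power of \<open>p\<close>, and not 1 as \<open>H\<close> is
    proper. Together with the previous count, \<open>p\<close> would divide 1.\<close>
  moreover have "p dvd card (rcosets H)"
  proof -
    have c: "card (rcosets H) * card H = card (carrier G)"
      using lagrange[OF H(1)] by (simp add: order_def)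
    obtain k where "card (carrier G) = p ^ k" using G by (auto simp: finite_p_group_def)
    then obtain m where m: "card (rcosets H) = p ^ m"
      using c p divides_primepow_nat by (metis dvd_triv_left)
    have "card H \<noteq> card (carrier G)" using H fin card_subset_eq H.subset by blast
    then have "m \<noteq> 0" using m c by (cases m) auto
    then show ?thesis using m by simp
  qed
  ultimately show False using p
    by (metis dvd_add_right_iff not_prime_unit)
qed

text \<open>
  Burnside's basis theorem: a maximal subgroup \<open>K\<close> of a finite \<open>p\<close>-group is normal, and an element
  outside \<open>K\<close> is central modulo \<open>K\<close> since \<open>K\<close> is maximal, so \<open>K\<close> contains the derived subgroup.
\<close>

lemma (in group) subgroup_eq_carrier_if_mod_derived:
  assumes p: "Factorial_Ring.prime p" and G: "finite_p_group p G" and H: "subgroup H G"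
    and gen: "\<And>g. g \<in> carrier G \<Longrightarrow> \<exists>h\<in>H. inv h \<otimes> g \<in> derived G (carrier G)"
  shows "H = carrier G"
proof (rule ccontr)
  assume "H \<noteq> carrier G"
  let ?P = "{K. subgroup K G \<and> H \<subseteq> K \<and> K \<noteq> carrier G}"
  have fin: "finite (carrier G)" using G by (simp add: finite_p_group_def)
  have finP: "finite ?P"
    by (rule finite_subset[of _ "Pow (carrier G)"]) (use fin subgroup.subset in auto)
  have "H \<in> ?P" using H \<open>H \<noteq> carrier G\<close> by simp
  then have "?P \<noteq> {}" by blast
  from finite_has_maximal[OF finP this] obtain K where "K \<in> ?P" and max: "\<forall>L\<in>?P. K \<subseteq> L \<longrightarrow> K = L"
    by (elim bexE)
  then have K: "subgroup K G" "H \<subseteq> K" "K \<noteq> carrier G" by simp_all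
  have maximal: "L = carrier G" if "subgroup L G" "K \<subseteq> L" "L \<noteq> K" for L
    using that max K(2) by auto
  interpret K: subgroup K G by (rule K)
  let ?N = "{g \<in> carrier G. \<forall>k\<in>K. g \<otimes> k \<otimes> inv g \<in> K}"
  have "subgroup ?N G"
  proof (rule subgroupI)
    show "?N \<noteq> {}" by (auto intro!: exI[of _ \<one>])
    fix g assume g: "g \<in> ?N"
    let ?c = "\<lambda>k. g \<otimes> k \<otimes> inv g"
    \<comment> \<open>Conjugation by \<open>g\<close> maps the finite set \<open>K\<close>
      injectively into itself, hence onto itself. Thus \<open>?N\<close>, although defined by an
      inclusion only, is closed under inverses.\<close>
    have "inj_on ?c K" using g by (auto simp: inj_on_def)
    moreover have "?c ` K \<subseteq> K" using g by auto
    ultimately have surj: "?c ` K = K"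
      using fin finite_subset[OF K.subset] by (simp add: endo_inj_surj)
    have "inv g \<otimes> k \<otimes> inv (inv g) \<in> K" if k: "k \<in> K" for k
    proof -
      obtain k' where k': "k' \<in> K" "k = g \<otimes> k' \<otimes> inv g" using surj k by blast
      then have "inv g \<otimes> k \<otimes> inv (inv g) = k'" using g by (simp add: m_assoc) (simp add: m_assoc[symmetric])
      then show ?thesis using k' by simp
    qed
    then show "inv g \<in> ?N" using g by simp
  next
    fix g h assume gh: "g \<in> ?N" "h \<in> ?N"
    have "g \<otimes> h \<otimes> k \<otimes> inv (g \<otimes> h) = g \<otimes> (h \<otimes> k \<otimes> inv h) \<otimes> inv g" if "k \<in> K" for k
      using gh that by (simp add: m_assoc inv_mult_group)
    then show "g \<otimes> h \<in> ?N" using gh by simp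
  qed auto
  moreover have "K \<subseteq> ?N" by auto
  moreover obtain g where "g \<in> carrier G - K" "\<forall>k\<in>K. g \<otimes> k \<otimes> inv g \<in> K"
    using proper_subgroup_normalizer[OF p G K(1,3)] by (elim bexE)
  then have "g \<in> ?N" "g \<notin> K" by simp_all
  then have "?N \<noteq> K" by metis
  ultimately have "?N = carrier G" by (intro maximal)
  then have "K \<lhd> G" using K(1) by (auto simp: normal_inv_iff)
  then interpret K: normal K G .
  interpret Q: group "G Mod K" by (rule K.factorgroup_is_group)
  interpret \<pi>: group_hom G "G Mod K" "\<lambda>a. K #> a"
    by (intro group_hom.intro group_hom_axioms.intro K.r_coset_hom_Mod is_group Q.is_group)
  have central: "(K #> a) \<otimes>\<^bsub>G Mod K\<^esub> (K #> g) = (K #> g) \<otimes>\<^bsub>G Mod K\<^esub> (K #> a)"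
    if ag: "a \<in> carrier G" "g \<in> carrier G" for a g
  proof (cases "g \<in> K")
    case True
    then have "K #> g = \<one>\<^bsub>G Mod K\<^esub>" using K.rcos_const[OF is_group] by simp
    then show ?thesis using \<pi>.hom_closed[OF ag(1)] Q.l_one Q.r_one by metis
  next
    case False
    \<comment> \<open>The preimage \<open>?Z\<close> of the centralizer of \<open>K #> g\<close>
      contains \<open>K\<close> and also \<open>g\<close>, so it is larger than the maximal subgroup
      \<open>K\<close> and must be all of \<open>G\<close>.\<close>
    let ?Z = "{a \<in> carrier G. (K #> a) \<otimes>\<^bsub>G Mod K\<^esub> (K #> g) = (K #> g) \<otimes>\<^bsub>G Mod K\<^esub> (K #> a)}"
    have "subgroup ?Z G"
    proof (rule subgroupI)
      show "?Z \<noteq> {}" using ag by (auto intro!: exI[of _ g])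
      fix a assume a: "a \<in> ?Z"
      let ?a = "K #> a" and ?g = "K #> g"
      have cl: "?a \<in> carrier (G Mod K)" "?g \<in> carrier (G Mod K)" using a ag \<pi>.hom_closed by blast+
      have "inv\<^bsub>G Mod K\<^esub> ?a \<otimes>\<^bsub>G Mod K\<^esub> ?g = inv\<^bsub>G Mod K\<^esub> ?a \<otimes>\<^bsub>G Mod K\<^esub> (?g \<otimes>\<^bsub>G Mod K\<^esub> ?a) \<otimes>\<^bsub>G Mod K\<^esub> inv\<^bsub>G Mod K\<^esub> ?a"
        using cl by (metis Q.m_assoc Q.inv_closed Q.m_closed Q.r_inv Q.r_one)
      also have "\<dots> = inv\<^bsub>G Mod K\<^esub> ?a \<otimes>\<^bsub>G Mod K\<^esub> (?a \<otimes>\<^bsub>G Mod K\<^esub> ?g) \<otimes>\<^bsub>G Mod K\<^esub> inv\<^bsub>G Mod K\<^esub> ?a"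
        using a by simp
      also have "\<dots> = ?g \<otimes>\<^bsub>G Mod K\<^esub> inv\<^bsub>G Mod K\<^esub> ?a"
        using cl by (metis Q.m_assoc Q.inv_closed Q.l_inv Q.l_one)
      finally show "inv a \<in> ?Z" using a \<pi>.hom_inv by auto
    next
      fix a b assume ab: "a \<in> ?Z" "b \<in> ?Z"
      then have cl: "K #> a \<in> carrier (G Mod K)" "K #> b \<in> carrier (G Mod K)" "K #> g \<in> carrier (G Mod K)"
        using ag \<pi>.hom_closed by blast+
      let ?a = "K #> a" and ?b = "K #> b" and ?g = "K #> g"
      have "K #> (a \<otimes> b) = ?a \<otimes>\<^bsub>G Mod K\<^esub> ?b" using ab by (intro \<pi>.hom_mult) auto
      moreover have "?a \<otimes>\<^bsub>G Mod K\<^esub> ?b \<otimes>\<^bsub>G Mod K\<^esub> ?g = ?a \<otimes>\<^bsub>G Mod K\<^esub> (?g \<otimes>\<^bsub>G Mod K\<^esub> ?b)"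
        using ab cl by (simp del: mult_FactGroup add: Q.m_assoc)
      moreover have "\<dots> = (?a \<otimes>\<^bsub>G Mod K\<^esub> ?g) \<otimes>\<^bsub>G Mod K\<^esub> ?b"
        using cl by (simp del: mult_FactGroup add: Q.m_assoc)
      moreover have "\<dots> = ?g \<otimes>\<^bsub>G Mod K\<^esub> (?a \<otimes>\<^bsub>G Mod K\<^esub> ?b)"
        using ab cl by (simp del: mult_FactGroup add: Q.m_assoc)
      ultimately show "a \<otimes> b \<in> ?Z" using ab by (simp del: mult_FactGroup)
    qed auto
    moreover have "K \<subseteq> ?Z"
    proof
      fix k assume k: "k \<in> K"
      then have "K #> k = \<one>\<^bsub>G Mod K\<^esub>" using K.rcos_const[OF is_group] by simp
      then show "k \<in> ?Z"
        using Q.l_one[OF \<pi>.hom_closed[OF ag(2)]] Q.r_one[OF \<pi>.hom_closed[OF ag(2)]] k K.subset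
        by (auto simp del: mult_FactGroup one_FactGroup)
    qed
    moreover have "?Z \<noteq> K" using False ag by blast
    ultimately have "?Z = carrier G" using maximal by blast
    then show ?thesis using ag by blast
  qed
  have "derived G (carrier G) \<subseteq> K"
    unfolding derived_def
  proof (rule generate_subgroup_incl[OF _ K(1)], clarify)
    fix a b assume ab: "a \<in> carrier G" "b \<in> carrier G"
    have "K #> (a \<otimes> b \<otimes> inv a \<otimes> inv b) = (K #> (a \<otimes> b)) \<otimes>\<^bsub>G Mod K\<^esub> inv\<^bsub>G Mod K\<^esub> (K #> (b \<otimes> a))"
      using ab \<pi>.hom_mult[of "a \<otimes> b" "inv (b \<otimes> a)"] \<pi>.hom_inv[of "b \<otimes> a"]
      by (simp del: mult_FactGroup add: m_assoc inv_mult_group)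
    also have "K #> (b \<otimes> a) = K #> (a \<otimes> b)" using central[OF ab] \<pi>.hom_mult ab by metis
    finally have "K #> (a \<otimes> b \<otimes> inv a \<otimes> inv b) = \<one>\<^bsub>G Mod K\<^esub>" using ab Q.r_inv \<pi>.hom_closed m_closed by metis
    then show "a \<otimes> b \<otimes> inv a \<otimes> inv b \<in> K"
      using coset_join1[OF _ _ K(1)] ab K.subset by simp
  qed
  then have inK: "g \<in> K" if g: "g \<in> carrier G" for g
  proof -
    obtain h where h: "h \<in> H" "inv h \<otimes> g \<in> K" using gen[OF g] \<open>derived G (carrier G) \<subseteq> K\<close> by blast
    then have "h \<otimes> (inv h \<otimes> g) \<in> K" using K(2) by blast
    moreover have "h \<otimes> (inv h \<otimes> g) = g"
      using h K(2) K.subset g by (metis inv_solve_left inv_closed m_closed subsetD)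
    ultimately show ?thesis by simp
  qed
  show False using inK K(3) K.subset by blast
qed

section \<open>IA-automorphisms: those inducing the identity on the abelianization\<close>

definition ia_autos :: "('a, 'b) monoid_scheme \<Rightarrow> ('a \<Rightarrow> 'a) set"
  where "ia_autos G = {f \<in> auto G. \<forall>z\<in>carrier G. inv\<^bsub>G\<^esub> z \<otimes>\<^bsub>G\<^esub> f z \<in> derived G (carrier G)}"

lemma AutoGroup_simps:
  "carrier (AutoGroup G) = auto G"
  "\<one>\<^bsub>AutoGroup G\<^esub> = (\<lambda>x\<in>carrier G. x)"
  by (simp_all add: AutoGroup_def BijGroup_def)

lemma AutoGroup_mult:
  "f \<in> auto G \<Longrightarrow> g \<in> auto G \<Longrightarrow> f \<otimes>\<^bsub>AutoGroup G\<^esub> g = compose (carrier G) f g"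
  by (simp add: AutoGroup_def BijGroup_def auto_def)

lemma autoD:
  assumes "f \<in> auto G"
  shows "f \<in> hom G G" "f ` carrier G = carrier G" "inj_on f (carrier G)" "f \<in> extensional (carrier G)"
  using assms by (auto simp: auto_def Bij_def bij_betw_def)

lemma auto_eqI:
  "f \<in> auto G \<Longrightarrow> g \<in> auto G \<Longrightarrow> (\<And>z. z \<in> carrier G \<Longrightarrow> f z = g z) \<Longrightarrow> f = g"
  using autoD(4) by (metis extensionalityI)

text \<open>Displacements telescope: \<open>inv z \<otimes> f (g z)\<close> is the displacement of
  \<open>g\<close> at \<open>z\<close> times that of \<open>f\<close> at \<open>g z\<close>.
  Likewise the displacement of the inverse of \<open>f\<close> at \<open>z\<close> is inverse to one
  of \<open>f\<close>.\<close>

lemma (in group) subgroup_ia_autos: "subgroup (ia_autos G) (AutoGroup G)"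
proof -
  interpret A: group "AutoGroup G" by (rule AutoGroup)
  interpret D: subgroup "derived G (carrier G)" G by (rule derived_is_subgroup) simp
  show ?thesis
  proof (rule A.subgroupI)
    show "ia_autos G \<subseteq> carrier (AutoGroup G)" by (auto simp: ia_autos_def AutoGroup_simps)
    have "(\<lambda>x\<in>carrier G. x) \<in> ia_autos G" by (simp add: ia_autos_def id_in_auto)
    then show "ia_autos G \<noteq> {}" by blast
  next
    fix f assume f: "f \<in> ia_autos G"
    then have fa: "f \<in> auto G" by (simp add: ia_autos_def)
    let ?g = "inv\<^bsub>AutoGroup G\<^esub> f"
    have g: "?g \<in> auto G" using A.inv_closed[of f] fa by (simp add: AutoGroup_simps)
    have "compose (carrier G) f ?g = (\<lambda>x\<in>carrier G. x)"
      using A.r_inv[of f] fa g by (simp add: AutoGroup_simps AutoGroup_mult)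
    then have fg: "f (?g z) = z" if "z \<in> carrier G" for z
      using that by (metis compose_eq restrict_apply')
    have "inv z \<otimes> ?g z \<in> derived G (carrier G)" if z: "z \<in> carrier G" for z
    proof -
      have gz: "?g z \<in> carrier G" using autoD(2)[OF g] z by blast
      then have "inv (?g z) \<otimes> z \<in> derived G (carrier G)"
        using f fg[OF z] by (auto simp: ia_autos_def)
      then have "inv (inv (?g z) \<otimes> z) \<in> derived G (carrier G)" by simp
      then show ?thesis using gz z by (simp add: inv_mult_group)
    qed
    then show "?g \<in> ia_autos G" using g by (simp add: ia_autos_def)
  next
    fix f g assume fg: "f \<in> ia_autos G" "g \<in> ia_autos G"
    then have a: "f \<in> auto G" "g \<in> auto G" by (simp_all add: ia_autos_def)
    have "inv z \<otimes> f (g z) \<in> derived G (carrier G)" if z: "z \<in> carrier G" for z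
    proof -
      have gz: "g z \<in> carrier G" "f (g z) \<in> carrier G" using autoD(2) a z by blast+
      have "(inv z \<otimes> g z) \<otimes> (inv (g z) \<otimes> f (g z)) \<in> derived G (carrier G)"
        using fg z gz by (auto simp: ia_autos_def)
      moreover have "(inv z \<otimes> g z) \<otimes> (inv (g z) \<otimes> f (g z)) = inv z \<otimes> f (g z)"
        using z gz by (metis inv_closed inv_solve_left m_assoc m_closed)
      ultimately show ?thesis by simp
    qed
    moreover have "compose (carrier G) f g \<in> auto G"
      using A.m_closed[of f g] a by (simp add: AutoGroup_simps AutoGroup_mult)
    ultimately show "f \<otimes>\<^bsub>AutoGroup G\<^esub> g \<in> ia_autos G"
      using a by (simp add: AutoGroup_mult ia_autos_def compose_def)
  qed
qed

text \<open>
  \<open>ia_autos G\<close> acts freely on the choice functions of the cosets of the derived subgroup, as the range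
  of such a function generates \<open>G\<close>.
\<close>

lemma (in group) finite_p_group_ia_autos:
  assumes p: "Factorial_Ring.prime p" and G: "finite_p_group p G"
  shows "finite_p_group p (AutoGroup G\<lparr>carrier := ia_autos G\<rparr>)"
proof -
  interpret A: group "AutoGroup G" by (rule AutoGroup)
  let ?D = "derived G (carrier G)"
  interpret D: subgroup ?D G by (rule derived_is_subgroup) simp
  have fin: "finite (carrier G)" using G by (simp add: finite_p_group_def)
  \<comment> \<open>\<open>?C z\<close> is the left coset of \<open>z\<close> modulo the derived
    subgroup. A value is chosen for each \<open>z\<close> separately, not once per coset, so
    \<open>?T\<close> is a plain product of sets of equal size.\<close>
  let ?C = "\<lambda>z. {y \<in> carrier G. inv z \<otimes> y \<in> ?D}"
  let ?T = "PiE (carrier G) ?C"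
  have cardC: "card (?C z) = card ?D" if z: "z \<in> carrier G" for z
  proof (rule bij_betw_same_card[of "\<lambda>y. inv z \<otimes> y"])
    show "bij_betw (\<lambda>y. inv z \<otimes> y) (?C z) ?D"
      by (rule bij_betwI[where g = "\<lambda>d. z \<otimes> d"]) (use z D.subset in \<open>auto simp: m_assoc[symmetric]\<close>)
  qed
  obtain k where k: "card ?D = p ^ k"
    using finite_p_group_subgroup[OF p G] D.subgroup_axioms by (auto simp: finite_p_group_def)
  have cardT: "card ?T = p ^ (k * card (carrier G))"
    using fin cardC k by (simp add: card_PiE power_mult)
  have ia: "f \<in> auto G" if "f \<in> ia_autos G" for f using that by (simp add: ia_autos_def)
  have "finite (auto G)"
    by (rule finite_subset[of _ "PiE (carrier G) (\<lambda>_. carrier G)"])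
      (use fin in \<open>auto simp: auto_def hom_def Bij_def PiE_iff extensional_def intro!: finite_PiE\<close>)
  then have finia: "finite (ia_autos G)" by (rule rev_finite_subset) (auto simp: ia_autos_def)
  interpret L: acting_group "AutoGroup G\<lparr>carrier := ia_autos G\<rparr>" ?T "compose (carrier G)"
  proof (intro acting_group.intro acting_group_axioms.intro)
    show "group (AutoGroup G\<lparr>carrier := ia_autos G\<rparr>)"
      by (rule subgroup.subgroup_is_group[OF subgroup_ia_autos A.is_group])
    show "finite (carrier (AutoGroup G\<lparr>carrier := ia_autos G\<rparr>))" using finia by simp
    show "finite ?T" using fin by (intro finite_PiE) auto
  next
    fix f t assume "f \<in> carrier (AutoGroup G\<lparr>carrier := ia_autos G\<rparr>)" and t: "t \<in> ?T"
    then have f: "f \<in> ia_autos G" by simp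
    have "f (t z) \<in> ?C z" if z: "z \<in> carrier G" for z
    proof -
      have tz: "t z \<in> carrier G" "inv z \<otimes> t z \<in> ?D" using t z by auto
      then have ftz: "f (t z) \<in> carrier G" "inv (t z) \<otimes> f (t z) \<in> ?D"
        using f autoD(2)[OF ia[OF f]] by (auto simp: ia_autos_def)
      then have "(inv z \<otimes> t z) \<otimes> (inv (t z) \<otimes> f (t z)) \<in> ?D" using tz by blast
      moreover have "(inv z \<otimes> t z) \<otimes> (inv (t z) \<otimes> f (t z)) = inv z \<otimes> f (t z)"
        using z tz ftz by (metis inv_closed inv_solve_left m_assoc m_closed)
      ultimately show ?thesis using ftz by simp
    qed
    then show "compose (carrier G) f t \<in> ?T" by (auto simp: compose_def)
  next
    fix t assume "t \<in> ?T"
    then have "t \<in> carrier G \<rightarrow> carrier G" "t \<in> extensional (carrier G)" by (auto simp: PiE_iff)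
    then show "compose (carrier G) \<one>\<^bsub>AutoGroup G\<lparr>carrier := ia_autos G\<rparr>\<^esub> t = t"
      by (simp add: AutoGroup_simps Id_compose)
  next
    fix f g t
    assume "f \<in> carrier (AutoGroup G\<lparr>carrier := ia_autos G\<rparr>)" "g \<in> carrier (AutoGroup G\<lparr>carrier := ia_autos G\<rparr>)"
      and t: "t \<in> ?T"
    then have fg: "f \<in> ia_autos G" "g \<in> ia_autos G" by simp_all
    then have a: "f \<in> auto G" "g \<in> auto G" using ia by blast+
    have tz: "t z \<in> carrier G" if "z \<in> carrier G" for z using t that by auto
    show "compose (carrier G) (f \<otimes>\<^bsub>AutoGroup G\<lparr>carrier := ia_autos G\<rparr>\<^esub> g) t =
      compose (carrier G) f (compose (carrier G) g t)"
      using a tz by (simp add: AutoGroup_mult compose_def cong: restrict_cong)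
  qed
  have "card (ia_autos G) dvd card ?T"
  proof (rule L.card_carrier_dvd_if_free[simplified])
    fix f t assume f: "f \<in> ia_autos G" and t: "t \<in> ?T" and eq: "compose (carrier G) f t = t"
    interpret f: group_hom G G f
      by (intro group_hom.intro group_hom_axioms.intro is_group autoD(1)[OF ia[OF f]])
    have fix1: "f (t z) = t z" if "z \<in> carrier G" for z using eq that by (metis compose_eq)
    let ?H = "{y \<in> carrier G. f y = y}"
    have "?H = carrier G"
    proof (rule subgroup_eq_carrier_if_mod_derived[OF p G])
      show "subgroup ?H G" by (rule subgroupI) (auto intro!: exI[of _ \<one>])
      fix z assume z: "z \<in> carrier G"
      then have tz: "t z \<in> carrier G" "inv z \<otimes> t z \<in> ?D" using t by auto
      then have "inv (inv z \<otimes> t z) \<in> ?D" by simp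
      then have "inv (t z) \<otimes> z \<in> ?D" using z tz by (simp add: inv_mult_group)
      then show "\<exists>h\<in>?H. inv h \<otimes> z \<in> ?D" using tz fix1[OF z] by blast
    qed
    then show "f = \<one>\<^bsub>AutoGroup G\<^esub>"
      using ia[OF f] id_in_auto by (intro auto_eqI[of _ G]) (auto simp: AutoGroup_simps)
  qed
  then obtain m where "card (ia_autos G) = p ^ m"
    unfolding cardT using p divides_primepow_nat by blast
  then show ?thesis using finia L.is_group by (auto simp: finite_p_group_def)
qed

section \<open>Pro-\<open>p\<close> completions\<close>

lemma (in group) rcos_eq_iff:
  assumes "subgroup N G" "a \<in> carrier G" "b \<in> carrier G"
  shows "N #> a = N #> b \<longleftrightarrow> a \<otimes> inv b \<in> N"
proof
  assume "N #> a = N #> b"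
  then have "a \<in> N #> b" using rcos_self[OF assms(2,1)] by simp
  then show "a \<otimes> inv b \<in> N" using subgroup.rcos_module_imp[OF assms(1) is_group assms(3)] by simp
next
  assume "a \<otimes> inv b \<in> N"
  then have "a \<in> N #> b" using subgroup.rcos_module_rev[OF assms(1) is_group assms(3,2)] by simp
  then show "N #> a = N #> b" using repr_independence[OF _ assms(3,1)] by simp
qed

lemma hom_eq_on_generate:
  assumes G: "group G" and H: "group H" and f: "f \<in> hom G H" and g: "g \<in> hom G H"
    and S: "S \<subseteq> carrier G" and eq: "\<And>s. s \<in> S \<Longrightarrow> f s = g s" and a: "a \<in> generate G S"
  shows "f a = g a"
proof -
  interpret f: group_hom G H f by (intro group_hom.intro group_hom_axioms.intro G H f)
  interpret g: group_hom G H g by (intro group_hom.intro group_hom_axioms.intro G H g)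
  show ?thesis
    using a
  proof (induction rule: generate.induct)
    case (inv h) then show ?case using eq S by auto
  next
    case (eng h1 h2)
    then have "h1 \<in> carrier G" "h2 \<in> carrier G" using f.G.generate_in_carrier[OF S] by simp_all
    then show ?case using eng by simp
  qed (simp_all add: eq)
qed

lemma finite_p_group_inj_hom:
  assumes p: "Factorial_Ring.prime p" and G: "group G" and H: "finite_p_group p H"
    and f: "f \<in> hom G H" "inj_on f (carrier G)"
  shows "finite_p_group p G"
proof -
  interpret G: group G by (rule G)
  interpret H: group H using H by (simp add: finite_p_group_def)
  interpret f: group_hom G H f by (intro group_hom.intro group_hom_axioms.intro G.is_group H.is_group f)
  have "finite_p_group p (H\<lparr>carrier := f ` carrier G\<rparr>)"
    by (rule finite_p_group_subgroup[OF p H f.img_is_subgroup])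
  then show ?thesis
    using f G card_image[OF f(2)] finite_imageD[OF _ f(2)] by (auto simp: finite_p_group_def)
qed

lemma finite_p_group_DirProd:
  assumes "finite_p_group p G" "finite_p_group p H"
  shows "finite_p_group p (G \<times>\<times> H)"
proof -
  obtain k l where "card (carrier G) = p ^ k" "card (carrier H) = p ^ l"
    using assms by (auto simp: finite_p_group_def)
  then have "card (carrier (G \<times>\<times> H)) = p ^ (k + l)" by (simp add: card_cartesian_product power_add)
  then show ?thesis using assms DirProd_group by (auto simp: finite_p_group_def)
qed

locale pro_p_group = group G for G (structure) +
  fixes p :: nat
  assumes prime_p: "Factorial_Ring.prime p"
begin

abbreviation "K \<equiv> p_quotient_kernels p G"
abbreviation "P \<equiv> pro_p_completion p G"
abbreviation "T \<equiv> pro_p_topology p G"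

lemma K_normal: "N \<in> K \<Longrightarrow> N \<lhd> G"
  by (simp add: p_quotient_kernels_def)

lemma K_subgroup: "N \<in> K \<Longrightarrow> subgroup N G"
  by (simp add: K_normal normal_imp_subgroup)

lemma K_iff: "N \<in> K \<longleftrightarrow> N \<lhd> G \<and> finite_p_group p (G Mod N)"
  by (auto simp: p_quotient_kernels_def finite_p_group_def normal.factorgroup_is_group)

lemma K_group: "N \<in> K \<Longrightarrow> group (G Mod N)"
  by (simp add: K_normal normal.factorgroup_is_group)

lemma quot_hom: "N \<in> K \<Longrightarrow> (\<lambda>a. N #> a) \<in> hom G (G Mod N)"
  by (simp add: K_normal normal.r_coset_hom_Mod)

lemma quot_mult: "N \<in> K \<Longrightarrow> a \<in> carrier G \<Longrightarrow> b \<in> carrier G \<Longrightarrow>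
    (N #> a) <#> (N #> b) = N #> (a \<otimes> b)"
  by (simp add: K_normal normal.rcos_sum)

text \<open>The quotient by the kernel embeds into \<open>H\<close>. Hence the kernels of all
  homomorphisms to finite \<open>p\<close>-groups are among the coordinates of the
  completion.\<close>

lemma kernel_in_K:
  assumes H: "finite_p_group p H" and f: "f \<in> hom G H"
  shows "kernel G H f \<in> K"
proof -
  interpret H: group H using H by (simp add: finite_p_group_def)
  interpret f: group_hom G H f by (intro group_hom.intro group_hom_axioms.intro is_group H.is_group f)
  interpret N: normal "kernel G H f" G by (rule f.normal_kernel)
  have "finite_p_group p (G Mod kernel G H f)"
    by (rule finite_p_group_inj_hom[OF prime_p N.factorgroup_is_group H f.FactGroup_hom f.FactGroup_inj_on])
  then show ?thesis using f.normal_kernel by (simp add: K_iff)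
qed

lemma kernel_quot:
  assumes N: "N \<in> K"
  shows "kernel G (G Mod N) (\<lambda>a. N #> a) = N"
proof -
  interpret N: subgroup N G by (rule K_subgroup[OF N])
  have "N #> a = N \<longleftrightarrow> a \<in> N" if "a \<in> carrier G" for a
    using coset_join1[OF _ that N.subgroup_axioms] coset_join2[OF that N.subgroup_axioms] by metis
  then show ?thesis using N.subset unfolding kernel_def by auto
qed

lemma carrier_in_K: "carrier G \<in> K"
proof -
  interpret N: normal "carrier G" G by (simp add: normal_inv_iff subgroup_self)
  have "carrier (G Mod carrier G) = {carrier G}"
    using coset_join2[OF _ subgroup_self] by (auto simp: carrier_FactGroup)
  then have "card (carrier (G Mod carrier G)) = p ^ 0" "finite (carrier (G Mod carrier G))" by simp_all
  then have "finite_p_group p (G Mod carrier G)"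
    using N.factorgroup_is_group by (auto simp only: finite_p_group_def)
  then show ?thesis using N.normal_axioms by (simp add: K_iff)
qed

text \<open>The intersection is the kernel of the diagonal map into the direct product of the two
  quotients.\<close>

lemma Int_in_K:
  assumes N: "N \<in> K" and M: "M \<in> K"
  shows "N \<inter> M \<in> K"
proof -
  let ?f = "\<lambda>a. (N #> a, M #> a)"
  have f: "?f \<in> hom G ((G Mod N) \<times>\<times> (G Mod M))"
    using hom_paired[of ?f] quot_hom[OF N] quot_hom[OF M] by (simp add: hom_paired)
  have "N \<inter> M = kernel G (G Mod N) (\<lambda>a. N #> a) \<inter> kernel G (G Mod M) (\<lambda>a. M #> a)"
    using kernel_quot N M by simp
  also have "\<dots> = kernel G ((G Mod N) \<times>\<times> (G Mod M)) ?f"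
    by (auto simp: kernel_def)
  also have "\<dots> \<in> K"
    using f N M by (intro kernel_in_K finite_p_group_DirProd) (simp_all add: K_iff)
  finally show ?thesis .
qed

lemma Inter_in_K: "finite S \<Longrightarrow> S \<noteq> {} \<Longrightarrow> S \<subseteq> K \<Longrightarrow> \<Inter>S \<in> K"
  by (induction S rule: finite_ne_induct) (auto intro: Int_in_K)

lemma mem_P: "x \<in> carrier P \<longleftrightarrow> x \<in> (\<Pi>\<^sub>E N\<in>K. carrier (G Mod N)) \<and>
    (\<forall>N\<in>K. \<forall>M\<in>K. N \<subseteq> M \<longrightarrow> x M = M <#> x N)"
  by (simp add: pro_p_completion_def)

lemma P_subset: "carrier P \<subseteq> (\<Pi>\<^sub>E N\<in>K. carrier (G Mod N))"
  unfolding pro_p_completion_def by auto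

lemma P_coord: "x \<in> carrier P \<Longrightarrow> N \<in> K \<Longrightarrow> x N \<in> carrier (G Mod N)"
  unfolding mem_P by (blast dest: PiE_mem)

lemma P_compat: "x \<in> carrier P \<Longrightarrow> N \<in> K \<Longrightarrow> M \<in> K \<Longrightarrow> N \<subseteq> M \<Longrightarrow> x M = M <#> x N"
  unfolding mem_P by blast

lemma P_group: "group P"
  by (rule group_pro_p_completion[OF is_group])

sublocale P: group P by (rule P_group)

lemma set_mult_rcos:
  assumes "N \<in> K" "M \<in> K" "N \<subseteq> M" "a \<in> carrier G"
  shows "M <#> (N #> a) = M #> a"
proof -
  have MN: "subgroup M G" "subgroup N G" using assms K_subgroup by auto
  have "M <#> N = M" using set_mult_subgroup_idem[OF MN(1)] assms MN by (simp add: subgroup_incl)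
  then show ?thesis using assms MN subgroup.subset by (metis setmult_rcos_assoc)
qed

lemma P_coset_ex: "x \<in> carrier P \<Longrightarrow> N \<in> K \<Longrightarrow> \<exists>a\<in>carrier G. x N = N #> a"
  using P_coord[of x N] by (auto simp: carrier_FactGroup)

lemma P_coset_mono:
  "x \<in> carrier P \<Longrightarrow> N \<in> K \<Longrightarrow> M \<in> K \<Longrightarrow> N \<subseteq> M \<Longrightarrow> a \<in> carrier G \<Longrightarrow> x N = N #> a \<Longrightarrow> x M = M #> a"
  using P_compat[of x N M] set_mult_rcos[of N M a] by simp

lemma P_agree_mono:
  "x \<in> carrier P \<Longrightarrow> y \<in> carrier P \<Longrightarrow> N \<in> K \<Longrightarrow> M \<in> K \<Longrightarrow> N \<subseteq> M \<Longrightarrow> x N = y N \<Longrightarrow> x M = y M"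
  using P_compat[of x N M] P_compat[of y N M] by simp

text \<open>Density of \<open>G\<close> in \<open>P\<close>: a representative at the intersection of
  \<open>S\<close> serves all coordinates in \<open>S\<close>. Inserting \<open>carrier G\<close>
  covers the case that \<open>S\<close> is empty.\<close>

lemma P_approx:
  assumes x: "x \<in> carrier P" and S: "finite S" "S \<subseteq> K"
  shows "\<exists>a\<in>carrier G. \<forall>N\<in>S. x N = N #> a"
proof -
  let ?S = "insert (carrier G) S"
  have I: "\<Inter>?S \<in> K" using S carrier_in_K by (intro Inter_in_K) auto
  obtain a where a: "a \<in> carrier G" "x (\<Inter>?S) = \<Inter>?S #> a" using P_coset_ex[OF x I] by blast
  have "x N = N #> a" if N: "N \<in> S" for N
  proof (rule P_coset_mono[OF x I _ _ a])
    show "N \<in> K" using N S by blast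
    show "\<Inter>?S \<subseteq> N" using N by blast
  qed
  then show ?thesis using a by blast
qed

text \<open>A coordinate is determined by any finer one, so agreement on a cofinal family suffices.
  This permits passing from \<open>N\<close> to a smaller invariant subgroup.\<close>

lemma P_eqI:
  assumes "x \<in> carrier P" "y \<in> carrier P" "\<And>N. N \<in> K \<Longrightarrow> \<exists>M\<in>K. M \<subseteq> N \<and> x M = y M"
  shows "x = y"
proof (rule PiE_ext[of _ K "\<lambda>N. carrier (G Mod N)"])
  fix N assume N: "N \<in> K"
  then obtain M where "M \<in> K" "M \<subseteq> N" "x M = y M" using assms(3) by blast
  then show "x N = y N" using P_agree_mono[OF assms(1,2) _ N] by simp
qed (use assms(1,2) mem_P in simp_all)

lemma P_mult: "N \<in> K \<Longrightarrow> (x \<otimes>\<^bsub>P\<^esub> y) N = x N <#> y N"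
  by (simp add: pro_p_completion_def)

lemma P_mult_rcos:
  "N \<in> K \<Longrightarrow> a \<in> carrier G \<Longrightarrow> b \<in> carrier G \<Longrightarrow> x N = N #> a \<Longrightarrow> y N = N #> b \<Longrightarrow>
    (x \<otimes>\<^bsub>P\<^esub> y) N = N #> (a \<otimes> b)"
  by (simp add: P_mult quot_mult)

lemma P_one: "N \<in> K \<Longrightarrow> \<one>\<^bsub>P\<^esub> N = N"
  by (simp add: pro_p_completion_def)

lemma coord_hom: "N \<in> K \<Longrightarrow> (\<lambda>x. x N) \<in> hom P (G Mod N)"
  by (rule homI) (simp_all add: P_mult P_coord)

lemma coord_group_hom: "N \<in> K \<Longrightarrow> group_hom P (G Mod N) (\<lambda>x. x N)"
  by (intro group_hom.intro group_hom_axioms.intro coord_hom K_group P_group)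

definition emb :: "'a \<Rightarrow> 'a set \<Rightarrow> 'a set" where "emb a = (\<lambda>N\<in>K. N #> a)"

lemma emb_apply: "N \<in> K \<Longrightarrow> emb a N = N #> a"
  by (simp add: emb_def)

lemma emb_closed: "a \<in> carrier G \<Longrightarrow> emb a \<in> carrier P"
  unfolding mem_P by (auto simp: emb_def carrier_FactGroup set_mult_rcos)

lemma emb_hom: "emb \<in> hom G P"
proof (rule homI)
  fix a b assume ab: "a \<in> carrier G" "b \<in> carrier G"
  show "emb (a \<otimes> b) = emb a \<otimes>\<^bsub>P\<^esub> emb b"
  proof (rule P_eqI)
    fix N assume "N \<in> K"
    then show "\<exists>M\<in>K. M \<subseteq> N \<and> emb (a \<otimes> b) M = (emb a \<otimes>\<^bsub>P\<^esub> emb b) M"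
      using ab by (intro bexI[of _ N]) (simp_all add: P_mult emb_apply quot_mult)
  qed (simp_all add: ab emb_closed)
qed (rule emb_closed)

text \<open>The value of \<open>hat H f\<close> does not depend on the choice of the representative.\<close>

definition hat :: "('c, 'd) monoid_scheme \<Rightarrow> ('a \<Rightarrow> 'c) \<Rightarrow> ('a set \<Rightarrow> 'a set) \<Rightarrow> 'c"
  where "hat H f x = f (SOME a. a \<in> carrier G \<and> x (kernel G H f) = kernel G H f #> a)"

lemma hom_eq_if_coset_eq:
  assumes "group H" "f \<in> hom G H" "a \<in> carrier G" "b \<in> carrier G" "kernel G H f #> a = kernel G H f #> b"
  shows "f a = f b"
proof -
  interpret f: group_hom G H f
    by (intro group_hom.intro group_hom_axioms.intro is_group assms)
  have "a \<otimes> inv b \<in> kernel G H f"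
    using rcos_eq_iff[OF f.subgroup_kernel assms(3,4)] assms(5) by simp
  then have "f a \<otimes>\<^bsub>H\<^esub> inv\<^bsub>H\<^esub> f b = \<one>\<^bsub>H\<^esub>" using assms by (simp add: kernel_def)
  then show ?thesis using assms by (metis f.H.inv_solve_right f.H.l_one f.H.one_closed f.hom_closed)
qed

lemma hat_eq:
  assumes "group H" "f \<in> hom G H" "a \<in> carrier G" "x (kernel G H f) = kernel G H f #> a"
  shows "hat H f x = f a"
  unfolding hat_def
proof (rule someI2[of _ a])
  fix b assume "b \<in> carrier G \<and> x (kernel G H f) = kernel G H f #> b"
  then show "f b = f a" using hom_eq_if_coset_eq[OF assms(1,2)] assms by metis
qed (use assms in simp)

lemma hat_ex:
  assumes "finite_p_group p H" "f \<in> hom G H" "x \<in> carrier P"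
  shows "\<exists>a\<in>carrier G. x (kernel G H f) = kernel G H f #> a \<and> hat H f x = f a"
proof -
  obtain a where a: "a \<in> carrier G" "x (kernel G H f) = kernel G H f #> a"
    using P_coset_ex[OF assms(3) kernel_in_K[OF assms(1,2)]] by blast
  moreover have "hat H f x = f a"
    using assms(1) by (intro hat_eq[of H f a x] assms(2) a) (simp add: finite_p_group_def)
  ultimately show ?thesis by blast
qed

lemma hat_hom:
  assumes H: "finite_p_group p H" and f: "f \<in> hom G H"
  shows "hat H f \<in> hom P H"
proof (rule homI)
  have gH: "group H" using H by (simp add: finite_p_group_def)
  fix x y assume x: "x \<in> carrier P" and y: "y \<in> carrier P"
  obtain a where a: "a \<in> carrier G" "x (kernel G H f) = kernel G H f #> a" "hat H f x = f a"
    using hat_ex[OF H f x] by blast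
  obtain b where b: "b \<in> carrier G" "y (kernel G H f) = kernel G H f #> b" "hat H f y = f b"
    using hat_ex[OF H f y] by blast
  have "hat H f (x \<otimes>\<^bsub>P\<^esub> y) = f (a \<otimes> b)"
    using a b by (intro hat_eq[OF gH f] P_mult_rcos kernel_in_K[OF H f]) auto
  then show "hat H f (x \<otimes>\<^bsub>P\<^esub> y) = hat H f x \<otimes>\<^bsub>H\<^esub> hat H f y"
    using a b f by (simp add: hom_mult)
next
  fix x assume x: "x \<in> carrier P"
  then show "hat H f x \<in> carrier H" using hat_ex[OF H f x] f by (auto simp: hom_def)
qed

lemma hat_emb:
  assumes "finite_p_group p H" "f \<in> hom G H" "a \<in> carrier G"
  shows "hat H f (emb a) = f a"
proof (rule hat_eq[OF _ assms(2,3)])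
  show "emb a (kernel G H f) = kernel G H f #> a" by (rule emb_apply[OF kernel_in_K[OF assms(1,2)]])
qed (use assms in \<open>simp add: finite_p_group_def\<close>)

section \<open>The topology of the completion\<close>

lemma topspace_T: "topspace T = carrier P"
  using P_subset by (simp add: pro_p_topology_def Int_absorb1)

text \<open>As the kernels are closed under finite intersections, a single coordinate describes a
  basic neighbourhood. Continuity thereby becomes a matter of agreement of coordinates.\<close>

lemma openin_T_iff:
  "openin T U \<longleftrightarrow> U \<subseteq> carrier P \<and> (\<forall>z\<in>U. \<exists>N\<in>K. \<forall>z'\<in>carrier P. z' N = z N \<longrightarrow> z' \<in> U)"
proof
  assume U: "openin T U"
  have "\<exists>N\<in>K. \<forall>z'\<in>carrier P. z' N = z N \<longrightarrow> z' \<in> U" if z: "z \<in> U" for z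
  proof -
    obtain V where V: "openin (product_topology (\<lambda>N. discrete_topology (carrier (G Mod N))) K) V"
      "U = V \<inter> carrier P"
      using U unfolding pro_p_topology_def openin_subtopology by blast
    then have "z \<in> V" using z by simp
    from bspec[OF V(1)[unfolded openin_product_topology_alt] this] obtain W where W: "finite {N \<in> K. W N \<noteq> topspace (discrete_topology (carrier (G Mod N)))}"
      "z \<in> PiE K W" "PiE K W \<subseteq> V"
      by (elim exE conjE)
    \<comment> \<open>The finitely many coordinates that \<open>W\<close> restricts;
      \<open>carrier G\<close> keeps the family nonempty.\<close>
    let ?F = "insert (carrier G) {N \<in> K. W N \<noteq> carrier (G Mod N)}"
    have I: "\<Inter>?F \<in> K" using W(1) carrier_in_K by (intro Inter_in_K) simp_all
    have "z' \<in> U" if z': "z' \<in> carrier P" "z' (\<Inter>?F) = z (\<Inter>?F)" for z'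
    proof -
      have zP: "z \<in> carrier P" using z V by simp
      have "z' N \<in> W N" if N: "N \<in> K" for N
      proof (cases "W N = carrier (G Mod N)")
        case True then show ?thesis using P_coord[OF z'(1) N] by simp
      next
        case False
        then have "\<Inter>?F \<subseteq> N" using N by blast
        then have "z' N = z N" by (rule P_agree_mono[OF z'(1) zP I N _ z'(2)])
        then show ?thesis using PiE_mem[OF W(2) N] by simp
      qed
      moreover have "z' \<in> extensional K" using z'(1) unfolding mem_P PiE_iff by blast
      ultimately have "z' \<in> PiE K W" unfolding PiE_iff by blast
      then show ?thesis using W(3) V(2) z'(1) by blast
    qed
    then show ?thesis using I by blast
  qed
  moreover have "U \<subseteq> carrier P" using openin_subset[OF U] topspace_T by simp
  ultimately show "U \<subseteq> carrier P \<and> (\<forall>z\<in>U. \<exists>N\<in>K. \<forall>z'\<in>carrier P. z' N = z N \<longrightarrow> z' \<in> U)" by blast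
next
  assume U: "U \<subseteq> carrier P \<and> (\<forall>z\<in>U. \<exists>N\<in>K. \<forall>z'\<in>carrier P. z' N = z N \<longrightarrow> z' \<in> U)"
  show "openin T U"
  proof (subst openin_subopen, intro ballI)
    fix z assume z: "z \<in> U"
    then obtain N where N: "N \<in> K" "\<forall>z'\<in>carrier P. z' N = z N \<longrightarrow> z' \<in> U" using U by blast
    let ?V = "{x \<in> carrier P. x N = z N}"
    have zP: "z \<in> carrier P" using z U by blast
    have "openin (product_topology (\<lambda>N. discrete_topology (carrier (G Mod N))) K)
      {x \<in> topspace (product_topology (\<lambda>N. discrete_topology (carrier (G Mod N))) K). x N \<in> {z N}}"
      using P_coord[OF zP N(1)]
      by (intro openin_continuous_map_preimage[OF continuous_map_product_projection[OF N(1)]]) simp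
    moreover have "?V = {x \<in> topspace (product_topology (\<lambda>N. discrete_topology (carrier (G Mod N))) K).
      x N \<in> {z N}} \<inter> carrier P"
      using P_subset by auto
    ultimately have "openin T ?V"
      unfolding pro_p_topology_def openin_subtopology by blast
    moreover have "z \<in> ?V" "?V \<subseteq> U" using zP N by auto
    ultimately show "\<exists>V. openin T V \<and> z \<in> V \<and> V \<subseteq> U" by blast
  qed
qed

lemma openin_coord: "N \<in> K \<Longrightarrow> openin T {x \<in> carrier P. x N \<in> A}"
  unfolding openin_T_iff by (intro conjI ballI bexI[of _ N]) auto

lemma Hausdorff_T: "Hausdorff_space T"
  unfolding pro_p_topology_def
  by (intro Hausdorff_space_subtopology) (auto simp: Hausdorff_space_product_topology Hausdorff_space_discrete_topology)

text \<open>The compatibility conditions are closed, so \<open>P\<close> is a closed subset of a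
  product of finite discrete spaces.\<close>

lemma compact_T: "compact_space T"
proof -
  let ?X = "product_topology (\<lambda>N. discrete_topology (carrier (G Mod N))) K"
  have "compact_space ?X"
    unfolding compact_space_product_topology
    by (auto simp: compact_space_discrete_topology K_iff finite_p_group_def)
  moreover have "closedin ?X (carrier P)"
  proof -
    have "closedin ?X {x \<in> topspace ?X. x M = M <#> x N}" if NM: "N \<in> K" "M \<in> K" for N M
    proof -
      \<comment> \<open>The condition involves two coordinates only; splitting it by the finitely
        many values \<open>c\<close> at \<open>N\<close> gives a finite union of closed
        sets.\<close>
      let ?A = "\<lambda>c. {x \<in> topspace ?X. x N \<in> {c}} \<inter> {x \<in> topspace ?X. x M \<in> {y \<in> carrier (G Mod M). y = M <#> c}}"
      have "closedin ?X (?A c)" if c: "c \<in> carrier (G Mod N)" for c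
        using c NM
        by (intro closedin_Int closedin_continuous_map_preimage[OF continuous_map_product_projection]) auto
      then have "closedin ?X (\<Union>c\<in>carrier (G Mod N). ?A c)"
        using NM by (intro closedin_Union) (auto simp: K_iff finite_p_group_def)
      moreover have "(\<Union>c\<in>carrier (G Mod N). ?A c) = {x \<in> topspace ?X. x M = M <#> x N}"
        using PiE_mem[of _ K "\<lambda>N. carrier (G Mod N)"] NM by fastforce
      ultimately show ?thesis by simp
    qed
    then have "closedin ?X (\<Inter>N\<in>K. \<Inter>M\<in>{M\<in>K. N \<subseteq> M}. {x \<in> topspace ?X. x M = M <#> x N})"
      using carrier_in_K by (intro closedin_INT) blast+
    moreover have "(\<Inter>N\<in>K. \<Inter>M\<in>{M\<in>K. N \<subseteq> M}. {x \<in> topspace ?X. x M = M <#> x N}) = carrier P"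
      (is "?L = _")
    proof
      show "carrier P \<subseteq> ?L" using P_subset P_compat by auto
      show "?L \<subseteq> carrier P"
      proof
        fix x assume x: "x \<in> ?L"
        have mem: "x \<in> {x \<in> topspace ?X. x M = M <#> x N}" if NM: "N \<in> K" "M \<in> K" "N \<subseteq> M" for M N
          using INT_D[OF INT_D[OF x NM(1)], of M] NM by simp
        have "x M = M <#> x N" if "N \<in> K" "M \<in> K" "N \<subseteq> M" for M N
          using mem[OF that] by simp
        moreover have "x \<in> topspace ?X" using mem[OF carrier_in_K carrier_in_K] by simp
        ultimately show "x \<in> carrier P" using mem_P[of x] topspace_product_topology topspace_discrete_topology
          by (metis (no_types, lifting) PiE_cong)
      qed
    qed
    ultimately show ?thesis by simp
  qed
  ultimately show ?thesis
    unfolding pro_p_topology_def by (simp add: closedin_compact_space compact_space_subtopology)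
qed

end

section \<open>Continuous automorphisms\<close>

lemma (in group_hom) derived_closed_img:
  "a \<in> derived G (carrier G) \<Longrightarrow> h a \<in> derived H (carrier H)"
proof -
  assume a: "a \<in> derived G (carrier G)"
  have "derived H (h ` carrier G) \<subseteq> derived H (carrier H)"
    by (rule H.mono_derived) auto
  then show ?thesis using derived_img[of "carrier G"] a by blast
qed

context pro_p_group
begin

lemma coord_inv_mult:
  assumes "x \<in> carrier P" "y \<in> carrier P" "N \<in> K"
  shows "x N = y N \<longleftrightarrow> (x \<otimes>\<^bsub>P\<^esub> inv\<^bsub>P\<^esub> y) N = N"
proof -
  interpret c: group_hom P "G Mod N" "\<lambda>x. x N" by (rule coord_group_hom[OF assms(3)])
  have "(x \<otimes>\<^bsub>P\<^esub> inv\<^bsub>P\<^esub> y) N = x N \<otimes>\<^bsub>G Mod N\<^esub> inv\<^bsub>G Mod N\<^esub> y N"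
    using assms c.hom_mult[of x "inv\<^bsub>P\<^esub> y"] c.hom_inv[of y] by simp
  moreover have "x N \<otimes>\<^bsub>G Mod N\<^esub> inv\<^bsub>G Mod N\<^esub> y N = \<one>\<^bsub>G Mod N\<^esub> \<longleftrightarrow> x N = y N"
    using P_coord assms by (metis c.H.inv_solve_right' c.H.l_one c.H.one_closed)
  ultimately show ?thesis by simp
qed

lemma continuous_map_TI:
  assumes "\<And>z. z \<in> carrier P \<Longrightarrow> f z \<in> carrier P"
    and "\<And>N z. N \<in> K \<Longrightarrow> z \<in> carrier P \<Longrightarrow> \<exists>M\<in>K. \<forall>z'\<in>carrier P. z' M = z M \<longrightarrow> f z' N = f z N"
  shows "continuous_map T T f"
  unfolding continuous_map_def topspace_T
proof (intro conjI allI impI)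
  show "f \<in> carrier P \<rightarrow> carrier P" using assms(1) by blast
  fix U assume U: "openin T U"
  have nb: "\<exists>M\<in>K. \<forall>z'\<in>carrier P. z' M = z M \<longrightarrow> f z' \<in> U" if z: "z \<in> carrier P" "f z \<in> U" for z
  proof -
    obtain N where N: "N \<in> K" "\<forall>z'\<in>carrier P. z' N = f z N \<longrightarrow> z' \<in> U"
      using U z(2) unfolding openin_T_iff by blast
    obtain M where M: "M \<in> K" "\<forall>z'\<in>carrier P. z' M = z M \<longrightarrow> f z' N = f z N"
      using assms(2)[OF N(1) z(1)] by blast
    have "f z' \<in> U" if "z' \<in> carrier P" "z' M = z M" for z'
      using N(2) assms(1)[OF that(1)] M(2) that by simp
    then show ?thesis using M(1) by blast
  qed
  show "openin T {x \<in> carrier P. f x \<in> U}" unfolding openin_T_iff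
  proof (intro conjI ballI)
    fix z assume "z \<in> {x \<in> carrier P. f x \<in> U}"
    then have "z \<in> carrier P" "f z \<in> U" by simp_all
    from nb[OF this] obtain M where "M \<in> K" "\<forall>z'\<in>carrier P. z' M = z M \<longrightarrow> f z' \<in> U" by (elim bexE)
    then show "\<exists>M\<in>K. \<forall>z'\<in>carrier P. z' M = z M \<longrightarrow> z' \<in> {x \<in> carrier P. f x \<in> U}"
      by (intro bexI[of _ M]) simp_all
  qed simp
qed

lemma continuous_map_TD:
  assumes f: "continuous_map T T f" and N: "N \<in> K" and z: "z \<in> carrier P"
  shows "\<exists>M\<in>K. \<forall>z'\<in>carrier P. z' M = z M \<longrightarrow> f z' N = f z N"
proof -
  let ?V = "{x \<in> topspace T. f x \<in> {x \<in> carrier P. x N \<in> {f z N}}}"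
  have "openin T ?V"
    by (rule openin_continuous_map_preimage[OF f openin_coord[OF N]])
  moreover have "f z \<in> carrier P" using continuous_map_funspace[OF f] z topspace_T by auto
  then have "z \<in> ?V" using z topspace_T by simp
  ultimately have "\<exists>M\<in>K. \<forall>z'\<in>carrier P. z' M = z M \<longrightarrow> z' \<in> ?V"
    by (rule bspec[OF conjunct2[OF openin_T_iff[THEN iffD1]]])
  then obtain M where M: "M \<in> K" "\<forall>z'\<in>carrier P. z' M = z M \<longrightarrow> z' \<in> ?V" by (elim bexE)
  then show ?thesis by (intro bexI[of _ M]) simp_all
qed

lemma cont_autoD:
  assumes "f \<in> cont_auto P T"
  shows "f \<in> auto P" "f \<in> hom P P" "continuous_map T T f" "\<And>z. z \<in> carrier P \<Longrightarrow> f z \<in> carrier P"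
    "f ` carrier P = carrier P" "inj_on f (carrier P)" "group_hom P P f"
  using assms autoD[of f P] P_group by (auto simp: cont_auto_def group_hom_def group_hom_axioms_def)

lemma subgroup_cont_auto: "subgroup (cont_auto P T) (AutoGroup P)"
proof -
  interpret A: group "AutoGroup P" by (rule P.AutoGroup)
  show ?thesis
  proof (rule A.subgroupI)
    show "cont_auto P T \<subseteq> carrier (AutoGroup P)" by (auto simp: cont_auto_def AutoGroup_simps)
    have "continuous_map T T (\<lambda>x\<in>carrier P. x)"
      by (rule continuous_map_eq[OF continuous_map_id]) (simp add: topspace_T)
    then have "(\<lambda>x\<in>carrier P. x) \<in> cont_auto P T" using P.id_in_auto by (simp add: cont_auto_def)
    then show "cont_auto P T \<noteq> {}" by blast
  next
    fix f assume f: "f \<in> cont_auto P T"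
    let ?h = "inv\<^bsub>AutoGroup P\<^esub> f"
    have fa: "f \<in> carrier (AutoGroup P)" using cont_autoD(1)[OF f] by (simp add: AutoGroup_simps)
    have h: "?h \<in> auto P" using A.inv_closed[OF fa] by (simp add: AutoGroup_simps)
    have "compose (carrier P) f ?h = (\<lambda>x\<in>carrier P. x)"
      using A.r_inv[OF fa] h cont_autoD(1)[OF f] by (simp add: AutoGroup_simps(2) AutoGroup_mult)
    then have fh: "f (?h z) = z" if "z \<in> carrier P" for z
      using that fun_cong[of _ _ z] compose_eq[of z "carrier P" f ?h] by fastforce
    have "homeomorphic_map T T f"
      using cont_autoD[OF f] compact_T Hausdorff_T
      by (intro continuous_imp_homeomorphic_map) (simp_all add: topspace_T)
    then obtain g where "homeomorphic_maps T T f g" by (auto simp: homeomorphic_map_maps)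
    then have g: "continuous_map T T g" "\<And>x. x \<in> carrier P \<Longrightarrow> g (f x) = x"
      by (auto simp: homeomorphic_maps_def topspace_T)
    have "?h z \<in> carrier P" if "z \<in> carrier P" for z using autoD(2)[OF h] that by blast
    then have "g z = ?h z" if "z \<in> carrier P" for z using g(2) fh that by metis
    then have "continuous_map T T ?h" using continuous_map_eq[OF g(1)] by (simp add: topspace_T)
    then show "?h \<in> cont_auto P T" using h by (simp add: cont_auto_def)
  next
    fix f g assume fg: "f \<in> cont_auto P T" "g \<in> cont_auto P T"
    then have a: "f \<in> auto P" "g \<in> auto P" by (simp_all add: cont_auto_def)
    have "continuous_map T T (compose (carrier P) f g)"
      by (rule continuous_map_eq[OF continuous_map_compose[OF cont_autoD(3)[OF fg(2)] cont_autoD(3)[OF fg(1)]]])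
        (simp add: topspace_T compose_def)
    moreover have "compose (carrier P) f g \<in> auto P"
      using A.m_closed[of f g] a by (simp add: AutoGroup_simps AutoGroup_mult)
    ultimately show "f \<otimes>\<^bsub>AutoGroup P\<^esub> g \<in> cont_auto P T"
      using a by (simp add: AutoGroup_mult cont_auto_def)
  qed
qed

abbreviation "\<A> \<equiv> ContAutoGroup P T"

lemma group_\<A>: "group \<A>"
  unfolding ContAutoGroup_def
  by (rule subgroup.subgroup_is_group[OF subgroup_cont_auto P.AutoGroup])

sublocale A: group \<A> by (rule group_\<A>)

lemma carrier_\<A>: "carrier \<A> = cont_auto P T"
  by (simp add: ContAutoGroup_def)

lemma one_\<A>: "\<one>\<^bsub>\<A>\<^esub> = (\<lambda>x\<in>carrier P. x)"
  by (simp add: ContAutoGroup_def AutoGroup_simps)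

lemma mult_\<A>: "f \<in> cont_auto P T \<Longrightarrow> g \<in> cont_auto P T \<Longrightarrow> f \<otimes>\<^bsub>\<A>\<^esub> g = compose (carrier P) f g"
  by (simp add: ContAutoGroup_def AutoGroup_mult cont_auto_def)

lemma mult_\<A>_apply:
  "f \<in> cont_auto P T \<Longrightarrow> g \<in> cont_auto P T \<Longrightarrow> z \<in> carrier P \<Longrightarrow> (f \<otimes>\<^bsub>\<A>\<^esub> g) z = f (g z)"
  by (simp add: mult_\<A> compose_def)

lemma inv_\<A>_apply:
  assumes f: "f \<in> cont_auto P T" and z: "z \<in> carrier P"
  shows "f ((inv\<^bsub>\<A>\<^esub> f) z) = z" "(inv\<^bsub>\<A>\<^esub> f) (f z) = z"
proof -
  have i: "inv\<^bsub>\<A>\<^esub> f \<in> cont_auto P T" using A.inv_closed[of f] f by (simp add: carrier_\<A>)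
  show "f ((inv\<^bsub>\<A>\<^esub> f) z) = z"
    using mult_\<A>_apply[OF f i z] A.r_inv[of f] f z by (simp add: carrier_\<A> one_\<A>)
  show "(inv\<^bsub>\<A>\<^esub> f) (f z) = z"
    using mult_\<A>_apply[OF i f z] A.l_inv[of f] f z by (simp add: carrier_\<A> one_\<A>)
qed

lemma inv_\<A>_closed: "f \<in> cont_auto P T \<Longrightarrow> inv\<^bsub>\<A>\<^esub> f \<in> cont_auto P T"
  using A.inv_closed[of f] by (simp add: carrier_\<A>)

lemma mult_\<A>_closed: "f \<in> cont_auto P T \<Longrightarrow> g \<in> cont_auto P T \<Longrightarrow> f \<otimes>\<^bsub>\<A>\<^esub> g \<in> cont_auto P T"
  using A.m_closed[of f g] by (simp add: carrier_\<A>)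

lemma cont_auto_eqI:
  "f \<in> cont_auto P T \<Longrightarrow> g \<in> cont_auto P T \<Longrightarrow> (\<And>z. z \<in> carrier P \<Longrightarrow> f z = g z) \<Longrightarrow> f = g"
  by (rule auto_eqI[of _ P]) (auto simp: cont_auto_def)

section \<open>Endomorphisms of the completion induced by endomorphisms of \<open>G\<close>\<close>

definition ind :: "('a \<Rightarrow> 'a) \<Rightarrow> ('a set \<Rightarrow> 'a set) \<Rightarrow> 'a set \<Rightarrow> 'a set"
  where "ind \<alpha> = (\<lambda>x\<in>carrier P. \<lambda>N\<in>K. hat (G Mod N) (\<lambda>a. N #> \<alpha> a) x)"

text \<open>The preimage of \<open>N\<close> under \<alpha>, written as the kernel that
  \<open>hat\<close> consults: the coordinate \<open>N\<close> of \<open>ind \<alpha> x\<close>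
  depends only on the coordinate \<open>pre \<alpha> N\<close> of \<open>x\<close>.\<close>

definition pre :: "('a \<Rightarrow> 'a) \<Rightarrow> 'a set \<Rightarrow> 'a set"
  where "pre \<alpha> N = kernel G (G Mod N) (\<lambda>a. N #> \<alpha> a)"

lemma comp_quot_hom: "\<alpha> \<in> hom G G \<Longrightarrow> N \<in> K \<Longrightarrow> (\<lambda>a. N #> \<alpha> a) \<in> hom G (G Mod N)"
  using Group.hom_compose[OF _ quot_hom, of \<alpha> G N] by (simp add: comp_def)

lemma pre_in_K: "\<alpha> \<in> hom G G \<Longrightarrow> N \<in> K \<Longrightarrow> pre \<alpha> N \<in> K"
  unfolding pre_def by (intro kernel_in_K comp_quot_hom) (auto simp: K_iff)

lemma ind_rcos:
  assumes "\<alpha> \<in> hom G G" "N \<in> K" "x \<in> carrier P" "a \<in> carrier G" "x (pre \<alpha> N) = pre \<alpha> N #> a"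
  shows "ind \<alpha> x N = N #> \<alpha> a"
  using hat_eq[OF K_group[OF assms(2)] comp_quot_hom[OF assms(1,2)] assms(4), of x] assms
  by (simp add: ind_def pre_def)

text \<open>Approximating \<open>x\<close> also at the preimages yields one element of
  \<open>G\<close> that represents \<open>x\<close> while its image represents
  \<open>ind \<alpha> x\<close>. Statements about \<open>ind \<alpha>\<close> thus reduce to
  statements about \<alpha>.\<close>

lemma ind_approx:
  assumes \<alpha>: "\<alpha> \<in> hom G G" and x: "x \<in> carrier P" and S: "finite S" "S \<subseteq> K"
  shows "\<exists>a\<in>carrier G. \<forall>N\<in>S. x N = N #> a \<and> ind \<alpha> x N = N #> \<alpha> a"
proof -
  have "finite (S \<union> pre \<alpha> ` S)" "S \<union> pre \<alpha> ` S \<subseteq> K" using S pre_in_K[OF \<alpha>] by auto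
  then obtain a where "a \<in> carrier G" "\<forall>N\<in>S \<union> pre \<alpha> ` S. x N = N #> a"
    using P_approx[OF x] by blast
  then show ?thesis using ind_rcos[OF \<alpha> _ x] S by (intro bexI[of _ a]) auto
qed

lemma ind_closed:
  assumes \<alpha>: "\<alpha> \<in> hom G G" and x: "x \<in> carrier P"
  shows "ind \<alpha> x \<in> carrier P"
  unfolding mem_P
proof (intro conjI ballI impI)
  have \<alpha>G: "\<And>a. a \<in> carrier G \<Longrightarrow> \<alpha> a \<in> carrier G" using \<alpha> by (auto simp: hom_def)
  show "ind \<alpha> x \<in> (\<Pi>\<^sub>E N\<in>K. carrier (G Mod N))"
  proof (rule PiE_I)
    fix N assume N: "N \<in> K"
    then obtain a where "a \<in> carrier G" "ind \<alpha> x N = N #> \<alpha> a"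
      using ind_approx[OF \<alpha> x, of "{N}"] by auto
    then show "ind \<alpha> x N \<in> carrier (G Mod N)" using \<alpha>G by (simp add: carrier_FactGroup)
  qed (use x in \<open>simp add: ind_def\<close>)
  fix N M assume NM: "N \<in> K" "M \<in> K" "N \<subseteq> M"
  then obtain a where "a \<in> carrier G" "ind \<alpha> x N = N #> \<alpha> a" "ind \<alpha> x M = M #> \<alpha> a"
    using ind_approx[OF \<alpha> x, of "{N, M}"] by auto
  then show "ind \<alpha> x M = M <#> ind \<alpha> x N" using NM \<alpha>G set_mult_rcos by simp
qed

lemma ind_emb: "\<alpha> \<in> hom G G \<Longrightarrow> a \<in> carrier G \<Longrightarrow> N \<in> K \<Longrightarrow> ind \<alpha> (emb a) N = N #> \<alpha> a"
  by (rule ind_rcos) (auto simp: emb_closed emb_apply pre_in_K)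

lemma ind_hom:
  assumes \<alpha>: "\<alpha> \<in> hom G G"
  shows "ind \<alpha> \<in> hom P P"
proof (rule homI)
  fix x y assume x: "x \<in> carrier P" and y: "y \<in> carrier P"
  show "ind \<alpha> (x \<otimes>\<^bsub>P\<^esub> y) = ind \<alpha> x \<otimes>\<^bsub>P\<^esub> ind \<alpha> y"
  proof (rule P_eqI)
    fix N assume N: "N \<in> K"
    have "hat (G Mod N) (\<lambda>a. N #> \<alpha> a) \<in> hom P (G Mod N)"
      using N by (intro hat_hom comp_quot_hom[OF \<alpha>]) (simp_all add: K_iff)
    then have "ind \<alpha> (x \<otimes>\<^bsub>P\<^esub> y) N = (ind \<alpha> x \<otimes>\<^bsub>P\<^esub> ind \<alpha> y) N"
      using x y N by (simp add: ind_def P_mult hom_mult)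
    then show "\<exists>M\<in>K. M \<subseteq> N \<and> ind \<alpha> (x \<otimes>\<^bsub>P\<^esub> y) M = (ind \<alpha> x \<otimes>\<^bsub>P\<^esub> ind \<alpha> y) M" using N by blast
  qed (use x y ind_closed[OF \<alpha>] in simp_all)
qed (rule ind_closed[OF \<alpha>])

lemma continuous_ind:
  assumes \<alpha>: "\<alpha> \<in> hom G G"
  shows "continuous_map T T (ind \<alpha>)"
proof (rule continuous_map_TI[OF ind_closed[OF \<alpha>]])
  fix N z assume N: "N \<in> K" and z: "z \<in> carrier P"
  have "ind \<alpha> z' N = ind \<alpha> z N" if z': "z' \<in> carrier P" "z' (pre \<alpha> N) = z (pre \<alpha> N)" for z'
  proof -
    obtain a where a: "a \<in> carrier G" "z (pre \<alpha> N) = pre \<alpha> N #> a"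
      using P_coset_ex[OF z pre_in_K[OF \<alpha> N]] by blast
    then show ?thesis using ind_rcos[OF \<alpha> N _ a(1)] z z' by simp
  qed
  then show "\<exists>M\<in>K. \<forall>z'\<in>carrier P. z' M = z M \<longrightarrow> ind \<alpha> z' N = ind \<alpha> z N"
    using pre_in_K[OF \<alpha> N] by blast
qed

definition ia_endo :: "('a \<Rightarrow> 'a) \<Rightarrow> bool"
  where "ia_endo \<alpha> \<longleftrightarrow> \<alpha> \<in> hom G G \<and> (\<forall>a\<in>carrier G. inv a \<otimes> \<alpha> a \<in> derived G (carrier G))"

lemma ia_quot:
  assumes \<alpha>: "ia_endo \<alpha>" and N: "N \<in> K" and a: "a \<in> carrier G"
  shows "inv\<^bsub>G Mod N\<^esub> (N #> a) \<otimes>\<^bsub>G Mod N\<^esub> (N #> \<alpha> a) \<in> derived (G Mod N) (carrier (G Mod N))"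
proof -
  interpret q: group_hom G "G Mod N" "\<lambda>a. N #> a"
    by (intro group_hom.intro group_hom_axioms.intro quot_hom K_group is_group N)
  have "\<alpha> a \<in> carrier G" "inv a \<otimes> \<alpha> a \<in> derived G (carrier G)"
    using \<alpha> a by (auto simp: ia_endo_def hom_def)
  then show ?thesis
    using q.derived_closed_img[of "inv a \<otimes> \<alpha> a"] q.hom_mult[of "inv a" "\<alpha> a"] q.hom_inv[OF a] a by simp
qed

lemma ia_surj_mod:
  assumes \<alpha>: "ia_endo \<alpha>" and N: "N \<in> K"
  shows "(\<lambda>a. N #> \<alpha> a) ` carrier G = carrier (G Mod N)"
proof -
  interpret Q: group "G Mod N" by (rule K_group[OF N])
  interpret D: subgroup "derived (G Mod N) (carrier (G Mod N))" "G Mod N" by (rule Q.derived_is_subgroup) simp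
  have \<alpha>h: "\<alpha> \<in> hom G G" using \<alpha> by (simp add: ia_endo_def)
  interpret f: group_hom G "G Mod N" "\<lambda>a. N #> \<alpha> a"
    by (intro group_hom.intro group_hom_axioms.intro comp_quot_hom K_group is_group N \<alpha>h)
  show ?thesis
  proof (rule Q.subgroup_eq_carrier_if_mod_derived[OF prime_p _ f.img_is_subgroup])
    show "finite_p_group p (G Mod N)" using N by (simp add: K_iff)
    fix C assume "C \<in> carrier (G Mod N)"
    then obtain a where a: "a \<in> carrier G" "C = N #> a" by (auto simp: carrier_FactGroup)
    have cl: "C \<in> carrier (G Mod N)" "N #> \<alpha> a \<in> carrier (G Mod N)" using a f.hom_closed \<open>C \<in> _\<close> by auto
    have "inv\<^bsub>G Mod N\<^esub> (inv\<^bsub>G Mod N\<^esub> C \<otimes>\<^bsub>G Mod N\<^esub> (N #> \<alpha> a)) \<in> derived (G Mod N) (carrier (G Mod N))"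
      using ia_quot[OF \<alpha> N a(1)] a(2) by blast
    then have "inv\<^bsub>G Mod N\<^esub> (N #> \<alpha> a) \<otimes>\<^bsub>G Mod N\<^esub> C \<in> derived (G Mod N) (carrier (G Mod N))"
      using cl by (simp add: Q.inv_mult_group del: mult_FactGroup)
    then show "\<exists>h\<in>(\<lambda>a. N #> \<alpha> a) ` carrier G. inv\<^bsub>G Mod N\<^esub> h \<otimes>\<^bsub>G Mod N\<^esub> C
        \<in> derived (G Mod N) (carrier (G Mod N))"
      using a(1) by blast
  qed
qed

text \<open>The image is compact and hence closed; it is dense because \<alpha> is onto modulo every
  \<open>N\<close> in \<open>K\<close>.\<close>

lemma ind_surj:
  assumes \<alpha>: "ia_endo \<alpha>"
  shows "ind \<alpha> ` carrier P = carrier P"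
proof
  have \<alpha>h: "\<alpha> \<in> hom G G" using \<alpha> by (simp add: ia_endo_def)
  show "ind \<alpha> ` carrier P \<subseteq> carrier P" using ind_closed[OF \<alpha>h] by blast
  have "compactin T (ind \<alpha> ` carrier P)"
    using image_compactin[OF _ continuous_ind[OF \<alpha>h]] compact_T by (simp add: compact_space_def topspace_T)
  then have "closedin T (ind \<alpha> ` carrier P)" using compactin_imp_closedin[OF Hausdorff_T] by blast
  then have "openin T (carrier P - ind \<alpha> ` carrier P)" by (simp add: closedin_def topspace_T)
  then have opn: "\<exists>N\<in>K. \<forall>z'\<in>carrier P. z' N = z N \<longrightarrow> z' \<in> carrier P - ind \<alpha> ` carrier P"
    if "z \<in> carrier P - ind \<alpha> ` carrier P" for z
    using that unfolding openin_T_iff by blast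
  show "carrier P \<subseteq> ind \<alpha> ` carrier P"
  proof
    fix z assume z: "z \<in> carrier P"
    show "z \<in> ind \<alpha> ` carrier P"
    proof (rule ccontr)
      assume "z \<notin> ind \<alpha> ` carrier P"
      then obtain N where N: "N \<in> K" "\<forall>z'\<in>carrier P. z' N = z N \<longrightarrow> z' \<in> carrier P - ind \<alpha> ` carrier P"
        using opn z by blast
      obtain a where a: "a \<in> carrier G" "z N = N #> \<alpha> a"
        using ia_surj_mod[OF \<alpha> N(1)] P_coord[OF z N(1)] by blast
      then have "ind \<alpha> (emb a) N = z N" using ind_emb[OF \<alpha>h _ N(1)] by simp
      then show False using N(2) ind_closed[OF \<alpha>h emb_closed[OF a(1)]] emb_closed[OF a(1)] by blast
    qed
  qed
qed

text \<open>Since \<open>N\<close> is invariant, \<alpha> induces a surjective map on the finite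
  group \<open>G Mod N\<close>, and this map must be injective.\<close>

lemma ia_inj_mod:
  assumes \<alpha>: "ia_endo \<alpha>" and N: "N \<in> K" and inv: "\<And>a. a \<in> N \<Longrightarrow> \<alpha> a \<in> N"
    and ab: "a \<in> carrier G" "b \<in> carrier G" "N #> \<alpha> a = N #> \<alpha> b"
  shows "N #> a = N #> b"
proof -
  have \<alpha>h: "\<alpha> \<in> hom G G" using \<alpha> by (simp add: ia_endo_def)
  interpret \<alpha>: group_hom G G \<alpha> by (intro group_hom.intro group_hom_axioms.intro is_group \<alpha>h)
  have wd: "N #> \<alpha> x = N #> \<alpha> y" if xy: "x \<in> carrier G" "y \<in> carrier G" "N #> x = N #> y" for x y
  proof -
    have "x \<otimes> inv y \<in> N" using xy rcos_eq_iff[OF K_subgroup[OF N]] by simp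
    then have "\<alpha> (x \<otimes> inv y) \<in> N" by (rule inv)
    then have "\<alpha> x \<otimes> inv \<alpha> y \<in> N" using xy \<alpha>.hom_mult[of x "inv y"] \<alpha>.hom_inv[of y] by simp
    then show ?thesis using xy rcos_eq_iff[OF K_subgroup[OF N]] by simp
  qed
  obtain g where g: "g \<in> hom (G Mod N) (G Mod N)" "\<And>x. x \<in> carrier G \<Longrightarrow> g (N #> x) = N #> \<alpha> x"
    by (rule FactGroup_universal[OF comp_quot_hom[OF \<alpha>h N] K_normal[OF N] wd]) metis+
  have "g ` carrier (G Mod N) = carrier (G Mod N)"
    unfolding ia_surj_mod[OF \<alpha> N, symmetric] using ia_surj_mod[OF \<alpha> N] g(2)
    by (simp add: carrier_FactGroup image_image cong: image_cong)
  moreover have "finite (carrier (G Mod N))" using N by (simp add: K_iff finite_p_group_def)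
  ultimately have "inj_on g (carrier (G Mod N))" by (simp add: eq_card_imp_inj_on)
  then show ?thesis
    using g(2) ab by (auto dest!: inj_onD[of g _ "N #> a" "N #> b"] simp: carrier_FactGroup)
qed

end

section \<open>Characteristic quotients of finitely generated groups\<close>

locale fg_pro_p_group = pro_p_group +
  assumes fg: "\<exists>S. finite S \<and> S \<subseteq> carrier G \<and> generate G S = carrier G"
begin

text \<open>
  \<open>core N\<close> is fully invariant, and its analogue \<open>{z \<in> P. z (core N) = core N}\<close> is invariant under the
  continuous automorphisms of \<open>P\<close> because a continuous homomorphism from \<open>P\<close> to \<open>G Mod N\<close> is determined
  by its values on \<open>G\<close>.
\<close>

definition core :: "'a set \<Rightarrow> 'a set"
  where "core N = \<Inter>((\<lambda>f. kernel G (G Mod N) f) ` hom G (G Mod N))"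

lemma core_subset: "N \<in> K \<Longrightarrow> core N \<subseteq> N"
  using kernel_quot[of N] quot_hom[of N] unfolding core_def by blast

text \<open>A homomorphism into the finite group \<open>G Mod N\<close> is determined by its values
  on a finite generating set, so only finitely many kernels are intersected.\<close>

lemma core_in_K:
  assumes N: "N \<in> K"
  shows "core N \<in> K"
  unfolding core_def
proof (rule Inter_in_K)
  obtain S where S: "finite S" "S \<subseteq> carrier G" "generate G S = carrier G" using fg by blast
  have ker_eq: "kernel G (G Mod N) f = kernel G (G Mod N) g"
    if fg: "f \<in> hom G (G Mod N)" "g \<in> hom G (G Mod N)" and eq: "restrict f S = restrict g S" for f g
  proof -
    have "f s = g s" if "s \<in> S" for s using fun_cong[OF eq, of s] that by simp
    then have "f a = g a" if "a \<in> carrier G" for a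
      using hom_eq_on_generate[OF is_group K_group[OF N] fg S(2), of a] S(3) that by simp
    then show ?thesis by (auto simp: kernel_def)
  qed
  have "finite ((\<lambda>f. restrict f S) ` hom G (G Mod N))"
  proof (rule finite_subset)
    show "(\<lambda>f. restrict f S) ` hom G (G Mod N) \<subseteq> S \<rightarrow>\<^sub>E carrier (G Mod N)"
      using S by (auto simp: hom_def)
    show "finite (S \<rightarrow>\<^sub>E carrier (G Mod N))"
      using S N by (intro finite_PiE) (auto simp: K_iff finite_p_group_def)
  qed
  moreover have "(\<lambda>f. kernel G (G Mod N) f) ` hom G (G Mod N) =
      (\<lambda>t. kernel G (G Mod N) (SOME f. f \<in> hom G (G Mod N) \<and> restrict f S = t)) `
      (\<lambda>f. restrict f S) ` hom G (G Mod N)" (is "_ = ?R")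
  proof -
    have "kernel G (G Mod N) (SOME g. g \<in> hom G (G Mod N) \<and> restrict g S = restrict f S) = kernel G (G Mod N) f"
      if f: "f \<in> hom G (G Mod N)" for f
    proof (rule someI2[of _ f])
      fix g assume "g \<in> hom G (G Mod N) \<and> restrict g S = restrict f S"
      then show "kernel G (G Mod N) g = kernel G (G Mod N) f" using ker_eq f by blast
    qed (use f in simp)
    then show ?thesis unfolding image_image by (rule image_cong[OF refl, symmetric])
  qed
  ultimately show "finite ((\<lambda>f. kernel G (G Mod N) f) ` hom G (G Mod N))" by simp
  show "(\<lambda>f. kernel G (G Mod N) f) ` hom G (G Mod N) \<noteq> {}" using quot_hom[OF N] by blast
  show "(\<lambda>f. kernel G (G Mod N) f) ` hom G (G Mod N) \<subseteq> K"
    using N by (auto intro!: kernel_in_K simp: K_iff)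
qed

lemma mem_core_iff:
  "N \<in> K \<Longrightarrow> a \<in> core N \<longleftrightarrow> a \<in> carrier G \<and> (\<forall>f\<in>hom G (G Mod N). f a = N)"
  using quot_hom[of N] unfolding core_def kernel_def by auto

lemma core_endo:
  assumes "N \<in> K" "\<alpha> \<in> hom G G" "a \<in> core N"
  shows "\<alpha> a \<in> core N"
  unfolding mem_core_iff[OF assms(1)]
proof (intro conjI ballI)
  show "\<alpha> a \<in> carrier G" using assms mem_core_iff by (auto simp: hom_def)
  fix f assume "f \<in> hom G (G Mod N)"
  then have "f \<circ> \<alpha> \<in> hom G (G Mod N)" using Group.hom_compose[OF assms(2)] by blast
  then show "f (\<alpha> a) = N" using assms mem_core_iff by (metis comp_apply)
qed

text \<open>Injectivity holds because \<alpha> preserves \<open>core N\<close>, is therefore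
  injective modulo \<open>core N\<close>, and the subgroups \<open>core N\<close> are cofinal in
  \<open>K\<close>.\<close>

lemma ind_cont_auto:
  assumes \<alpha>: "ia_endo \<alpha>"
  shows "ind \<alpha> \<in> cont_auto P T"
proof -
  have \<alpha>h: "\<alpha> \<in> hom G G" using \<alpha> by (simp add: ia_endo_def)
  have "inj_on (ind \<alpha>) (carrier P)"
  proof (rule inj_onI)
    fix x y assume xy: "x \<in> carrier P" "y \<in> carrier P" "ind \<alpha> x = ind \<alpha> y"
    show "x = y"
    proof (rule P_eqI[OF xy(1,2)])
      fix N assume N: "N \<in> K"
      let ?M = "core N"
      have M: "?M \<in> K" by (rule core_in_K[OF N])
      obtain a where a: "a \<in> carrier G" "x ?M = ?M #> a" "ind \<alpha> x ?M = ?M #> \<alpha> a"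
        using ind_approx[OF \<alpha>h xy(1), of "{?M}"] M by auto
      obtain b where b: "b \<in> carrier G" "y ?M = ?M #> b" "ind \<alpha> y ?M = ?M #> \<alpha> b"
        using ind_approx[OF \<alpha>h xy(2), of "{?M}"] M by auto
      have eq: "?M #> \<alpha> a = ?M #> \<alpha> b" using a(3) b(3) xy(3) by simp
      have "?M #> a = ?M #> b"
        by (rule ia_inj_mod[OF \<alpha> M _ a(1) b(1) eq]) (rule core_endo[OF N \<alpha>h])
      then have "x ?M = y ?M" using a b by simp
      then show "\<exists>M\<in>K. M \<subseteq> N \<and> x M = y M" by (intro bexI[of _ ?M] conjI core_subset[OF N] M)
    qed
  qed
  then show ?thesis
    using ind_hom[OF \<alpha>h] continuous_ind[OF \<alpha>h] ind_surj[OF \<alpha>]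
    by (auto simp: cont_auto_def auto_def Bij_def bij_betw_def ind_def)
qed

lemma core_agree:
  assumes N: "N \<in> K" and f: "f \<in> cont_auto P T" and z: "z \<in> carrier P" "z' \<in> carrier P"
    and eq: "z (core N) = z' (core N)"
  shows "f z (core N) = f z' (core N)"
proof -
  let ?M = "core N"
  have M: "?M \<in> K" by (rule core_in_K[OF N])
  interpret f: group_hom P P f by (rule cont_autoD(7)[OF f])
  have triv: "f z ?M = ?M" if z: "z \<in> carrier P" "z ?M = ?M" for z
  proof -
    obtain b where b: "b \<in> carrier G" "f z ?M = ?M #> b" using P_coset_ex[OF _ M] f.hom_closed z by blast
    have "b \<in> ?M"
      unfolding mem_core_iff[OF N]
    proof (intro conjI ballI)
      fix \<psi> assume \<psi>: "\<psi> \<in> hom G (G Mod N)"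
      have pN: "finite_p_group p (G Mod N)" using N by (simp add: K_iff)
      have ker: "kernel G (G Mod N) \<psi> \<in> K" by (rule kernel_in_K[OF pN \<psi>])
      have sub: "?M \<subseteq> kernel G (G Mod N) \<psi>" using \<psi> by (auto simp: core_def)
      \<comment> \<open>The composite of \<open>emb\<close>, \<open>f\<close> and the extension of
        \<psi> is itself one of the homomorphisms whose kernels are intersected in
        \<open>core N\<close>.\<close>
      have hom: "(\<lambda>a. hat (G Mod N) \<psi> (f (emb a))) \<in> hom G (G Mod N)"
        using Group.hom_compose[OF Group.hom_compose[OF emb_hom cont_autoD(2)[OF f]] hat_hom[OF pN \<psi>]]
        by (simp add: comp_def)
      \<comment> \<open>Continuity of \<open>f\<close>: if \<open>a\<close> is close enough to
        \<open>z\<close>, then \<open>f (emb a)\<close> and \<open>f z\<close> agree at the kernel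
        of \<psi>, the only coordinate on which the extension of \<psi> depends.\<close>
      obtain L where L: "L \<in> K" "\<forall>z'\<in>carrier P. z' L = z L \<longrightarrow>
          f z' (kernel G (G Mod N) \<psi>) = f z (kernel G (G Mod N) \<psi>)"
        using continuous_map_TD[OF cont_autoD(3)[OF f] ker z(1)] by blast
      obtain a where a: "a \<in> carrier G" "z L = L #> a" "z ?M = ?M #> a"
        using P_approx[OF z(1), of "{L, ?M}"] L(1) M by auto
      have "a \<in> ?M" using a(1,3) z(2) coset_join1[OF _ a(1) K_subgroup[OF M]] by simp
      then have "hat (G Mod N) \<psi> (f (emb a)) = N"
        using bspec[OF conjunct2[OF mem_core_iff[OF N, THEN iffD1]] hom, of a] by simp
      moreover have "f (emb a) (kernel G (G Mod N) \<psi>) = f z (kernel G (G Mod N) \<psi>)"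
        using L emb_closed[OF a(1)] emb_apply[OF L(1)] a(2) by simp
      then have "hat (G Mod N) \<psi> (f (emb a)) = hat (G Mod N) \<psi> (f z)"
        by (simp add: hat_def)
      moreover have "hat (G Mod N) \<psi> (f z) = \<psi> b"
        using P_coset_mono[OF f.hom_closed[OF z(1)] M ker sub b(1,2)]
        by (intro hat_eq[of _ \<psi> b "f z"] K_group[OF N] \<psi> b(1))
      ultimately show "\<psi> b = N" by simp
    qed (rule b)
    then show ?thesis using b coset_join2[OF b(1) K_subgroup[OF M]] by simp
  qed
  have "(z \<otimes>\<^bsub>P\<^esub> inv\<^bsub>P\<^esub> z') ?M = ?M" using coord_inv_mult[OF z M] eq by simp
  then have "f (z \<otimes>\<^bsub>P\<^esub> inv\<^bsub>P\<^esub> z') ?M = ?M" using z by (intro triv) simp_all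
  moreover have "f (z \<otimes>\<^bsub>P\<^esub> inv\<^bsub>P\<^esub> z') = f z \<otimes>\<^bsub>P\<^esub> inv\<^bsub>P\<^esub> f z'"
    using z f.hom_mult[of z "inv\<^bsub>P\<^esub> z'"] f.hom_inv[of z'] by simp
  ultimately have "(f z \<otimes>\<^bsub>P\<^esub> inv\<^bsub>P\<^esub> f z') ?M = ?M" by simp
  then show ?thesis using coord_inv_mult[OF _ _ M, of "f z" "f z'"] z by simp
qed

end

section \<open>The topology of the automorphism group\<close>

context fg_pro_p_group
begin

lemma openin_TD:
  "openin T U \<Longrightarrow> z \<in> U \<Longrightarrow> \<exists>N\<in>K. \<forall>z'\<in>carrier P. z' N = z N \<longrightarrow> z' \<in> U"
  by (rule bspec[OF conjunct2[OF openin_T_iff[THEN iffD1]]])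

definition pk :: "'a set \<Rightarrow> ('a set \<Rightarrow> 'a set) set"
  where "pk M = {z \<in> carrier P. z M = M}"

lemma pk_rcos_iff:
  assumes "M \<in> K" "x \<in> carrier P" "y \<in> carrier P"
  shows "x \<in> pk M #>\<^bsub>P\<^esub> y \<longleftrightarrow> x M = y M"
proof -
  have "x \<otimes>\<^bsub>P\<^esub> inv\<^bsub>P\<^esub> y \<in> pk M \<longleftrightarrow> x M = y M"
    using assms coord_inv_mult[OF assms(2,3,1)] by (simp add: pk_def)
  moreover have "x \<in> pk M #>\<^bsub>P\<^esub> y \<longleftrightarrow> x \<otimes>\<^bsub>P\<^esub> inv\<^bsub>P\<^esub> y \<in> pk M"
  proof -
    have "x = u \<otimes>\<^bsub>P\<^esub> y \<longleftrightarrow> u = x \<otimes>\<^bsub>P\<^esub> inv\<^bsub>P\<^esub> y" if "u \<in> pk M" for u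
      using that assms P.inv_solve_right[of u x y] by (auto simp: pk_def)
    then show ?thesis unfolding r_coset_def by auto
  qed
  ultimately show ?thesis by simp
qed

lemma subgroup_pk: "M \<in> K \<Longrightarrow> subgroup (pk M) P"
  using group_hom.subgroup_kernel[OF coord_group_hom[of M]] by (simp add: pk_def kernel_def)

lemma open_characteristic_pk:
  assumes N: "N \<in> K"
  shows "open_characteristic P T (pk (core N))"
  unfolding open_characteristic_def
proof (intro conjI ballI)
  have M: "core N \<in> K" by (rule core_in_K[OF N])
  show "subgroup (pk (core N)) P" by (rule subgroup_pk[OF M])
  show "openin T (pk (core N))"
    using openin_coord[OF M, of "{core N}"] by (simp add: pk_def)
  fix f assume f: "f \<in> cont_auto P T"
  have sub: "g z \<in> pk (core N)" if g: "g \<in> cont_auto P T" and z: "z \<in> pk (core N)" for g z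
  proof -
    interpret g: group_hom P P g by (rule cont_autoD(7)[OF g])
    have "z \<in> carrier P" "z (core N) = \<one>\<^bsub>P\<^esub> (core N)" using z P_one[OF M] by (simp_all add: pk_def)
    then have "g z (core N) = g \<one>\<^bsub>P\<^esub> (core N)" by (intro core_agree[OF N g]) simp_all
    then show ?thesis using \<open>z \<in> carrier P\<close> P_one[OF M] by (simp add: pk_def)
  qed
  show "f ` pk (core N) = pk (core N)"
  proof
    show "f ` pk (core N) \<subseteq> pk (core N)" using sub[OF f] by blast
    show "pk (core N) \<subseteq> f ` pk (core N)"
    proof
      fix z assume z: "z \<in> pk (core N)"
      then have "z = f ((inv\<^bsub>\<A>\<^esub> f) z)" using inv_\<A>_apply(1)[OF f] by (simp add: pk_def)
      then show "z \<in> f ` pk (core N)" using sub[OF inv_\<A>_closed[OF f] z] by (rule image_eqI)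
    qed
  qed
qed

text \<open>The subgroups \<open>pk (core N)\<close> are cofinal among the open characteristic ones,
  so the topology of the automorphism group can be tested on the coordinates
  \<open>core N\<close>.\<close>

lemma open_characteristic_ex:
  assumes "open_characteristic P T U"
  shows "\<exists>N\<in>K. pk (core N) \<subseteq> U"
proof -
  interpret U: subgroup U P using assms by (simp add: open_characteristic_def)
  obtain N where N: "N \<in> K" "\<forall>z'\<in>carrier P. z' N = \<one>\<^bsub>P\<^esub> N \<longrightarrow> z' \<in> U"
    using openin_TD[OF _ U.one_closed] assms unfolding open_characteristic_def by blast
  have "z \<in> U" if z: "z \<in> pk (core N)" for z
  proof -
    have zP: "z \<in> carrier P" and eq: "z (core N) = \<one>\<^bsub>P\<^esub> (core N)"
      using z P_one[OF core_in_K[OF N(1)]] by (simp_all add: pk_def)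
    have "z N = \<one>\<^bsub>P\<^esub> N"
      by (rule P_agree_mono[OF zP P.one_closed core_in_K[OF N(1)] N(1) core_subset[OF N(1)] eq])
    then show ?thesis using bspec[OF N(2) zP] by simp
  qed
  then show ?thesis using N(1) by blast
qed

lemma trivial_on_quotientI:
  assumes U: "open_characteristic P T U" and f: "f \<in> cont_auto P T" and N: "N \<in> K" "pk (core N) \<subseteq> U"
    and agree: "\<And>z. z \<in> carrier P \<Longrightarrow> f z (core N) = z (core N)"
  shows "f \<in> trivial_on_quotient P T U"
  unfolding trivial_on_quotient_def
proof (intro CollectI conjI f ballI)
  interpret U: subgroup U P using U by (simp add: open_characteristic_def)
  have M: "core N \<in> K" by (rule core_in_K[OF N(1)])
  have sub: "f z \<in> U #>\<^bsub>P\<^esub> y" if z: "y \<in> carrier P" "z \<in> U #>\<^bsub>P\<^esub> y" for y z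
  proof -
    have zP: "z \<in> carrier P" using z P.r_coset_subset_G[OF U.subset] by blast
    then have "f z \<in> pk (core N) #>\<^bsub>P\<^esub> z"
      using agree pk_rcos_iff[OF M cont_autoD(4)[OF f zP] zP] by simp
    then have "f z \<in> U #>\<^bsub>P\<^esub> z" using N(2) by (auto simp: r_coset_def)
    moreover have "U #>\<^bsub>P\<^esub> z = U #>\<^bsub>P\<^esub> y" using P.repr_independence[OF z(2,1) U.subgroup_axioms] by simp
    ultimately show ?thesis by simp
  qed
  fix C assume "C \<in> carrier (P Mod U)"
  then obtain y where y: "y \<in> carrier P" "C = U #>\<^bsub>P\<^esub> y" by (auto simp: carrier_FactGroup)
  show "f ` C = C"
  proof
    show "f ` C \<subseteq> C" using sub y by blast
    \<comment> \<open>By \<open>sub\<close>, \<open>f\<close> moves each element within its coset,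
      so the preimage \<open>w\<close> of \<open>z\<close> lies in the coset of
      \<open>z\<close>.\<close>
    show "C \<subseteq> f ` C"
    proof
      fix z assume z: "z \<in> C"
      then have zP: "z \<in> carrier P" using y P.r_coset_subset_G[OF U.subset] by blast
      then obtain w where w: "w \<in> carrier P" "f w = z" using cont_autoD(5)[OF f] by (metis imageE)
      have "z \<in> U #>\<^bsub>P\<^esub> w" using sub[OF w(1) P.rcos_self[OF w(1) U.subgroup_axioms]] w(2) by simp
      then have "U #>\<^bsub>P\<^esub> w = U #>\<^bsub>P\<^esub> z" using P.repr_independence[OF _ w(1) U.subgroup_axioms] by simp
      moreover have "U #>\<^bsub>P\<^esub> z = C" using P.repr_independence[OF _ y(1) U.subgroup_axioms] z y(2) by simp
      ultimately have "w \<in> C" using P.rcos_self[OF w(1) U.subgroup_axioms] by simp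
      then show "z \<in> f ` C" using w(2) by blast
    qed
  qed
qed

lemma trivial_on_quotientD:
  assumes f: "f \<in> trivial_on_quotient P T (pk (core N))" and N: "N \<in> K" and z: "z \<in> carrier P"
  shows "f z (core N) = z (core N)"
proof -
  have M: "core N \<in> K" by (rule core_in_K[OF N])
  have fc: "f \<in> cont_auto P T" and im: "f ` (pk (core N) #>\<^bsub>P\<^esub> z) = pk (core N) #>\<^bsub>P\<^esub> z"
    using f z by (auto simp: trivial_on_quotient_def carrier_FactGroup)
  have "f z \<in> pk (core N) #>\<^bsub>P\<^esub> z" using im P.rcos_self[OF z subgroup_pk[OF M]] by blast
  then show ?thesis using pk_rcos_iff[OF M cont_autoD(4)[OF fc z] z] by simp
qed

lemma trivial_on_quotient_mult:
  assumes "s \<in> trivial_on_quotient P T U" "t \<in> trivial_on_quotient P T U" "subgroup U P"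
  shows "s \<otimes>\<^bsub>\<A>\<^esub> t \<in> trivial_on_quotient P T U"
proof -
  have c: "s \<in> cont_auto P T" "t \<in> cont_auto P T" using assms by (simp_all add: trivial_on_quotient_def)
  have "(s \<otimes>\<^bsub>\<A>\<^esub> t) ` C = C" if C: "C \<in> carrier (P Mod U)" for C
  proof -
    have "C \<subseteq> carrier P"
      using C P.r_coset_subset_G[OF subgroup.subset[OF assms(3)]] by (auto simp: carrier_FactGroup)
    then have "(s \<otimes>\<^bsub>\<A>\<^esub> t) ` C = s ` t ` C"
      unfolding image_image by (intro image_cong) (auto simp: mult_\<A>_apply[OF c])
    then show ?thesis using C assms by (simp add: trivial_on_quotient_def)
  qed
  then show ?thesis using mult_\<A>_closed[OF c] by (simp add: trivial_on_quotient_def)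
qed

abbreviation "TA \<equiv> auto_topology P T"

lemma auto_coset_self:
  assumes f: "f \<in> cont_auto P T" and U: "subgroup U P"
  shows "f \<in> f <#\<^bsub>\<A>\<^esub> trivial_on_quotient P T U"
proof -
  have "\<one>\<^bsub>\<A>\<^esub> ` C = C" if "C \<in> carrier (P Mod U)" for C
  proof -
    have "C \<subseteq> carrier P"
      using that P.r_coset_subset_G[OF subgroup.subset[OF U]] by (auto simp: carrier_FactGroup)
    then have "\<one>\<^bsub>\<A>\<^esub> ` C = (\<lambda>x. x) ` C" unfolding one_\<A> by (intro image_cong) auto
    then show ?thesis by simp
  qed
  then have "\<one>\<^bsub>\<A>\<^esub> \<in> trivial_on_quotient P T U"
    using A.one_closed by (simp add: trivial_on_quotient_def carrier_\<A>)
  moreover have "f = f \<otimes>\<^bsub>\<A>\<^esub> \<one>\<^bsub>\<A>\<^esub>" using f by (simp add: carrier_\<A>)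
  ultimately show ?thesis unfolding l_coset_def by blast
qed

lemma auto_coset_subset:
  "f \<in> cont_auto P T \<Longrightarrow> f <#\<^bsub>\<A>\<^esub> trivial_on_quotient P T U \<subseteq> cont_auto P T"
  using mult_\<A>_closed by (auto simp: l_coset_def trivial_on_quotient_def)

lemma topspace_TA: "topspace TA = cont_auto P T"
proof -
  have U: "open_characteristic P T (pk (core (carrier G)))"
    by (rule open_characteristic_pk[OF carrier_in_K])
  show ?thesis
    unfolding auto_topology_def topology_generated_by_topspace
  proof (intro equalityI subsetI)
    fix f assume f: "f \<in> cont_auto P T"
    then have "f \<in> f <#\<^bsub>\<A>\<^esub> trivial_on_quotient P T (pk (core (carrier G)))"
      using U by (intro auto_coset_self) (simp_all add: open_characteristic_def)
    then show "f \<in> \<Union> {f <#\<^bsub>\<A>\<^esub> trivial_on_quotient P T U |f U. f \<in> cont_auto P T \<and> open_characteristic P T U}"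
      using U f by blast
  qed (use auto_coset_subset in blast)
qed

text \<open>Distinct automorphisms take different values at some \<open>z\<close> in some coordinate
  \<open>core N\<close>. This value is constant on the corresponding basic cosets, which are
  therefore disjoint.\<close>

lemma Hausdorff_TA: "Hausdorff_space TA"
  unfolding Hausdorff_space_def topspace_TA
proof (intro allI impI)
  fix f g assume fg: "f \<in> cont_auto P T \<and> g \<in> cont_auto P T \<and> f \<noteq> g"
  then obtain z where z: "z \<in> carrier P" "f z \<noteq> g z" using cont_auto_eqI[of f g] by blast
  have fz: "f z \<in> carrier P" "g z \<in> carrier P" using fg cont_autoD(4) z by blast+
  obtain N where N: "N \<in> K" "\<forall>M\<in>K. M \<subseteq> N \<longrightarrow> f z M \<noteq> g z M" using P_eqI[OF fz] z(2) by blast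
  let ?U = "pk (core N)"
  have M: "core N \<in> K" by (rule core_in_K[OF N(1)])
  have U: "open_characteristic P T ?U" by (rule open_characteristic_pk[OF N(1)])
  let ?B = "\<lambda>f. f <#\<^bsub>\<A>\<^esub> trivial_on_quotient P T ?U"
  have opn: "openin TA (?B f)" if "f \<in> cont_auto P T" for f
    unfolding auto_topology_def by (rule topology_generated_by_Basis) (use that U in blast)
  have self: "f \<in> ?B f" if "f \<in> cont_auto P T" for f
    using U by (intro auto_coset_self that) (simp add: open_characteristic_def)
  have val: "h z (core N) = f z (core N)" if f: "f \<in> cont_auto P T" and h: "h \<in> ?B f" for f h
  proof -
    obtain t where t: "t \<in> trivial_on_quotient P T ?U" "h = f \<otimes>\<^bsub>\<A>\<^esub> t" using h by (auto simp: l_coset_def)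
    then have tc: "t \<in> cont_auto P T" by (simp add: trivial_on_quotient_def)
    have "t z (core N) = z (core N)" by (rule trivial_on_quotientD[OF t(1) N(1) z(1)])
    then have "f (t z) (core N) = f z (core N)"
      by (intro core_agree[OF N(1) f] cont_autoD(4)[OF tc] z(1))
    then show ?thesis using t mult_\<A>_apply[OF f tc z(1)] by simp
  qed
  have "disjnt (?B f) (?B g)"
  proof -
    have "f z (core N) \<noteq> g z (core N)" using N M core_subset by simp
    then have "h \<notin> ?B g" if "h \<in> ?B f" for h
      using val[of f h] val[of g h] fg that by auto
    then show ?thesis by (auto simp: disjnt_iff)
  qed
  then show "\<exists>U V. openin TA U \<and> openin TA V \<and> f \<in> U \<and> g \<in> V \<and> disjnt U V"
    using opn self fg by blast
qed

lemma continuous_map_into_TA: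
  assumes mem: "\<And>s. s \<in> topspace S \<Longrightarrow> \<phi> s \<in> cont_auto P T"
    and loc: "\<And>s N. s \<in> topspace S \<Longrightarrow> N \<in> K \<Longrightarrow> \<exists>W. openin S W \<and> s \<in> W \<and>
      (\<forall>s'\<in>W. \<forall>z\<in>carrier P. \<phi> s' z (core N) = \<phi> s z (core N))"
  shows "continuous_map S TA \<phi>"
  unfolding auto_topology_def
proof (rule continuous_on_generated_topo)
  have "\<phi> ` topspace S \<subseteq> topspace TA" using mem topspace_TA by blast
  then show "\<phi> ` topspace S \<subseteq> \<Union>{f <#\<^bsub>\<A>\<^esub> trivial_on_quotient P T U |f U.
      f \<in> cont_auto P T \<and> open_characteristic P T U}"
    unfolding auto_topology_def topology_generated_by_topspace .
  fix V assume "V \<in> {f <#\<^bsub>\<A>\<^esub> trivial_on_quotient P T U |f U.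
      f \<in> cont_auto P T \<and> open_characteristic P T U}"
  then obtain f U where V: "V = f <#\<^bsub>\<A>\<^esub> trivial_on_quotient P T U"
    and f: "f \<in> cont_auto P T" and U: "open_characteristic P T U" by blast
  obtain N where N: "N \<in> K" "pk (core N) \<subseteq> U" using open_characteristic_ex[OF U] by blast
  show "openin S (\<phi> -` V \<inter> topspace S)"
  proof (subst openin_subopen, intro ballI)
    fix s assume "s \<in> \<phi> -` V \<inter> topspace S"
    then have s: "s \<in> topspace S" "\<phi> s \<in> V" by simp_all
    obtain W where W: "openin S W" "s \<in> W" "\<forall>s'\<in>W. \<forall>z\<in>carrier P. \<phi> s' z (core N) = \<phi> s z (core N)"
      using loc[OF s(1) N(1)] by blast
    have cs: "\<phi> s \<in> cont_auto P T" by (rule mem[OF s(1)])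
    obtain t where t: "t \<in> trivial_on_quotient P T U" "\<phi> s = f \<otimes>\<^bsub>\<A>\<^esub> t"
      using s(2) unfolding V l_coset_def by blast
    then have tc: "t \<in> cont_auto P T" by (simp add: trivial_on_quotient_def)
    have "\<phi> s' \<in> V" if s': "s' \<in> W" for s'
    proof -
      have cs': "\<phi> s' \<in> cont_auto P T" using mem openin_subset[OF W(1)] s' by blast
      let ?t = "inv\<^bsub>\<A>\<^esub> \<phi> s \<otimes>\<^bsub>\<A>\<^esub> \<phi> s'"
      have tc': "?t \<in> cont_auto P T" by (intro mult_\<A>_closed inv_\<A>_closed cs cs')
      have "?t z (core N) = z (core N)" if z: "z \<in> carrier P" for z
      proof -
        have "(inv\<^bsub>\<A>\<^esub> \<phi> s) (\<phi> s' z) (core N) = (inv\<^bsub>\<A>\<^esub> \<phi> s) (\<phi> s z) (core N)"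
          using W(3) s' z by (intro core_agree[OF N(1) inv_\<A>_closed[OF cs]] cont_autoD(4)[OF cs] cont_autoD(4)[OF cs'] z) simp
        then show ?thesis using mult_\<A>_apply[OF inv_\<A>_closed[OF cs] cs' z] inv_\<A>_apply(2)[OF cs z] by simp
      qed
      then have "?t \<in> trivial_on_quotient P T U" by (intro trivial_on_quotientI[OF U tc' N])
      then have "t \<otimes>\<^bsub>\<A>\<^esub> ?t \<in> trivial_on_quotient P T U"
        using U by (intro trivial_on_quotient_mult[OF t(1)]) (simp_all add: open_characteristic_def)
      moreover have "\<phi> s' = f \<otimes>\<^bsub>\<A>\<^esub> (t \<otimes>\<^bsub>\<A>\<^esub> ?t)"
      proof -
        have "f \<otimes>\<^bsub>\<A>\<^esub> (t \<otimes>\<^bsub>\<A>\<^esub> ?t) = \<phi> s \<otimes>\<^bsub>\<A>\<^esub> ?t"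
          using f tc tc' t(2) by (simp add: carrier_\<A> A.m_assoc)
        also have "\<dots> = \<phi> s'"
          using cs cs' unfolding carrier_\<A>[symmetric] by (simp add: A.m_assoc[symmetric])
        finally show ?thesis by simp
      qed
      ultimately show ?thesis unfolding V l_coset_def by blast
    qed
    then have "W \<subseteq> \<phi> -` V \<inter> topspace S" using openin_subset[OF W(1)] by auto
    then show "\<exists>W. openin S W \<and> s \<in> W \<and> W \<subseteq> \<phi> -` V \<inter> topspace S" using W(1,2) by metis
  qed
qed

section \<open>Inner automorphisms\<close>

definition inner :: "('a set \<Rightarrow> 'a set) \<Rightarrow> ('a set \<Rightarrow> 'a set) \<Rightarrow> 'a set \<Rightarrow> 'a set"
  where "inner c = (\<lambda>x\<in>carrier P. c \<otimes>\<^bsub>P\<^esub> x \<otimes>\<^bsub>P\<^esub> inv\<^bsub>P\<^esub> c)"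

lemma inner_auto_eq: "inner_auto P = inner ` carrier P"
  by (simp add: inner_auto_def inner_def)

lemma inner_agree:
  assumes "c \<in> carrier P" "c' \<in> carrier P" "x \<in> carrier P" "x' \<in> carrier P" "M \<in> K"
    "c M = c' M" "x M = x' M"
  shows "inner c x M = inner c' x' M"
proof -
  interpret h: group_hom P "G Mod M" "\<lambda>x. x M" by (rule coord_group_hom[OF assms(5)])
  show ?thesis
    using assms h.hom_inv[of c] h.hom_inv[of c'] by (simp add: inner_def h.hom_mult del: mult_FactGroup)
qed

lemma inner_cont_auto:
  assumes c: "c \<in> carrier P"
  shows "inner c \<in> cont_auto P T"
proof -
  have cl: "inner c z \<in> carrier P" if "z \<in> carrier P" for z using c that by (simp add: inner_def)
  have hom: "inner c \<in> hom P P"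
  proof (rule homI)
    fix x y assume "x \<in> carrier P" "y \<in> carrier P"
    then show "inner c (x \<otimes>\<^bsub>P\<^esub> y) = inner c x \<otimes>\<^bsub>P\<^esub> inner c y"
      using c by (simp add: inner_def P.m_assoc) (simp add: P.m_assoc[symmetric])
  qed (rule cl)
  have "bij_betw (inner c) (carrier P) (carrier P)"
  proof (rule bij_betwI[where g = "\<lambda>x. inv\<^bsub>P\<^esub> c \<otimes>\<^bsub>P\<^esub> x \<otimes>\<^bsub>P\<^esub> c"])
    show "inner c \<in> carrier P \<rightarrow> carrier P" using cl by blast
    show "(\<lambda>x. inv\<^bsub>P\<^esub> c \<otimes>\<^bsub>P\<^esub> x \<otimes>\<^bsub>P\<^esub> c) \<in> carrier P \<rightarrow> carrier P" using c by simp
    fix x assume "x \<in> carrier P"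
    then show "inv\<^bsub>P\<^esub> c \<otimes>\<^bsub>P\<^esub> inner c x \<otimes>\<^bsub>P\<^esub> c = x" "inner c (inv\<^bsub>P\<^esub> c \<otimes>\<^bsub>P\<^esub> x \<otimes>\<^bsub>P\<^esub> c) = x"
      using c by (simp_all add: inner_def P.m_assoc) (simp_all add: P.m_assoc[symmetric])
  qed
  moreover have "continuous_map T T (inner c)"
  proof (rule continuous_map_TI[OF cl])
    fix N z assume "N \<in> K" "z \<in> carrier P"
    then show "\<exists>M\<in>K. \<forall>z'\<in>carrier P. z' M = z M \<longrightarrow> inner c z' N = inner c z N"
      using inner_agree[OF c c _ _ _ refl] by (intro bexI[of _ N]) blast+
  qed
  ultimately show ?thesis using hom by (auto simp: cont_auto_def auto_def Bij_def inner_def)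
qed

lemma inner_mult: "c \<in> carrier P \<Longrightarrow> d \<in> carrier P \<Longrightarrow> inner (c \<otimes>\<^bsub>P\<^esub> d) = inner c \<otimes>\<^bsub>\<A>\<^esub> inner d"
proof (rule cont_auto_eqI)
  assume cd: "c \<in> carrier P" "d \<in> carrier P"
  fix z assume z: "z \<in> carrier P"
  show "inner (c \<otimes>\<^bsub>P\<^esub> d) z = (inner c \<otimes>\<^bsub>\<A>\<^esub> inner d) z"
    using mult_\<A>_apply[OF inner_cont_auto[OF cd(1)] inner_cont_auto[OF cd(2)] z] cd z
    by (simp add: inner_def P.m_assoc P.inv_mult_group)
qed (simp_all add: inner_cont_auto mult_\<A>_closed)

lemma inner_conj:
  assumes f: "f \<in> cont_auto P T" and c: "c \<in> carrier P"
  shows "f \<otimes>\<^bsub>\<A>\<^esub> inner c \<otimes>\<^bsub>\<A>\<^esub> inv\<^bsub>\<A>\<^esub> f = inner (f c)"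
proof (rule cont_auto_eqI)
  interpret f: group_hom P P f by (rule cont_autoD(7)[OF f])
  have i: "inv\<^bsub>\<A>\<^esub> f \<in> cont_auto P T" by (rule inv_\<A>_closed[OF f])
  have ic: "inner c \<in> cont_auto P T" by (rule inner_cont_auto[OF c])
  show "f \<otimes>\<^bsub>\<A>\<^esub> inner c \<otimes>\<^bsub>\<A>\<^esub> inv\<^bsub>\<A>\<^esub> f \<in> cont_auto P T" by (intro mult_\<A>_closed f ic i)
  show "inner (f c) \<in> cont_auto P T" using c by (intro inner_cont_auto) simp
  fix z assume z: "z \<in> carrier P"
  have iz: "(inv\<^bsub>\<A>\<^esub> f) z \<in> carrier P" by (rule cont_autoD(4)[OF i z])
  have "(f \<otimes>\<^bsub>\<A>\<^esub> inner c \<otimes>\<^bsub>\<A>\<^esub> inv\<^bsub>\<A>\<^esub> f) z = f (inner c ((inv\<^bsub>\<A>\<^esub> f) z))"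
    by (simp add: mult_\<A>_apply f ic i z iz mult_\<A>_closed)
  also have "\<dots> = f c \<otimes>\<^bsub>P\<^esub> f ((inv\<^bsub>\<A>\<^esub> f) z) \<otimes>\<^bsub>P\<^esub> inv\<^bsub>P\<^esub> f c" using iz c by (simp add: inner_def)
  also have "\<dots> = inner (f c) z" using inv_\<A>_apply(1)[OF f z] z by (simp add: inner_def)
  finally show "(f \<otimes>\<^bsub>\<A>\<^esub> inner c \<otimes>\<^bsub>\<A>\<^esub> inv\<^bsub>\<A>\<^esub> f) z = inner (f c) z" .
qed

lemma inner_auto_normal: "inner_auto P \<lhd> \<A>"
proof -
  have "inner \<in> hom P \<A>"
    by (rule homI) (simp_all add: carrier_\<A> inner_cont_auto inner_mult)
  then interpret i: group_hom P \<A> inner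
    by (intro group_hom.intro group_hom_axioms.intro P_group group_\<A>)
  have "subgroup (inner_auto P) \<A>" unfolding inner_auto_eq by (rule i.img_is_subgroup)
  moreover have "f \<otimes>\<^bsub>\<A>\<^esub> h \<otimes>\<^bsub>\<A>\<^esub> inv\<^bsub>\<A>\<^esub> f \<in> inner_auto P"
    if f: "f \<in> carrier \<A>" and h: "h \<in> inner_auto P" for f h
  proof -
    obtain c where c: "c \<in> carrier P" "h = inner c" using h unfolding inner_auto_eq by blast
    have fc: "f \<in> cont_auto P T" using f by (simp add: carrier_\<A>)
    show ?thesis using inner_conj[OF fc c(1)] cont_autoD(4)[OF fc c(1)] c(2) unfolding inner_auto_eq by simp
  qed
  ultimately show ?thesis by (simp add: A.normal_inv_iff)
qed

end

section \<open>Closed subgroups of the outer automorphism group\<close>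

context fg_pro_p_group
begin

abbreviation "Out \<equiv> OutGroup P T"
abbreviation "TO \<equiv> out_topology P T"
abbreviation "cls f \<equiv> inner_auto P #>\<^bsub>\<A>\<^esub> f"

text \<open>
  The preimage in the automorphism group of the image of a closed set \<open>C\<close> is the image of the compact
  space \<open>P \<times> C\<close>.
\<close>

lemma closed_map_cls:
  assumes E: "topspace TE = carrier E" "compact_space TE"
    and \<Phi>: "\<And>\<gamma>. \<gamma> \<in> carrier E \<Longrightarrow> \<Phi> \<gamma> \<in> cont_auto P T"
    and loc: "\<And>\<gamma> N. \<gamma> \<in> carrier E \<Longrightarrow> N \<in> K \<Longrightarrow> \<exists>W. openin TE W \<and> \<gamma> \<in> W \<and>
      (\<forall>\<gamma>'\<in>W. \<forall>z\<in>carrier P. \<Phi> \<gamma>' z (core N) = \<Phi> \<gamma> z (core N))"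
  shows "closed_map TE TO (\<lambda>\<gamma>. cls (\<Phi> \<gamma>))"
  unfolding closed_map_def
proof (intro allI impI)
  fix C assume C: "closedin TE C"
  have CE: "C \<subseteq> carrier E" using closedin_subset[OF C] E by simp
  let ?m = "\<lambda>(c, \<gamma>). inner c \<otimes>\<^bsub>\<A>\<^esub> \<Phi> \<gamma>"
  have "continuous_map (prod_topology T TE) TA ?m"
  proof (rule continuous_map_into_TA)
    fix s assume "s \<in> topspace (prod_topology T TE)"
    then obtain c \<gamma> where s: "s = (c, \<gamma>)" "c \<in> carrier P" "\<gamma> \<in> carrier E"
      using E topspace_T by (cases s) auto
    show "?m s \<in> cont_auto P T" using s mult_\<A>_closed[OF inner_cont_auto[OF s(2)] \<Phi>[OF s(3)]] by simp
    fix N assume N: "N \<in> K"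
    have M: "core N \<in> K" by (rule core_in_K[OF N])
    obtain W where W: "openin TE W" "\<gamma> \<in> W"
      "\<forall>\<gamma>'\<in>W. \<forall>z\<in>carrier P. \<Phi> \<gamma>' z (core N) = \<Phi> \<gamma> z (core N)"
      using loc[OF s(3) N] by blast
    let ?V = "{x \<in> carrier P. x (core N) \<in> {c (core N)}}"
    have "openin (prod_topology T TE) (?V \<times> W)"
      using openin_coord[OF M, of "{c (core N)}"] W(1) by (simp add: openin_prod_Times_iff)
    moreover have "s \<in> ?V \<times> W" using s W(2) by simp
    moreover have "?m s' z (core N) = ?m s z (core N)" if s': "s' \<in> ?V \<times> W" and z: "z \<in> carrier P" for s' z
    proof -
      obtain c' \<gamma>' where s'': "s' = (c', \<gamma>')" "c' \<in> carrier P" "c' (core N) = c (core N)" "\<gamma>' \<in> W"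
        using s' by auto
      have \<gamma>': "\<gamma>' \<in> carrier E" using openin_subset[OF W(1)] s''(4) E by auto
      have "inner c' (\<Phi> \<gamma>' z) (core N) = inner c (\<Phi> \<gamma> z) (core N)"
        by (rule inner_agree[OF s''(2) s(2) cont_autoD(4)[OF \<Phi>[OF \<gamma>'] z] cont_autoD(4)[OF \<Phi>[OF s(3)] z] M s''(3)])
          (use W(3) s''(4) z in blast)
      then show ?thesis
        using mult_\<A>_apply[OF inner_cont_auto[OF s''(2)] \<Phi>[OF \<gamma>'] z]
          mult_\<A>_apply[OF inner_cont_auto[OF s(2)] \<Phi>[OF s(3)] z] s s'' by simp
    qed
    ultimately show "\<exists>W. openin (prod_topology T TE) W \<and> s \<in> W \<and>
      (\<forall>s'\<in>W. \<forall>z\<in>carrier P. ?m s' z (core N) = ?m s z (core N))" by blast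
  qed
  moreover have "compactin (prod_topology T TE) (carrier P \<times> C)"
    using compact_T closedin_compact_space[OF E(2) C] by (simp add: compactin_Times compact_space_def topspace_T)
  ultimately have "compactin TA (?m ` (carrier P \<times> C))" by (intro image_compactin)
  then have closed: "closedin TA (?m ` (carrier P \<times> C))" by (rule compactin_imp_closedin[OF Hausdorff_TA])
  interpret I: normal "inner_auto P" \<A> by (rule inner_auto_normal)
  have eq: "{f \<in> topspace TA. cls f \<in> (\<lambda>\<gamma>. cls (\<Phi> \<gamma>)) ` C} = ?m ` (carrier P \<times> C)"
  proof (intro equalityI subsetI)
    fix f assume "f \<in> {f \<in> topspace TA. cls f \<in> (\<lambda>\<gamma>. cls (\<Phi> \<gamma>)) ` C}"
    then obtain \<gamma> where \<gamma>: "f \<in> cont_auto P T" "\<gamma> \<in> C" "cls f = cls (\<Phi> \<gamma>)" by (auto simp: topspace_TA)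
    then have "f \<in> cls (\<Phi> \<gamma>)" using A.rcos_self[OF _ I.subgroup_axioms, of f] by (simp add: carrier_\<A>)
    then obtain c where "c \<in> carrier P" "f = inner c \<otimes>\<^bsub>\<A>\<^esub> \<Phi> \<gamma>" by (auto simp: r_coset_def inner_auto_eq)
    then show "f \<in> ?m ` (carrier P \<times> C)" using \<gamma>(2) by (intro image_eqI[of _ _ "(c, \<gamma>)"]) simp_all
  next
    fix f assume "f \<in> ?m ` (carrier P \<times> C)"
    then obtain c \<gamma> where c: "c \<in> carrier P" "\<gamma> \<in> C" "f = inner c \<otimes>\<^bsub>\<A>\<^esub> \<Phi> \<gamma>" by auto
    have \<Phi>\<gamma>: "\<Phi> \<gamma> \<in> cont_auto P T" using \<Phi> c(2) CE by blast
    have f: "f \<in> cont_auto P T" using c mult_\<A>_closed[OF inner_cont_auto[OF c(1)] \<Phi>\<gamma>] by simp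
    have "f \<in> cls (\<Phi> \<gamma>)" using c by (auto simp: r_coset_def inner_auto_eq)
    then have "cls f = cls (\<Phi> \<gamma>)"
      using A.repr_independence[OF _ _ I.subgroup_axioms] \<Phi>\<gamma> by (simp add: carrier_\<A>)
    then show "f \<in> {f \<in> topspace TA. cls f \<in> (\<lambda>\<gamma>. cls (\<Phi> \<gamma>)) ` C}" using f c(2) by (simp add: topspace_TA)
  qed
  have qm: "quotient_map TA TO cls" unfolding out_topology_def by (rule quotient_map_quotient_topology)
  have sub: "(\<lambda>\<gamma>. cls (\<Phi> \<gamma>)) ` C \<subseteq> topspace TO"
    using \<Phi> CE by (auto simp: out_topology_def topspace_TA)
  have "closedin TA {f \<in> topspace TA. cls f \<in> (\<lambda>\<gamma>. cls (\<Phi> \<gamma>)) ` C} \<longleftrightarrow>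
      closedin TO ((\<lambda>\<gamma>. cls (\<Phi> \<gamma>)) ` C)"
    by (rule mp[OF spec[OF conjunct2[OF quotient_map_closedin[THEN iffD1, OF qm]]] sub])
  then show "closedin TO ((\<lambda>\<gamma>. cls (\<Phi> \<gamma>)) ` C)" using closed unfolding eq by blast
qed

text \<open>The induced map to \<open>Out\<close> is continuous, injective and closed, hence a
  homeomorphism onto a closed image. The assumption \<open>loc\<close> is continuity of \<Phi>
  expressed in coordinates, and \<open>faithful\<close> is injectivity modulo inner
  automorphisms.\<close>

lemma closed_subgroup_of_Out:
  assumes E: "group E" "topspace TE = carrier E" "compact_space TE"
    and \<Phi>: "\<Phi> \<in> hom E \<A>"
    and loc: "\<And>\<gamma> N. \<gamma> \<in> carrier E \<Longrightarrow> N \<in> K \<Longrightarrow> \<exists>W. openin TE W \<and> \<gamma> \<in> W \<and>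
      (\<forall>\<gamma>'\<in>W. \<forall>z\<in>carrier P. \<Phi> \<gamma>' z (core N) = \<Phi> \<gamma> z (core N))"
    and faithful: "\<And>\<gamma>. \<gamma> \<in> carrier E \<Longrightarrow> \<Phi> \<gamma> \<in> inner_auto P \<Longrightarrow> \<gamma> = \<one>\<^bsub>E\<^esub>"
  shows "\<exists>H h. subgroup H Out \<and> closedin TO H \<and> h \<in> iso (Out\<lparr>carrier := H\<rparr>) E \<and>
    homeomorphic_map (subtopology TO H) TE h"
proof -
  interpret E: group E by (rule E(1))
  interpret I: normal "inner_auto P" \<A> by (rule inner_auto_normal)
  have Out: "Out = \<A> Mod inner_auto P" by (simp add: OutGroup_def)
  interpret O: group Out unfolding Out by (rule I.factorgroup_is_group)
  have \<Phi>c: "\<Phi> \<gamma> \<in> cont_auto P T" if "\<gamma> \<in> carrier E" for \<gamma>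
    using hom_in_carrier[OF \<Phi> that] by (simp add: carrier_\<A>)
  let ?\<psi> = "\<lambda>\<gamma>. cls (\<Phi> \<gamma>)"
  have \<psi>: "?\<psi> \<in> hom E Out"
    using Group.hom_compose[OF \<Phi> I.r_coset_hom_Mod] by (simp add: comp_def Out)
  interpret \<psi>: group_hom E Out ?\<psi>
    by (intro group_hom.intro group_hom_axioms.intro \<psi> E.is_group O.is_group)
  have "\<gamma> = \<one>\<^bsub>E\<^esub>" if \<gamma>: "\<gamma> \<in> carrier E" "?\<psi> \<gamma> = \<one>\<^bsub>Out\<^esub>" for \<gamma>
  proof (rule faithful[OF \<gamma>(1)])
    have "cls (\<Phi> \<gamma>) = inner_auto P" using \<gamma>(2) by (simp add: Out)
    then show "\<Phi> \<gamma> \<in> inner_auto P"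
      using A.coset_join1[OF _ _ I.subgroup_axioms, of "\<Phi> \<gamma>"] \<Phi>c[OF \<gamma>(1)] by (simp add: carrier_\<A>)
  qed
  then have inj: "inj_on ?\<psi> (carrier E)" using \<psi>.inj_on_one_iff by blast
  let ?H = "?\<psi> ` carrier E"
  have H: "subgroup ?H Out" by (rule \<psi>.img_is_subgroup)
  have "continuous_map TE TA \<Phi>"
    by (rule continuous_map_into_TA) (use \<Phi>c loc E(2) in simp_all)
  moreover have "continuous_map TA TO cls"
    unfolding out_topology_def by (rule quotient_imp_continuous_map[OF quotient_map_quotient_topology])
  ultimately have cont: "continuous_map TE TO ?\<psi>"
    using continuous_map_compose[of TE TA \<Phi> TO cls] by (simp add: comp_def)
  have clm: "closed_map TE TO ?\<psi>" by (rule closed_map_cls[OF E(2,3) \<Phi>c loc])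
  have closed: "closedin TO ?H"
    using clm closedin_topspace[of TE] E(2) unfolding closed_map_def by metis
  have tsH: "topspace (subtopology TO ?H) = ?H"
    using closedin_subset[OF closed] by auto
  have "homeomorphic_map TE (subtopology TO ?H) ?\<psi>"
  proof (rule bijective_closed_imp_homeomorphic_map)
    show "continuous_map TE (subtopology TO ?H) ?\<psi>" using cont E(2) by (simp add: continuous_map_in_subtopology)
    show "closed_map TE (subtopology TO ?H) ?\<psi>" using clm E(2) by (intro closed_map_into_subtopology) auto
  qed (use E(2) tsH inj in simp_all)
  then obtain g where g: "homeomorphic_maps TE (subtopology TO ?H) ?\<psi> g" unfolding homeomorphic_map_maps ..
  \<comment> \<open>The inverse isomorphism of groups; it has to be matched with the inverse
    homeomorphism \<open>g\<close>.\<close>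
  let ?h = "inv_into (carrier E) ?\<psi>"
  have "homeomorphic_map (subtopology TO ?H) TE g" using g by (simp add: homeomorphic_maps_map)
  moreover have "g y = ?h y" if y: "y \<in> topspace (subtopology TO ?H)" for y
  proof -
    obtain \<gamma> where \<gamma>: "\<gamma> \<in> carrier E" "y = ?\<psi> \<gamma>" using y unfolding tsH by blast
    then show ?thesis using g inv_into_f_f[OF inj \<gamma>(1)] E(2) by (simp add: homeomorphic_maps_def)
  qed
  ultimately have "homeomorphic_map (subtopology TO ?H) TE ?h" by (rule homeomorphic_map_eq)
  moreover have "?\<psi> \<in> iso E (Out\<lparr>carrier := ?H\<rparr>)"
    using \<psi> inj by (auto simp: iso_def hom_def bij_betw_def)
  then have "?h \<in> iso (Out\<lparr>carrier := ?H\<rparr>) E" by (rule E.iso_set_sym)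
  ultimately show ?thesis using H closed by blast
qed

end

section \<open>Extending actions to completions\<close>

text \<open>\<open>R\<close> is a discrete group. The assumption \<open>trivial_in_K\<close> makes
  its action continuous for the pro-\<open>p\<close> topology of \<open>R\<close>, which is what an
  extension to the completion of \<open>R\<close> requires.\<close>

locale discrete_action = fg_pro_p_group G p + E: pro_p_group R p
  for G :: "('a, 'b) monoid_scheme" (structure) and p and R :: "('c, 'd) monoid_scheme" +
  fixes \<rho> :: "'c \<Rightarrow> ('a set \<Rightarrow> 'a set) \<Rightarrow> 'a set \<Rightarrow> 'a set"
  assumes \<rho>_hom: "\<rho> \<in> hom R \<A>"
    and trivial_in_K: "\<And>N. N \<in> K \<Longrightarrow>
      {w \<in> carrier R. \<forall>z\<in>carrier P. \<rho> w z (core N) = z (core N)} \<in> E.K"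
begin

definition RK :: "'a set \<Rightarrow> 'c set"
  where "RK N = {w \<in> carrier R. \<forall>z\<in>carrier P. \<rho> w z (core N) = z (core N)}"

lemma RK_in_K: "N \<in> K \<Longrightarrow> RK N \<in> E.K"
  unfolding RK_def by (rule trivial_in_K)

lemma \<rho>_cont_auto: "w \<in> carrier R \<Longrightarrow> \<rho> w \<in> cont_auto P T"
  using hom_in_carrier[OF \<rho>_hom] by (simp add: carrier_\<A>)

lemma \<rho>_closed: "w \<in> carrier R \<Longrightarrow> z \<in> carrier P \<Longrightarrow> \<rho> w z \<in> carrier P"
  by (rule cont_autoD(4)[OF \<rho>_cont_auto])

lemma \<rho>_mult:
  "w \<in> carrier R \<Longrightarrow> w' \<in> carrier R \<Longrightarrow> z \<in> carrier P \<Longrightarrow> \<rho> (w \<otimes>\<^bsub>R\<^esub> w') z = \<rho> w (\<rho> w' z)"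
  by (simp add: hom_mult[OF \<rho>_hom] mult_\<A>_apply \<rho>_cont_auto)

lemma \<rho>_one: "z \<in> carrier P \<Longrightarrow> \<rho> \<one>\<^bsub>R\<^esub> z = z"
  using hom_one[OF \<rho>_hom E.is_group group_\<A>] by (simp add: one_\<A>)

lemma \<rho>_agree:
  assumes N: "N \<in> K" and w: "w \<in> carrier R" "w' \<in> carrier R" "RK N #>\<^bsub>R\<^esub> w = RK N #>\<^bsub>R\<^esub> w'"
    and z: "z \<in> carrier P"
  shows "\<rho> w z N = \<rho> w' z N"
proof -
  let ?u = "w \<otimes>\<^bsub>R\<^esub> inv\<^bsub>R\<^esub> w'"
  have u: "?u \<in> RK N" using E.rcos_eq_iff[OF E.K_subgroup[OF RK_in_K[OF N]] w(1,2)] w(3) by simp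
  have "w = ?u \<otimes>\<^bsub>R\<^esub> w'" using w by (simp add: E.m_assoc)
  then have "\<rho> w z = \<rho> ?u (\<rho> w' z)" using \<rho>_mult[of ?u w' z] w z by simp
  then have "\<rho> w z (core N) = \<rho> w' z (core N)" using u \<rho>_closed[OF w(2) z] by (simp add: RK_def)
  then show ?thesis
    by (rule P_agree_mono[OF \<rho>_closed[OF w(1) z] \<rho>_closed[OF w(2) z] core_in_K[OF N] N core_subset[OF N]])
qed

text \<open>The continuous extension of \<rho>: the coordinate \<open>N\<close> is computed with any
  element of \<open>R\<close> that represents \<gamma> modulo \<open>RK N\<close>, and by
  \<open>\<rho>_agree\<close> the choice does not matter.\<close>

definition \<Phi> :: "('c set \<Rightarrow> 'c set) \<Rightarrow> ('a set \<Rightarrow> 'a set) \<Rightarrow> 'a set \<Rightarrow> 'a set"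
  where "\<Phi> \<gamma> = (\<lambda>z\<in>carrier P. \<lambda>N\<in>K. \<rho> (SOME w. w \<in> carrier R \<and> \<gamma> (RK N) = RK N #>\<^bsub>R\<^esub> w) z N)"

lemma \<Phi>_eq:
  assumes N: "N \<in> K" and w: "w \<in> carrier R" "\<gamma> (RK N) = RK N #>\<^bsub>R\<^esub> w" and z: "z \<in> carrier P"
  shows "\<Phi> \<gamma> z N = \<rho> w z N"
proof -
  have "\<rho> (SOME w. w \<in> carrier R \<and> \<gamma> (RK N) = RK N #>\<^bsub>R\<^esub> w) z N = \<rho> w z N"
  proof (rule someI2[of _ w])
    fix w' assume "w' \<in> carrier R \<and> \<gamma> (RK N) = RK N #>\<^bsub>R\<^esub> w'"
    then show "\<rho> w' z N = \<rho> w z N" using w by (intro \<rho>_agree[OF N _ w(1) _ z]) simp_all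
  qed (use w in simp)
  then show ?thesis using N z by (simp add: \<Phi>_def)
qed

lemma \<Phi>_approx:
  assumes \<gamma>: "\<gamma> \<in> carrier E.P" and S: "finite S" "S \<subseteq> K"
  shows "\<exists>w\<in>carrier R. \<forall>N\<in>S. \<gamma> (RK N) = RK N #>\<^bsub>R\<^esub> w \<and> (\<forall>z\<in>carrier P. \<Phi> \<gamma> z N = \<rho> w z N)"
proof -
  have "finite (RK ` S)" "RK ` S \<subseteq> E.K" using S RK_in_K by auto
  then obtain w where "w \<in> carrier R" "\<forall>N\<in>RK ` S. \<gamma> N = N #>\<^bsub>R\<^esub> w" using E.P_approx[OF \<gamma>] by blast
  then show ?thesis using \<Phi>_eq S by (intro bexI[of _ w]) auto
qed

lemma \<Phi>_ex:
  assumes "\<gamma> \<in> carrier E.P" "N \<in> K"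
  obtains w where "w \<in> carrier R" "\<gamma> (RK N) = RK N #>\<^bsub>R\<^esub> w" "\<And>z. z \<in> carrier P \<Longrightarrow> \<Phi> \<gamma> z N = \<rho> w z N"
  using \<Phi>_approx[OF assms(1), of "{N}"] assms(2) by auto

lemma \<Phi>_closed:
  assumes \<gamma>: "\<gamma> \<in> carrier E.P" and z: "z \<in> carrier P"
  shows "\<Phi> \<gamma> z \<in> carrier P"
  unfolding mem_P
proof (intro conjI ballI impI)
  show "\<Phi> \<gamma> z \<in> (\<Pi>\<^sub>E N\<in>K. carrier (G Mod N))"
  proof (rule PiE_I)
    fix N assume N: "N \<in> K"
    obtain w where w: "w \<in> carrier R" "\<Phi> \<gamma> z N = \<rho> w z N" using \<Phi>_ex[OF \<gamma> N] z by metis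
    then show "\<Phi> \<gamma> z N \<in> carrier (G Mod N)" using P_coord[OF \<rho>_closed[OF w(1) z] N] by simp
  qed (use z in \<open>simp add: \<Phi>_def\<close>)
  fix N M assume NM: "N \<in> K" "M \<in> K" "N \<subseteq> M"
  have "finite {N, M}" "{N, M} \<subseteq> K" using NM by simp_all
  then obtain w where w: "w \<in> carrier R" "\<forall>L\<in>{N, M}. \<gamma> (RK L) = RK L #>\<^bsub>R\<^esub> w \<and> (\<forall>z\<in>carrier P. \<Phi> \<gamma> z L = \<rho> w z L)"
    using \<Phi>_approx[OF \<gamma>, of "{N, M}"] by metis
  then have "\<Phi> \<gamma> z N = \<rho> w z N" "\<Phi> \<gamma> z M = \<rho> w z M" using z by simp_all
  then show "\<Phi> \<gamma> z M = M <#> \<Phi> \<gamma> z N" using P_compat[OF \<rho>_closed[OF w(1) z] NM] by simp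
qed

lemma \<Phi>_one: "z \<in> carrier P \<Longrightarrow> \<Phi> \<one>\<^bsub>E.P\<^esub> z = z"
proof (rule P_eqI)
  fix N assume z: "z \<in> carrier P" and N: "N \<in> K"
  have RN: "RK N \<in> E.K" by (rule RK_in_K[OF N])
  have "\<one>\<^bsub>E.P\<^esub> (RK N) = RK N #>\<^bsub>R\<^esub> \<one>\<^bsub>R\<^esub>"
    using E.P_one[OF RN] subgroup.subset[OF E.K_subgroup[OF RN]] by simp
  then have "\<Phi> \<one>\<^bsub>E.P\<^esub> z N = \<rho> \<one>\<^bsub>R\<^esub> z N" by (intro \<Phi>_eq N z) simp_all
  then show "\<exists>M\<in>K. M \<subseteq> N \<and> \<Phi> \<one>\<^bsub>E.P\<^esub> z M = z M" using N \<rho>_one[OF z] by auto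
qed (simp_all add: \<Phi>_closed)

lemma \<Phi>_mult:
  assumes \<gamma>: "\<gamma> \<in> carrier E.P" and \<delta>: "\<delta> \<in> carrier E.P" and z: "z \<in> carrier P"
  shows "\<Phi> (\<gamma> \<otimes>\<^bsub>E.P\<^esub> \<delta>) z = \<Phi> \<gamma> (\<Phi> \<delta> z)"
proof (rule P_eqI)
  fix N assume N: "N \<in> K"
  have M: "core N \<in> K" by (rule core_in_K[OF N])
  obtain w where w: "w \<in> carrier R" "\<gamma> (RK N) = RK N #>\<^bsub>R\<^esub> w"
    "\<And>z. z \<in> carrier P \<Longrightarrow> \<Phi> \<gamma> z N = \<rho> w z N" using \<Phi>_ex[OF \<gamma> N] by metis
  \<comment> \<open>\<delta> is approximated at \<open>core N\<close> as well: an automorphism such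
    as \<open>\<rho> w\<close> respects agreement at \<open>core N\<close>, but agreement at
    \<open>N\<close> alone might be lost.\<close>
  have "finite {N, core N}" "{N, core N} \<subseteq> K" using N M by simp_all
  then obtain v where "v \<in> carrier R" "\<forall>L\<in>{N, core N}. \<delta> (RK L) = RK L #>\<^bsub>R\<^esub> v \<and> (\<forall>z\<in>carrier P. \<Phi> \<delta> z L = \<rho> v z L)"
    using \<Phi>_approx[OF \<delta>, of "{N, core N}"] by metis
  then have v: "v \<in> carrier R" "\<delta> (RK N) = RK N #>\<^bsub>R\<^esub> v" "\<Phi> \<delta> z (core N) = \<rho> v z (core N)" using z by simp_all
  have \<delta>z: "\<Phi> \<delta> z \<in> carrier P" and vz: "\<rho> v z \<in> carrier P" using \<Phi>_closed[OF \<delta> z] \<rho>_closed[OF v(1) z] .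
  have "\<rho> w (\<Phi> \<delta> z) (core N) = \<rho> w (\<rho> v z) (core N)"
    by (rule core_agree[OF N \<rho>_cont_auto[OF w(1)] \<delta>z vz v(3)])
  then have "\<rho> w (\<Phi> \<delta> z) N = \<rho> w (\<rho> v z) N"
    by (rule P_agree_mono[OF \<rho>_closed[OF w(1) \<delta>z] \<rho>_closed[OF w(1) vz] M N core_subset[OF N]])
  then have "\<Phi> \<gamma> (\<Phi> \<delta> z) N = \<rho> (w \<otimes>\<^bsub>R\<^esub> v) z N"
    using w(3)[OF \<delta>z] \<rho>_mult[OF w(1) v(1) z] by simp
  moreover have "(\<gamma> \<otimes>\<^bsub>E.P\<^esub> \<delta>) (RK N) = RK N #>\<^bsub>R\<^esub> (w \<otimes>\<^bsub>R\<^esub> v)"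
    by (rule E.P_mult_rcos[of "RK N" w v \<gamma> \<delta>, OF RK_in_K[OF N] w(1) v(1) w(2) v(2)])
  then have "\<Phi> (\<gamma> \<otimes>\<^bsub>E.P\<^esub> \<delta>) z N = \<rho> (w \<otimes>\<^bsub>R\<^esub> v) z N" using w v by (intro \<Phi>_eq N z) simp_all
  ultimately show "\<exists>M\<in>K. M \<subseteq> N \<and> \<Phi> (\<gamma> \<otimes>\<^bsub>E.P\<^esub> \<delta>) z M = \<Phi> \<gamma> (\<Phi> \<delta> z) M" using N by auto
qed (simp_all add: \<Phi>_closed \<gamma> \<delta> z)

lemma \<Phi>_cont_auto:
  assumes \<gamma>: "\<gamma> \<in> carrier E.P"
  shows "\<Phi> \<gamma> \<in> cont_auto P T"
proof -
  have cl: "\<And>z. z \<in> carrier P \<Longrightarrow> \<Phi> \<gamma> z \<in> carrier P" by (rule \<Phi>_closed[OF \<gamma>])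
  have "\<Phi> \<gamma> \<in> hom P P"
  proof (rule homI[OF cl])
    fix x y assume x: "x \<in> carrier P" and y: "y \<in> carrier P"
    show "\<Phi> \<gamma> (x \<otimes>\<^bsub>P\<^esub> y) = \<Phi> \<gamma> x \<otimes>\<^bsub>P\<^esub> \<Phi> \<gamma> y"
    proof (rule P_eqI)
      fix N assume N: "N \<in> K"
      obtain w where w: "w \<in> carrier R" "\<And>z. z \<in> carrier P \<Longrightarrow> \<Phi> \<gamma> z N = \<rho> w z N" using \<Phi>_ex[OF \<gamma> N] by metis
      have "\<rho> w (x \<otimes>\<^bsub>P\<^esub> y) = \<rho> w x \<otimes>\<^bsub>P\<^esub> \<rho> w y"
        by (rule hom_mult[OF cont_autoD(2)[OF \<rho>_cont_auto[OF w(1)]] x y])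
      then have "\<Phi> \<gamma> (x \<otimes>\<^bsub>P\<^esub> y) N = (\<Phi> \<gamma> x \<otimes>\<^bsub>P\<^esub> \<Phi> \<gamma> y) N" using w x y P_mult[OF N] by simp
      then show "\<exists>M\<in>K. M \<subseteq> N \<and> \<Phi> \<gamma> (x \<otimes>\<^bsub>P\<^esub> y) M = (\<Phi> \<gamma> x \<otimes>\<^bsub>P\<^esub> \<Phi> \<gamma> y) M" using N by auto
    qed (simp_all add: cl x y)
  qed
  moreover have "bij_betw (\<Phi> \<gamma>) (carrier P) (carrier P)"
  proof (rule bij_betwI[where g = "\<Phi> (inv\<^bsub>E.P\<^esub> \<gamma>)"])
    fix z assume z: "z \<in> carrier P"
    show "\<Phi> (inv\<^bsub>E.P\<^esub> \<gamma>) (\<Phi> \<gamma> z) = z" "\<Phi> \<gamma> (\<Phi> (inv\<^bsub>E.P\<^esub> \<gamma>) z) = z"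
      using \<Phi>_mult[of "inv\<^bsub>E.P\<^esub> \<gamma>" \<gamma> z] \<Phi>_mult[of \<gamma> "inv\<^bsub>E.P\<^esub> \<gamma>" z] \<Phi>_one[OF z] \<gamma> z by simp_all
  qed (use \<Phi>_closed \<gamma> in auto)
  moreover have "continuous_map T T (\<Phi> \<gamma>)"
  proof (rule continuous_map_TI[OF cl])
    fix N z assume N: "N \<in> K" and z: "z \<in> carrier P"
    obtain w where w: "w \<in> carrier R" "\<And>z. z \<in> carrier P \<Longrightarrow> \<Phi> \<gamma> z N = \<rho> w z N" using \<Phi>_ex[OF \<gamma> N] by metis
    show "\<exists>M\<in>K. \<forall>z'\<in>carrier P. z' M = z M \<longrightarrow> \<Phi> \<gamma> z' N = \<Phi> \<gamma> z N"
      using continuous_map_TD[OF cont_autoD(3)[OF \<rho>_cont_auto[OF w(1)]] N z] w(2) z by simp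
  qed
  ultimately show ?thesis by (simp add: cont_auto_def auto_def Bij_def \<Phi>_def)
qed

lemma \<Phi>_hom: "\<Phi> \<in> hom E.P \<A>"
proof (rule homI)
  fix \<gamma> \<delta> assume \<gamma>\<delta>: "\<gamma> \<in> carrier E.P" "\<delta> \<in> carrier E.P"
  show "\<Phi> (\<gamma> \<otimes>\<^bsub>E.P\<^esub> \<delta>) = \<Phi> \<gamma> \<otimes>\<^bsub>\<A>\<^esub> \<Phi> \<delta>"
    by (rule cont_auto_eqI)
      (simp_all add: \<gamma>\<delta> \<Phi>_cont_auto mult_\<A>_closed mult_\<A>_apply \<Phi>_mult)
qed (simp add: carrier_\<A> \<Phi>_cont_auto)

text \<open>If \<open>\<Phi> \<gamma>\<close> is inner, approximate \<gamma> by some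
  \<open>w\<close> in \<open>R\<close> modulo both \<open>L\<close> and \<open>RK N\<close>. Then
  \<open>\<rho> w\<close> agrees with the inner automorphism at \<open>N\<close>, so
  \<open>w\<close> lies in \<open>L\<close>. Thus faithfulness on the completion reduces to elements
  of \<open>R\<close> and single coordinates of \<open>P\<close>.\<close>

lemma contains_free_pro_p_if_detected:
  assumes detect: "\<And>L. L \<in> E.K \<Longrightarrow> \<exists>N\<in>K. \<forall>w\<in>carrier R. \<forall>c\<in>carrier P.
      (\<forall>z\<in>carrier P. \<rho> w z N = inner c z N) \<longrightarrow> w \<in> L"
  shows "\<exists>H h. subgroup H Out \<and> closedin TO H \<and> h \<in> iso (Out\<lparr>carrier := H\<rparr>) E.P \<and>
    homeomorphic_map (subtopology TO H) E.T h"
proof (rule closed_subgroup_of_Out[OF E.P_group E.topspace_T E.compact_T \<Phi>_hom])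
  fix \<gamma> N assume \<gamma>: "\<gamma> \<in> carrier E.P" and N: "N \<in> K"
  have M: "core N \<in> K" by (rule core_in_K[OF N])
  let ?W = "{\<gamma>' \<in> carrier E.P. \<gamma>' (RK (core N)) \<in> {\<gamma> (RK (core N))}}"
  have "openin E.T ?W" by (rule E.openin_coord[OF RK_in_K[OF M]])
  moreover have "\<gamma> \<in> ?W" using \<gamma> by simp
  moreover have "\<Phi> \<gamma>' z (core N) = \<Phi> \<gamma> z (core N)" if "\<gamma>' \<in> ?W" and z: "z \<in> carrier P" for \<gamma>' z
  proof -
    have \<gamma>': "\<gamma>' \<in> carrier E.P" "\<gamma>' (RK (core N)) = \<gamma> (RK (core N))" using \<open>\<gamma>' \<in> ?W\<close> by simp_all
    obtain w where w: "w \<in> carrier R" "\<gamma> (RK (core N)) = RK (core N) #>\<^bsub>R\<^esub> w" using \<Phi>_ex[OF \<gamma> M] by metis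
    then show ?thesis using \<Phi>_eq[OF M w(1) _ z] \<gamma>'(2) by simp
  qed
  ultimately show "\<exists>W. openin E.T W \<and> \<gamma> \<in> W \<and> (\<forall>\<gamma>'\<in>W. \<forall>z\<in>carrier P. \<Phi> \<gamma>' z (core N) = \<Phi> \<gamma> z (core N))"
    by blast
next
  fix \<gamma> assume \<gamma>: "\<gamma> \<in> carrier E.P" and inn: "\<Phi> \<gamma> \<in> inner_auto P"
  obtain c where c: "c \<in> carrier P" "\<Phi> \<gamma> = inner c" using inn unfolding inner_auto_eq by blast
  show "\<gamma> = \<one>\<^bsub>E.P\<^esub>"
  proof (rule E.P_eqI[OF \<gamma> E.P.one_closed])
    fix L assume L: "L \<in> E.K"
    obtain N where N: "N \<in> K" "\<forall>w\<in>carrier R. \<forall>c\<in>carrier P. (\<forall>z\<in>carrier P. \<rho> w z N = inner c z N) \<longrightarrow> w \<in> L"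
      using detect[OF L] by metis
    have "finite {L, RK N}" "{L, RK N} \<subseteq> E.K" using L RK_in_K[OF N(1)] by simp_all
    then obtain w where "w \<in> carrier R" "\<forall>M\<in>{L, RK N}. \<gamma> M = M #>\<^bsub>R\<^esub> w"
      using E.P_approx[OF \<gamma>, of "{L, RK N}"] by metis
    then have w: "w \<in> carrier R" "\<gamma> L = L #>\<^bsub>R\<^esub> w" "\<gamma> (RK N) = RK N #>\<^bsub>R\<^esub> w" by simp_all
    have "\<rho> w z N = inner c z N" if "z \<in> carrier P" for z
      using \<Phi>_eq[of N w \<gamma> z, OF N(1) w(1,3) that] c(2) by simp
    then have "w \<in> L" using N(2) w(1) c(1) by metis
    then have "\<gamma> L = \<one>\<^bsub>E.P\<^esub> L"
      using w(2) E.coset_join2[OF w(1) E.K_subgroup[OF L]] E.P_one[OF L] by simp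
    then show "\<exists>M\<in>E.K. M \<subseteq> L \<and> \<gamma> M = \<one>\<^bsub>E.P\<^esub> M" using L by auto
  qed
qed

end

section \<open>The action on finite characteristic quotients\<close>

context fg_pro_p_group
begin

text \<open>The automorphism of \<open>G Mod core N\<close> induced by \<open>f\<close>. By
  \<open>core_agree\<close> the choice of the lift of a coset is immaterial.\<close>

definition res :: "'a set \<Rightarrow> (('a set \<Rightarrow> 'a set) \<Rightarrow> 'a set \<Rightarrow> 'a set) \<Rightarrow> 'a set \<Rightarrow> 'a set"
  where "res N f = (\<lambda>C\<in>carrier (G Mod core N).
    f (emb (SOME a. a \<in> carrier G \<and> C = core N #> a)) (core N))"

lemma res_apply:
  assumes N: "N \<in> K" and f: "f \<in> cont_auto P T" and z: "z \<in> carrier P"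
  shows "res N f (z (core N)) = f z (core N)"
proof -
  have M: "core N \<in> K" by (rule core_in_K[OF N])
  obtain a where a: "a \<in> carrier G" "z (core N) = core N #> a" using P_coset_ex[OF z M] by blast
  have "f (emb (SOME a. a \<in> carrier G \<and> z (core N) = core N #> a)) (core N) = f z (core N)"
  proof (rule someI2[of _ a])
    fix b assume b: "b \<in> carrier G \<and> z (core N) = core N #> b"
    then show "f (emb b) (core N) = f z (core N)"
      by (intro core_agree[OF N f]) (simp_all add: emb_closed z emb_apply[OF M])
  qed (use a in simp)
  then show ?thesis using P_coord[OF z M] by (simp add: res_def)
qed

lemma coord_surj: "M \<in> K \<Longrightarrow> C \<in> carrier (G Mod M) \<Longrightarrow> \<exists>z\<in>carrier P. C = z M"
  by (auto simp: carrier_FactGroup emb_apply intro!: bexI[OF _ emb_closed])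

lemma res_mult:
  assumes N: "N \<in> K" and f: "f \<in> cont_auto P T" "g \<in> cont_auto P T"
  shows "res N (f \<otimes>\<^bsub>\<A>\<^esub> g) = compose (carrier (G Mod core N)) (res N f) (res N g)"
proof (rule extensionalityI[of _ "carrier (G Mod core N)"])
  have M: "core N \<in> K" by (rule core_in_K[OF N])
  fix C assume C: "C \<in> carrier (G Mod core N)"
  obtain z where z: "z \<in> carrier P" "C = z (core N)" using coord_surj[OF M C] by blast
  have gz: "g z \<in> carrier P" by (rule cont_autoD(4)[OF f(2) z(1)])
  have "res N (f \<otimes>\<^bsub>\<A>\<^esub> g) C = f (g z) (core N)"
    using res_apply[OF N mult_\<A>_closed[OF f] z(1)] mult_\<A>_apply[OF f z(1)] z(2) by simp
  also have "\<dots> = res N f (res N g C)" using res_apply[OF N f(1) gz] res_apply[OF N f(2) z(1)] z(2) by simp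
  finally show "res N (f \<otimes>\<^bsub>\<A>\<^esub> g) C = compose (carrier (G Mod core N)) (res N f) (res N g) C"
    using C by (simp add: compose_def)
qed (simp_all add: res_def)

lemma res_one: "N \<in> K \<Longrightarrow> res N \<one>\<^bsub>\<A>\<^esub> = (\<lambda>C\<in>carrier (G Mod core N). C)"
proof (rule extensionalityI[of _ "carrier (G Mod core N)"])
  fix C assume N: "N \<in> K" and C: "C \<in> carrier (G Mod core N)"
  obtain z where z: "z \<in> carrier P" "C = z (core N)" using coord_surj[OF core_in_K[OF N] C] by blast
  have "\<one>\<^bsub>\<A>\<^esub> \<in> cont_auto P T" using A.one_closed by (simp add: carrier_\<A>)
  from res_apply[OF N this z(1)] show "res N \<one>\<^bsub>\<A>\<^esub> C = (\<lambda>C\<in>carrier (G Mod core N). C) C"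
    using z C by (simp add: one_\<A>)
qed (simp_all add: res_def)

lemma res_auto:
  assumes N: "N \<in> K" and f: "f \<in> cont_auto P T"
  shows "res N f \<in> auto (G Mod core N)"
proof -
  let ?Q = "G Mod core N"
  have M: "core N \<in> K" by (rule core_in_K[OF N])
  have cl: "res N g C \<in> carrier ?Q" if g: "g \<in> cont_auto P T" and C: "C \<in> carrier ?Q" for g C
  proof -
    obtain z where z: "z \<in> carrier P" "C = z (core N)" using coord_surj[OF M C] by blast
    then show ?thesis using res_apply[OF N g z(1)] P_coord[OF cont_autoD(4)[OF g z(1)] M] by simp
  qed
  have "res N f \<in> hom ?Q ?Q"
  proof (rule homI[OF cl[OF f]])
    fix C D assume CD: "C \<in> carrier ?Q" "D \<in> carrier ?Q"
    obtain z where z: "z \<in> carrier P" "C = z (core N)" using coord_surj[OF M CD(1)] by blast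
    obtain y where y: "y \<in> carrier P" "D = y (core N)" using coord_surj[OF M CD(2)] by blast
    have fz: "f z \<in> carrier P" "f y \<in> carrier P" using cont_autoD(4)[OF f] z y by simp_all
    have "C \<otimes>\<^bsub>?Q\<^esub> D = (z \<otimes>\<^bsub>P\<^esub> y) (core N)" using z y by (simp add: P_mult[OF M])
    then have "res N f (C \<otimes>\<^bsub>?Q\<^esub> D) = f (z \<otimes>\<^bsub>P\<^esub> y) (core N)" using z y by (simp add: res_apply[OF N f])
    also have "\<dots> = f z (core N) <#> f y (core N)"
      using hom_mult[OF cont_autoD(2)[OF f] z(1) y(1)] by (simp add: P_mult[OF M])
    finally show "res N f (C \<otimes>\<^bsub>?Q\<^esub> D) = res N f C \<otimes>\<^bsub>?Q\<^esub> res N f D"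
      using res_apply[OF N f] z y by simp
  qed
  moreover have "bij_betw (res N f) (carrier ?Q) (carrier ?Q)"
  proof (rule bij_betwI[where g = "res N (inv\<^bsub>\<A>\<^esub> f)"])
    have i: "inv\<^bsub>\<A>\<^esub> f \<in> cont_auto P T" by (rule inv_\<A>_closed[OF f])
    have fA: "f \<in> carrier \<A>" using f by (simp add: carrier_\<A>)
    show "res N f \<in> carrier ?Q \<rightarrow> carrier ?Q" "res N (inv\<^bsub>\<A>\<^esub> f) \<in> carrier ?Q \<rightarrow> carrier ?Q"
      using cl[OF f] cl[OF i] by auto
    fix C assume C: "C \<in> carrier ?Q"
    show "res N (inv\<^bsub>\<A>\<^esub> f) (res N f C) = C"
      using fun_cong[OF res_mult[OF N i f], of C] C A.l_inv[OF fA] res_one[OF N] by (simp add: compose_def)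
    show "res N f (res N (inv\<^bsub>\<A>\<^esub> f) C) = C"
      using fun_cong[OF res_mult[OF N f i], of C] C A.r_inv[OF fA] res_one[OF N] by (simp add: compose_def)
  qed
  ultimately show ?thesis by (simp add: auto_def Bij_def res_def)
qed

lemma res_hom: "N \<in> K \<Longrightarrow> res N \<in> hom \<A> (AutoGroup (G Mod core N))"
  by (rule homI) (simp_all add: carrier_\<A> AutoGroup_simps AutoGroup_mult res_auto res_mult)

lemma res_ind_ia:
  assumes \<alpha>: "ia_endo \<alpha>" and N: "N \<in> K"
  shows "res N (ind \<alpha>) \<in> ia_autos (G Mod core N)"
proof -
  have M: "core N \<in> K" by (rule core_in_K[OF N])
  have \<alpha>h: "\<alpha> \<in> hom G G" using \<alpha> by (simp add: ia_endo_def)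
  have c: "ind \<alpha> \<in> cont_auto P T" by (rule ind_cont_auto[OF \<alpha>])
  have "inv\<^bsub>G Mod core N\<^esub> C \<otimes>\<^bsub>G Mod core N\<^esub> res N (ind \<alpha>) C \<in> derived (G Mod core N) (carrier (G Mod core N))"
    if C: "C \<in> carrier (G Mod core N)" for C
  proof -
    obtain a where a: "a \<in> carrier G" "C = core N #> a" using C unfolding carrier_FactGroup by blast
    have "res N (ind \<alpha>) C = core N #> \<alpha> a"
      using res_apply[OF N c emb_closed[OF a(1)]] ind_emb[OF \<alpha>h a(1) M] emb_apply[OF M] a(2) by simp
    then show ?thesis using ia_quot[OF \<alpha> M a(1)] a(2) by simp
  qed
  then show ?thesis using res_auto[OF N c] by (simp add: ia_autos_def)
qed

text \<open>The image of \<open>R\<close> in the automorphism group of \<open>G Mod core N\<close>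
  is generated by IA-automorphisms and so lies in a finite \<open>p\<close>-group; the set in
  question is the kernel of this homomorphism.\<close>

lemma trivial_in_K_if_ia:
  fixes R :: "('c, 'd) monoid_scheme"
  assumes R: "group R" and S: "S \<subseteq> carrier R" "generate R S = carrier R"
    and \<rho>: "\<rho> \<in> hom R \<A>" and ia: "\<And>s. s \<in> S \<Longrightarrow> \<exists>\<alpha>. ia_endo \<alpha> \<and> \<rho> s = ind \<alpha>" and N: "N \<in> K"
  shows "{w \<in> carrier R. \<forall>z\<in>carrier P. \<rho> w z (core N) = z (core N)} \<in> p_quotient_kernels p R"
proof -
  interpret R: pro_p_group R p by (intro pro_p_group.intro pro_p_group_axioms.intro R prime_p)
  have M: "core N \<in> K" by (rule core_in_K[OF N])
  let ?Q = "G Mod core N"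
  interpret Q: group ?Q by (rule K_group[OF M])
  let ?A = "AutoGroup ?Q"
  interpret AQ: group ?A by (rule Q.AutoGroup)
  let ?\<tau> = "\<lambda>w. res N (\<rho> w)"
  have \<tau>: "?\<tau> \<in> hom R ?A" using Group.hom_compose[OF \<rho> res_hom[OF N]] by (simp add: comp_def)
  interpret \<tau>: group_hom R ?A ?\<tau>
    by (intro group_hom.intro group_hom_axioms.intro R AQ.is_group \<tau>)
  have "?\<tau> ` carrier R = generate ?A (?\<tau> ` S)" using \<tau>.generate_img[OF S(1)] S(2) by simp
  also have "\<dots> \<subseteq> ia_autos ?Q"
    using ia res_ind_ia[OF _ N] by (intro AQ.generate_subgroup_incl Q.subgroup_ia_autos) fastforce
  finally have "?\<tau> \<in> hom R (?A\<lparr>carrier := ia_autos ?Q\<rparr>)"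
    using \<tau> by (auto simp: hom_def)
  then have "kernel R (?A\<lparr>carrier := ia_autos ?Q\<rparr>) ?\<tau> \<in> p_quotient_kernels p R"
    using M by (intro R.kernel_in_K Q.finite_p_group_ia_autos prime_p) (simp_all add: K_iff)
  moreover have "kernel R (?A\<lparr>carrier := ia_autos ?Q\<rparr>) ?\<tau> =
      {w \<in> carrier R. \<forall>z\<in>carrier P. \<rho> w z (core N) = z (core N)}"
  proof -
    have "?\<tau> w = \<one>\<^bsub>?A\<^esub> \<longleftrightarrow> (\<forall>z\<in>carrier P. \<rho> w z (core N) = z (core N))" if w: "w \<in> carrier R" for w
    proof -
      have c: "\<rho> w \<in> cont_auto P T" using hom_in_carrier[OF \<rho> w] by (simp add: carrier_\<A>)
      have "?\<tau> w = \<one>\<^bsub>?A\<^esub> \<longleftrightarrow> (\<forall>C\<in>carrier ?Q. ?\<tau> w C = C)"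
      proof
        assume "\<forall>C\<in>carrier ?Q. ?\<tau> w C = C"
        then show "?\<tau> w = \<one>\<^bsub>?A\<^esub>"
          using res_auto[OF N c] Q.id_in_auto
          by (intro auto_eqI[of _ ?Q]) (simp_all add: AutoGroup_simps)
      qed (simp add: AutoGroup_simps)
      also have "\<dots> \<longleftrightarrow> (\<forall>z\<in>carrier P. ?\<tau> w (z (core N)) = z (core N))"
        using coord_surj[OF M] P_coord[OF _ M] by metis
      finally show ?thesis using res_apply[OF N c] by simp
    qed
    then show ?thesis by (auto simp: kernel_def)
  qed
  ultimately show ?thesis by simp
qed

end

section \<open>Free groups and wreath products\<close>

definition free_lift :: "('h, 'k) monoid_scheme \<Rightarrow> ('a \<Rightarrow> 'h) \<Rightarrow> ('a \<times> bool) list \<Rightarrow> 'h"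
  where "free_lift H g w = foldr (\<lambda>l acc. (if snd l then g (fst l) else inv\<^bsub>H\<^esub> g (fst l)) \<otimes>\<^bsub>H\<^esub> acc) w \<one>\<^bsub>H\<^esub>"

lemma free_group_simps:
  "carrier (free_group S) = {w. reduced w \<and> set w \<subseteq> S \<times> UNIV}"
  "monoid.mult (free_group S) = foldr cancel_cons" "\<one>\<^bsub>free_group S\<^esub> = []"
  by (simp_all add: free_group_def)

lemma free_lift_letter:
  "group H \<Longrightarrow> g s \<in> carrier H \<Longrightarrow> free_lift H g [(s, True)] = g s"
  by (simp add: free_lift_def group.is_monoid monoid.r_one)

text \<open>Cancelling a letter against its inverse does not change the product of the
  values.\<close>

lemma free_lift_hom:
  assumes H: "group H" and g: "\<And>s. s \<in> S \<Longrightarrow> g s \<in> carrier H"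
  shows "free_lift H g \<in> hom (free_group S) H"
proof -
  interpret H: group H by (rule H)
  let ?e = "\<lambda>l. if snd l then g (fst l) else inv\<^bsub>H\<^esub> g (fst l)"
  have step: "free_lift H g (l # w) = ?e l \<otimes>\<^bsub>H\<^esub> free_lift H g w" for l w
    by (simp add: free_lift_def)
  have e: "?e l \<in> carrier H" if "fst l \<in> S" for l using g[OF that] by simp
  have cl: "free_lift H g w \<in> carrier H" if "set w \<subseteq> S \<times> UNIV" for w
    using that
  proof (induction w)
    case Nil then show ?case by (simp add: free_lift_def)
  next
    case (Cons l w)
    then have "fst l \<in> S" "free_lift H g w \<in> carrier H" by auto
    then show ?case using H.m_closed[OF e[of l]] by (simp only: step)
  qed
  have cancel: "free_lift H g (cancel_cons l w) = ?e l \<otimes>\<^bsub>H\<^esub> free_lift H g w"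
    if l: "fst l \<in> S" and w: "set w \<subseteq> S \<times> UNIV" for l w
  proof (cases w)
    case Nil then show ?thesis using step by simp
  next
    case w': (Cons y v)
    show ?thesis
    proof (cases "y = letter_inv l")
      case True
      have v: "free_lift H g v \<in> carrier H" using cl w w' by simp
      have "?e l \<otimes>\<^bsub>H\<^esub> free_lift H g w = ?e l \<otimes>\<^bsub>H\<^esub> (?e y \<otimes>\<^bsub>H\<^esub> free_lift H g v)" using w' step by simp
      also have "\<dots> = (?e l \<otimes>\<^bsub>H\<^esub> ?e y) \<otimes>\<^bsub>H\<^esub> free_lift H g v"
        using e[OF l] g[OF l] v True by (simp add: H.m_assoc letter_inv_def)
      also have "?e l \<otimes>\<^bsub>H\<^esub> ?e y = \<one>\<^bsub>H\<^esub>" using g[OF l] True by (simp add: letter_inv_def)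
      finally show ?thesis using True w' v by simp
    next
      case False then show ?thesis using w' step by simp
    qed
  qed
  have mult: "free_lift H g (foldr cancel_cons u v) = free_lift H g u \<otimes>\<^bsub>H\<^esub> free_lift H g v"
    if u: "set u \<subseteq> S \<times> UNIV" and v: "set v \<subseteq> S \<times> UNIV" for u v
    using u
  proof (induction u)
    case Nil
    have "free_lift H g [] = \<one>\<^bsub>H\<^esub>" by (simp add: free_lift_def)
    then show ?case using cl[OF v] by simp
  next
    case (Cons l u)
    then have l: "fst l \<in> S" and u: "set u \<subseteq> S \<times> UNIV" by auto
    have "set (foldr cancel_cons u v) \<subseteq> S \<times> UNIV" using set_foldr_cancel_cons[of u v] u v by blast
    then have "free_lift H g (foldr cancel_cons (l # u) v) = ?e l \<otimes>\<^bsub>H\<^esub> (free_lift H g u \<otimes>\<^bsub>H\<^esub> free_lift H g v)"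
      using cancel[OF l, of "foldr cancel_cons u v"] Cons.IH[OF u] by simp
    then show ?case
      using e[OF l] cl[OF u] cl[OF v] by (simp add: step H.m_assoc)
  qed
  show ?thesis by (rule homI) (simp_all add: free_group_simps cl mult)
qed

lemma generate_free_group:
  "generate (free_group S) ((\<lambda>s. [(s, True)]) ` S) = carrier (free_group S)" (is "generate ?F ?X = _")
proof
  interpret F: group ?F by (rule group_free_group)
  have X: "?X \<subseteq> carrier ?F" by (auto simp: free_group_simps)
  show "generate ?F ?X \<subseteq> carrier ?F" by (rule F.generate_incl[OF X])
  have gen: "w \<in> generate ?F ?X" if "reduced w" "set w \<subseteq> S \<times> UNIV" for w
    using that
  proof (induction w)
    case Nil
    then show ?case using generate.one[of ?F ?X] by (simp add: free_group_simps)
  next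
    case (Cons l w)
    have w: "w \<in> generate ?F ?X" using Cons.IH Cons.prems reduced_Cons[of l w] by simp
    obtain s b where l: "l = (s, b)" "s \<in> S" using Cons.prems by (cases l) auto
    have pos: "[(s, True)] \<in> generate ?F ?X" using l by (intro generate.incl) simp
    have "inv\<^bsub>?F\<^esub> [(s, True)] = [(s, False)]"
      using l by (intro F.inv_equality) (simp_all add: free_group_simps letter_inv_def)
    then have "[(s, False)] \<in> generate ?F ?X" using generate.inv[of "[(s, True)]" ?X ?F] l by simp
    then have "[l] \<in> generate ?F ?X" using pos l by (cases b) simp_all
    moreover have "[l] \<otimes>\<^bsub>?F\<^esub> w = l # w" using Cons.prems(1) by (cases w) (simp_all add: free_group_simps)
    ultimately show ?case using generate.eng[of "[l]" ?F ?X w] w by simp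
  qed
  show "carrier ?F \<subseteq> generate ?F ?X" using gen by (auto simp: free_group_simps)
qed

definition free_basis :: "('a, 'b) monoid_scheme \<Rightarrow> nat \<Rightarrow> (nat \<Rightarrow> 'a) \<Rightarrow> bool"
  where "free_basis G n x \<longleftrightarrow> group G \<and> (\<forall>i<n. x i \<in> carrier G) \<and>
    (\<exists>\<phi>\<in>iso G (free_group {..<n}). \<forall>i<n. \<phi> (x i) = [(i, True)])"

lemma free_basis_ex:
  assumes "free_of_finite_rank F"
  shows "\<exists>n x. free_basis F n x"
proof -
  obtain n \<phi> where \<phi>: "\<phi> \<in> iso F (free_group {..<n::nat})" and F: "group F"
    using assms by (auto simp: free_of_finite_rank_def is_iso_def)
  let ?x = "\<lambda>i. inv_into (carrier F) \<phi> [(i, True)]"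
  have surj: "\<phi> ` carrier F = carrier (free_group {..<n})" using \<phi> by (simp add: iso_def bij_betw_def)
  have mem: "[(i, True)] \<in> \<phi> ` carrier F" if "i < n" for i
    using that unfolding surj by (simp add: free_group_simps)
  have "free_basis F n ?x"
    unfolding free_basis_def
    using F \<phi> inv_into_into[OF mem] f_inv_into_f[OF mem] by blast
  then show ?thesis by blast
qed

lemma free_basis_hom:
  assumes B: "free_basis G n x" and H: "group H" and g: "\<And>i. i < n \<Longrightarrow> g i \<in> carrier H"
  shows "\<exists>f\<in>hom G H. \<forall>i<n. f (x i) = g i"
proof -
  obtain \<phi> where \<phi>: "\<phi> \<in> iso G (free_group {..<n})" "\<forall>i<n. \<phi> (x i) = [(i, True)]"
    using B by (auto simp: free_basis_def)
  have "free_lift H g \<in> hom (free_group {..<n}) H" by (rule free_lift_hom[OF H]) (simp add: g)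
  then have "free_lift H g \<circ> \<phi> \<in> hom G H" using \<phi>(1) by (intro hom_compose) (simp_all add: iso_def)
  moreover have "(free_lift H g \<circ> \<phi>) (x i) = g i" if "i < n" for i
    using \<phi>(2) that free_lift_letter[of H g i, OF H g[OF that]] by simp
  ultimately show ?thesis by blast
qed

lemma free_basis_generate:
  assumes B: "free_basis G n x"
  shows "generate G (x ` {..<n}) = carrier G"
proof -
  obtain \<phi> where \<phi>: "\<phi> \<in> iso G (free_group {..<n})" "\<forall>i<n. \<phi> (x i) = [(i, True)]"
    using B by (auto simp: free_basis_def)
  have G: "group G" and x: "x ` {..<n} \<subseteq> carrier G" using B by (auto simp: free_basis_def)
  interpret \<phi>: group_hom G "free_group {..<n}" \<phi>
    using \<phi>(1) by (intro group_hom.intro group_hom_axioms.intro G group_free_group) (simp add: iso_def)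
  have "\<phi> ` generate G (x ` {..<n}) = generate (free_group {..<n}) (\<phi> ` x ` {..<n})"
    by (rule \<phi>.generate_img[OF x, symmetric])
  also have "\<phi> ` x ` {..<n} = (\<lambda>s. [(s, True)]) ` {..<n}"
    using \<phi>(2) by (auto simp: image_image)
  also have "generate (free_group {..<n}) \<dots> = carrier (free_group {..<n})" by (rule generate_free_group)
  also have "\<dots> = \<phi> ` carrier G" using \<phi>(1) by (simp add: iso_def bij_betw_def)
  finally have "\<phi> ` generate G (x ` {..<n}) = \<phi> ` carrier G" .
  moreover have "inj_on \<phi> (carrier G)" using \<phi>(1) by (simp add: iso_def bij_betw_def)
  ultimately show ?thesis using \<phi>.G.generate_incl[OF x] by (simp add: inj_on_image_eq_iff)
qed

section \<open>Wreath products with the cyclic group of order \<open>q\<close> acting by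
  shifts\<close>

definition wreath :: "('a, 'b) monoid_scheme \<Rightarrow> nat \<Rightarrow> ((nat \<Rightarrow> 'a) \<times> nat) monoid"
  where "wreath G q = \<lparr>carrier = ({..<q} \<rightarrow>\<^sub>E carrier G) \<times> {..<q},
    monoid.mult = (\<lambda>(f, i) (g, j). (\<lambda>k\<in>{..<q}. f k \<otimes>\<^bsub>G\<^esub> g ((k + i) mod q), (i + j) mod q)),
    one = (\<lambda>k\<in>{..<q}. \<one>\<^bsub>G\<^esub>, 0)\<rparr>"

locale wreath_product = group G for G (structure) + fixes q :: nat assumes q_pos: "0 < q"
begin

abbreviation "W \<equiv> wreath G q"

definition base :: "(nat \<Rightarrow> 'a) \<Rightarrow> (nat \<Rightarrow> 'a) \<times> nat"
  where "base f = (\<lambda>k\<in>{..<q}. f k, 0)"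

definition rot :: "nat \<Rightarrow> (nat \<Rightarrow> 'a) \<times> nat"
  where "rot j = (\<lambda>k\<in>{..<q}. \<one>, j mod q)"

lemma carrier_W: "carrier W = ({..<q} \<rightarrow>\<^sub>E carrier G) \<times> {..<q}"
  by (simp add: wreath_def)

lemma mult_W: "(f, i) \<otimes>\<^bsub>W\<^esub> (g, j) = (\<lambda>k\<in>{..<q}. f k \<otimes> g ((k + i) mod q), (i + j) mod q)"
  by (simp add: wreath_def)

lemma mem_W: "u \<in> carrier W \<Longrightarrow> \<exists>f i. u = (f, i) \<and> i < q \<and> f \<in> extensional {..<q} \<and> (\<forall>k<q. f k \<in> carrier G)"
  by (cases u) (simp add: carrier_W PiE_iff)

lemma W_I: "i < q \<Longrightarrow> (\<And>k. k < q \<Longrightarrow> f k \<in> carrier G) \<Longrightarrow> (\<lambda>k\<in>{..<q}. f k, i) \<in> carrier W"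
  by (simp add: carrier_W)

lemma one_W: "\<one>\<^bsub>W\<^esub> = (\<lambda>k\<in>{..<q}. \<one>, 0)"
  by (simp add: wreath_def)

lemma group_W: "group W"
proof (rule groupI)
  fix u v assume uv: "u \<in> carrier W" "v \<in> carrier W"
  obtain f i where u: "u = (f, i)" "i < q" "\<forall>k<q. f k \<in> carrier G" using mem_W[OF uv(1)] by blast
  obtain g j where v: "v = (g, j)" "j < q" "\<forall>k<q. g k \<in> carrier G" using mem_W[OF uv(2)] by blast
  show "u \<otimes>\<^bsub>W\<^esub> v \<in> carrier W"
    unfolding u(1) v(1) mult_W using u v q_pos by (intro W_I) simp_all
next
  show "\<one>\<^bsub>W\<^esub> \<in> carrier W" using q_pos by (simp add: one_W carrier_W)
next
  fix u v w assume uvw: "u \<in> carrier W" "v \<in> carrier W" "w \<in> carrier W"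
  obtain f i where f: "u = (f, i)" "\<forall>k<q. f k \<in> carrier G" using mem_W[OF uvw(1)] by blast
  obtain g j where g: "v = (g, j)" "\<forall>k<q. g k \<in> carrier G" using mem_W[OF uvw(2)] by blast
  obtain h l where h: "w = (h, l)" "\<forall>k<q. h k \<in> carrier G" using mem_W[OF uvw(3)] by blast
  have "f k \<otimes> g ((k + i) mod q) \<otimes> h ((k + (i + j) mod q) mod q) =
      f k \<otimes> (g ((k + i) mod q) \<otimes> h (((k + i) mod q + j) mod q))" if "k < q" for k
  proof -
    have "(k + (i + j) mod q) mod q = ((k + i) mod q + j) mod q" by (simp add: mod_simps add.assoc)
    moreover have "f k \<in> carrier G" "g ((k + i) mod q) \<in> carrier G" "h (((k + i) mod q + j) mod q) \<in> carrier G"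
      using f g h that q_pos by simp_all
    ultimately show ?thesis by (simp add: m_assoc)
  qed
  moreover have "((i + j) mod q + l) mod q = (i + (j + l) mod q) mod q" by (simp add: mod_simps add.assoc)
  ultimately show "u \<otimes>\<^bsub>W\<^esub> v \<otimes>\<^bsub>W\<^esub> w = u \<otimes>\<^bsub>W\<^esub> (v \<otimes>\<^bsub>W\<^esub> w)"
    using q_pos unfolding f(1) g(1) h(1) mult_W prod.inject by (intro conjI restrict_ext) simp_all
next
  fix u assume uW: "u \<in> carrier W"
  obtain f i where u: "u = (f, i)" "i < q" "f \<in> extensional {..<q}" "\<forall>k<q. f k \<in> carrier G"
    using mem_W[OF uW] by blast
  have "(\<lambda>k\<in>{..<q}. (\<lambda>k\<in>{..<q}. \<one>) k \<otimes> f ((k + 0) mod q)) = f"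
    by (rule extensionalityI[of _ "{..<q}"]) (use u in simp_all)
  then show "\<one>\<^bsub>W\<^esub> \<otimes>\<^bsub>W\<^esub> u = u" using u(2) unfolding u(1) one_W mult_W by simp
  let ?j = "(q - i) mod q"
  let ?v = "(\<lambda>k\<in>{..<q}. inv (f ((k + ?j) mod q)), ?j)"
  have "?v \<in> carrier W" using u q_pos by (intro W_I) simp_all
  moreover have "(?j + i) mod q = 0" using u(2) by (simp add: mod_simps)
  then have "?v \<otimes>\<^bsub>W\<^esub> u = \<one>\<^bsub>W\<^esub>"
    unfolding u(1) mult_W one_W prod.inject using u q_pos by (intro conjI restrict_ext) simp_all
  ultimately show "\<exists>v\<in>carrier W. v \<otimes>\<^bsub>W\<^esub> u = \<one>\<^bsub>W\<^esub>" by blast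
qed

sublocale W: group W by (rule group_W)

lemma base_closed: "(\<And>k. f k \<in> carrier G) \<Longrightarrow> base f \<in> carrier W"
  using q_pos by (simp add: base_def carrier_W)

lemma rot_closed: "rot j \<in> carrier W"
  using q_pos by (simp add: rot_def carrier_W)

lemma base_cong: "(\<And>k. k < q \<Longrightarrow> f k = g k) \<Longrightarrow> base f = base g"
  by (auto simp: base_def intro!: restrict_ext)

lemma base_one: "base (\<lambda>k. \<one>) = \<one>\<^bsub>W\<^esub>"
  by (simp add: base_def one_W)

lemma base_mult: "base f \<otimes>\<^bsub>W\<^esub> base g = base (\<lambda>k. f k \<otimes> g k)"
  using q_pos by (auto simp: base_def mult_W intro!: restrict_ext)

lemma base_inv:
  assumes "\<And>k. f k \<in> carrier G"
  shows "inv\<^bsub>W\<^esub> base f = base (\<lambda>k. inv (f k))"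
proof (rule W.inv_equality)
  show "base (\<lambda>k. inv (f k)) \<otimes>\<^bsub>W\<^esub> base f = \<one>\<^bsub>W\<^esub>"
    unfolding base_mult base_one[symmetric] by (rule base_cong) (simp add: assms)
qed (simp_all add: assms base_closed)

lemma base_pow:
  assumes "\<And>k. f k \<in> carrier G"
  shows "base f [^]\<^bsub>W\<^esub> (j::nat) = base (\<lambda>k. f k [^] j)"
  by (induction j) (simp_all add: base_one base_mult)

lemma rot_mult: "rot i \<otimes>\<^bsub>W\<^esub> rot j = rot (i + j)"
  using q_pos by (auto simp: rot_def mult_W mod_simps intro!: restrict_ext)

lemma rot_pow: "rot 1 [^]\<^bsub>W\<^esub> (j::nat) = rot j"
proof (induction j)
  case 0 then show ?case by (simp add: rot_def one_W)
next
  case (Suc j) then show ?case by (simp add: rot_mult)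
qed

lemma rot_conj:
  assumes f: "\<And>k. f k \<in> carrier G"
  shows "rot j \<otimes>\<^bsub>W\<^esub> base f \<otimes>\<^bsub>W\<^esub> inv\<^bsub>W\<^esub> rot j = base (\<lambda>k. f ((k + j) mod q))"
proof -
  have "rot j \<otimes>\<^bsub>W\<^esub> base f = base (\<lambda>k. f ((k + j) mod q)) \<otimes>\<^bsub>W\<^esub> rot j"
    using q_pos f unfolding rot_def base_def mult_W prod.inject
    by (intro conjI restrict_ext) (simp_all add: mod_simps)
  moreover have "base (\<lambda>k. f ((k + j) mod q)) \<in> carrier W" using f q_pos by (intro base_closed) simp
  ultimately show ?thesis using rot_closed base_closed[OF f] by (simp add: W.m_assoc)
qed

text \<open>Conjugation by \<open>C\<close> shifts the positions and conjugates the values, so it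
  carries positions with nontrivial value to such positions.\<close>

lemma card_support_conj:
  assumes C: "C \<in> carrier W" and f: "\<And>k. f k \<in> carrier G" and g: "\<And>k. g k \<in> carrier G"
    and eq: "base f \<otimes>\<^bsub>W\<^esub> C = C \<otimes>\<^bsub>W\<^esub> base g"
  shows "card {k. k < q \<and> f k \<noteq> \<one>} = card {k. k < q \<and> g k \<noteq> \<one>}"
proof -
  obtain h i where h: "C = (h, i)" "\<And>k. k < q \<Longrightarrow> h k \<in> carrier G" "i < q" using C by (auto simp: carrier_W)
  have eq': "(\<lambda>k\<in>{..<q}. f k \<otimes> h k) = (\<lambda>k\<in>{..<q}. h k \<otimes> g ((k + i) mod q))"
    using eq q_pos unfolding h(1) base_def mult_W prod.inject by (simp cong: restrict_cong)
  have coord: "f k \<otimes> h k = h k \<otimes> g ((k + i) mod q)" if "k < q" for k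
    using that fun_cong[OF eq', of k] by simp
  have iff: "f k = \<one> \<longleftrightarrow> g ((k + i) mod q) = \<one>" if k: "k < q" for k
  proof -
    have cl: "f k \<in> carrier G" "h k \<in> carrier G" "g ((k + i) mod q) \<in> carrier G"
      using f g h k q_pos by simp_all
    then have "f k = \<one> \<longleftrightarrow> f k \<otimes> h k = h k" "g ((k + i) mod q) = \<one> \<longleftrightarrow> h k \<otimes> g ((k + i) mod q) = h k"
      by simp_all
    then show ?thesis using coord[OF k] by simp
  qed
  let ?s = "\<lambda>k. (k + i) mod q"
  have inj: "inj_on ?s {..<q}"
    using h(3) by (intro inj_onI) (auto simp: mod_if split: if_splits)
  have "?s ` {..<q} \<subseteq> {..<q}" using q_pos by auto
  then have surj: "?s ` {..<q} = {..<q}" using inj by (simp add: endo_inj_surj)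
  have "?s ` {k. k < q \<and> f k \<noteq> \<one>} = {k. k < q \<and> g k \<noteq> \<one>}"
  proof (intro equalityI subsetI)
    fix k assume "k \<in> {k. k < q \<and> g k \<noteq> \<one>}"
    then have k: "k < q" "g k \<noteq> \<one>" by simp_all
    have "k \<in> ?s ` {..<q}" unfolding surj using k(1) by simp
    then obtain k' where k': "k' < q" "k = ?s k'" by blast
    have "f k' \<noteq> \<one>" using k(2)[unfolded k'(2)] iff[OF k'(1)] by simp
    then show "k \<in> ?s ` {k. k < q \<and> f k \<noteq> \<one>}" using k' by (intro image_eqI[of _ _ k']) simp_all
  next
    fix k assume "k \<in> ?s ` {k. k < q \<and> f k \<noteq> \<one>}"
    then obtain k' where k': "k' < q" "f k' \<noteq> \<one>" "k = ?s k'" by blast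
    then show "k \<in> {k. k < q \<and> g k \<noteq> \<one>}" using iff[OF k'(1)] q_pos by simp
  qed
  moreover have "inj_on ?s {k. k < q \<and> f k \<noteq> \<one>}" by (rule inj_on_subset[OF inj]) auto
  then have "card (?s ` {k. k < q \<and> f k \<noteq> \<one>}) = card {k. k < q \<and> f k \<noteq> \<one>}" by (rule card_image)
  ultimately show ?thesis by simp
qed

end

lemma finite_p_group_wreath:
  fixes m :: nat
  assumes "Factorial_Ring.prime p" "finite_p_group p Q"
  shows "finite_p_group p (wreath Q (p ^ m))"
proof -
  have q: "0 < p ^ m" using assms(1) prime_gt_0_nat by simp
  interpret wreath_product Q "p ^ m"
    using assms q by (intro wreath_product.intro wreath_product_axioms.intro) (simp_all add: finite_p_group_def)
  obtain k where k: "card (carrier Q) = p ^ k" "finite (carrier Q)" using assms by (auto simp: finite_p_group_def)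
  have "card (carrier W) = p ^ (k * p ^ m + m)"
    using k by (simp add: carrier_W card_cartesian_product card_PiE power_mult power_add)
  moreover have "finite (carrier W)" using k by (auto simp: carrier_W intro!: finite_PiE)
  ultimately show ?thesis using group_W by (auto simp: finite_p_group_def)
qed

section \<open>The free subgroup\<close>

text \<open>The commutator of a power of \<open>a\<close> with \<open>b\<close>. The exponent starts
  at 1 because exponent 0 would give the identity for \<open>j = 0\<close>.\<close>

definition conj_pow_comm :: "('h, 'k) monoid_scheme \<Rightarrow> nat \<Rightarrow> 'h \<Rightarrow> 'h \<Rightarrow> 'h"
  where "conj_pow_comm H j a b =
    a [^]\<^bsub>H\<^esub> Suc j \<otimes>\<^bsub>H\<^esub> b \<otimes>\<^bsub>H\<^esub> inv\<^bsub>H\<^esub> (a [^]\<^bsub>H\<^esub> Suc j) \<otimes>\<^bsub>H\<^esub> inv\<^bsub>H\<^esub> b"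

text \<open>
  In the wreath product, with \<open>u\<close> the cyclic shift and \<open>v\<close> in the base group, the conjugates below are
  the shifts of \<open>v\<close> by one and by three places.
\<close>

definition shifted_comm :: "('h, 'k) monoid_scheme \<Rightarrow> nat \<Rightarrow> 'h \<Rightarrow> 'h \<Rightarrow> 'h"
  where "shifted_comm H j u v = conj_pow_comm H j
    (u \<otimes>\<^bsub>H\<^esub> v \<otimes>\<^bsub>H\<^esub> inv\<^bsub>H\<^esub> u)
    (u [^]\<^bsub>H\<^esub> (3::nat) \<otimes>\<^bsub>H\<^esub> v \<otimes>\<^bsub>H\<^esub> inv\<^bsub>H\<^esub> (u [^]\<^bsub>H\<^esub> (3::nat)))"

context group
begin

lemma conj_pow_comm_closed [simp]:
  "a \<in> carrier G \<Longrightarrow> b \<in> carrier G \<Longrightarrow> conj_pow_comm G j a b \<in> carrier G"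
  by (simp add: conj_pow_comm_def)

lemma conj_pow_comm_one_left: "b \<in> carrier G \<Longrightarrow> conj_pow_comm G j \<one> b = \<one>"
  using nat_pow_one[of "Suc j"] by (simp add: conj_pow_comm_def del: nat_pow_Suc)

lemma conj_pow_comm_one_right: "a \<in> carrier G \<Longrightarrow> conj_pow_comm G j a \<one> = \<one>"
  by (simp add: conj_pow_comm_def del: nat_pow_Suc)

lemma conj_pow_comm_derived:
  assumes "a \<in> carrier G" "b \<in> carrier G"
  shows "conj_pow_comm G j a b \<in> derived G (carrier G)"
  unfolding derived_def conj_pow_comm_def
  by (rule generate.incl) (use assms nat_pow_closed[OF assms(1), of "Suc j"] in blast)

lemma shifted_comm_closed [simp]:
  "a \<in> carrier G \<Longrightarrow> b \<in> carrier G \<Longrightarrow> shifted_comm G j a b \<in> carrier G"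
  by (simp add: shifted_comm_def)

lemma shifted_comm_derived:
  "a \<in> carrier G \<Longrightarrow> b \<in> carrier G \<Longrightarrow> shifted_comm G j a b \<in> derived G (carrier G)"
  by (simp add: shifted_comm_def conj_pow_comm_derived)

end

lemma (in group_hom) hom_conj_pow_comm:
  assumes "a \<in> carrier G" "b \<in> carrier G"
  shows "h (conj_pow_comm G j a b) = conj_pow_comm H j (h a) (h b)"
proof -
  have "a [^] Suc j \<in> carrier G" "h (a [^] Suc j) = h a [^]\<^bsub>H\<^esub> Suc j"
    using assms hom_nat_pow[of a "Suc j"] G.nat_pow_closed[of a "Suc j"] by blast+
  then show ?thesis using assms by (simp add: conj_pow_comm_def del: nat_pow_Suc)
qed

lemma (in group_hom) hom_shifted_comm:
  assumes "u \<in> carrier G" "v \<in> carrier G"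
  shows "h (shifted_comm G j u v) = shifted_comm H j (h u) (h v)"
  using assms hom_nat_pow[of u 3] by (simp add: shifted_comm_def hom_conj_pow_comm)

context wreath_product
begin

lemma base_conj_pow_comm:
  assumes f: "\<And>k. f k \<in> carrier G" and g: "\<And>k. g k \<in> carrier G"
  shows "conj_pow_comm W j (base f) (base g) = base (\<lambda>k. conj_pow_comm G j (f k) (g k))"
proof -
  have fj: "\<And>k. f k [^] Suc j \<in> carrier G" using f by (rule nat_pow_closed)
  show ?thesis
    unfolding conj_pow_comm_def base_pow[OF f] base_inv[OF fj] base_inv[OF g] base_mult ..
qed

lemma shifted_comm_rot_base:
  assumes f: "\<And>k. f k \<in> carrier G"
  shows "shifted_comm W j (rot 1) (base f) =
    base (\<lambda>k. conj_pow_comm G j (f ((k + 1) mod q)) (f ((k + 3) mod q)))"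
  unfolding shifted_comm_def rot_pow rot_conj[OF f] using f q_pos
  by (intro base_conj_pow_comm) simp_all

text \<open>At position 0 and for \<open>Suc j < q\<close> the value is
  \<open>f (Suc j) \<otimes> inv (f 0)\<close>. Different exponents read different positions of
  \<open>f\<close>, so powers of the one shift suffice to prescribe these values
  independently.\<close>

lemma conj_pow_comm_rot_base:
  assumes f: "\<And>k. f k \<in> carrier G"
  shows "conj_pow_comm W j (rot 1) (base f) = base (\<lambda>k. f ((k + Suc j) mod q) \<otimes> inv (f k))"
  unfolding conj_pow_comm_def rot_pow rot_conj[OF f] base_inv[OF f] base_mult by simp

definition pattern :: "'a \<Rightarrow> 'a \<Rightarrow> 'a \<Rightarrow> nat \<Rightarrow> 'a"
  where "pattern a b c k = (if k = 0 then a else if k = 1 then b else if k = 3 then c else \<one>)"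

text \<open>
  The shifts of the set \<open>{0, 1, 3}\<close> by one and by three places modulo \<open>q \<ge> 6\<close> meet only in \<open>0\<close>, so
  that the commutator is supported at \<open>0\<close>.
\<close>

lemma pattern_mult_shifted_comm:
  assumes q: "6 \<le> q" and abc: "a \<in> carrier G" "b \<in> carrier G" "c \<in> carrier G"
  shows "base (pattern a b c) \<otimes>\<^bsub>W\<^esub> shifted_comm W j (rot 1) (base (pattern a b c)) =
    base (pattern (a \<otimes> conj_pow_comm G j b c) b c)"
proof -
  let ?f = "pattern a b c"
  have f: "\<And>k. ?f k \<in> carrier G" using abc by (simp add: pattern_def)
  have "?f k \<otimes> conj_pow_comm G j (?f ((k + 1) mod q)) (?f ((k + 3) mod q)) =
      pattern (a \<otimes> conj_pow_comm G j b c) b c k" if k: "k < q" for k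
  proof (cases "k = 0")
    case True then show ?thesis using q by (simp add: pattern_def)
  next
    case False
    have "?f ((k + 1) mod q) = \<one> \<or> ?f ((k + 3) mod q) = \<one>"
    proof -
      \<comment> \<open>The case \<open>k = 2\<close> is where \<open>6 \<le> q\<close> enters:
        \<open>k + 1\<close> hits position 3, so \<open>k + 3 = 5\<close> has to miss the pattern,
        while for \<open>q = 5\<close> it would wrap around to 0.\<close>
      consider "k = 1" | "k = 2" | "3 \<le> k" "k < q - 1" | "k = q - 1" using False k by linarith
      then show ?thesis
      proof cases
        case 4
        then have "(k + 3) mod q = 2" using q by (simp add: mod_if)
        then show ?thesis by (simp add: pattern_def)
      qed (use q in \<open>simp_all add: pattern_def\<close>)
    qed
    then have "conj_pow_comm G j (?f ((k + 1) mod q)) (?f ((k + 3) mod q)) = \<one>"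
      using conj_pow_comm_one_left conj_pow_comm_one_right f by metis
    moreover have "pattern (a \<otimes> conj_pow_comm G j b c) b c k = ?f k"
      using False by (simp add: pattern_def)
    ultimately show ?thesis using r_one[OF f[of k]] by simp
  qed
  then show ?thesis unfolding shifted_comm_rot_base[OF f] base_mult by (rule base_cong)
qed

lemma pattern_conj_imp_one:
  assumes q: "6 \<le> q" and abc: "a \<in> carrier G" "b \<in> carrier G" "c \<in> carrier G"
    and C: "C \<in> carrier W" and eq: "base (pattern a b c) \<otimes>\<^bsub>W\<^esub> C = C \<otimes>\<^bsub>W\<^esub> base (pattern \<one> b c)"
  shows "a = \<one>"
proof (rule ccontr)
  assume a: "a \<noteq> \<one>"
  let ?S = "{k. k < q \<and> pattern \<one> b c k \<noteq> \<one>}"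
  have "{k. k < q \<and> pattern a b c k \<noteq> \<one>} = insert 0 ?S" using a q by (auto simp: pattern_def)
  moreover have "0 \<notin> ?S" by (simp add: pattern_def)
  moreover have "card {k. k < q \<and> pattern a b c k \<noteq> \<one>} = card ?S"
    using abc by (intro card_support_conj[OF C _ _ eq]) (simp_all add: pattern_def)
  ultimately show False by simp
qed

end

context fg_pro_p_group
begin

text \<open>By density, an identity between homomorphisms on \<open>G\<close> persists on the
  completion; one representative is taken for the kernels of \<open>f\<close> and \<open>f'\<close>
  together.\<close>

lemma hat_ind:
  assumes H: "finite_p_group p H" and f: "f \<in> hom G H" "f' \<in> hom G H" and \<alpha>: "\<alpha> \<in> hom G G"
    and eq: "\<And>a. a \<in> carrier G \<Longrightarrow> f (\<alpha> a) = f' a" and z: "z \<in> carrier P"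
  shows "hat H f (ind \<alpha> z) = hat H f' z"
proof -
  let ?N = "kernel G H f" and ?N' = "kernel G H f'"
  have gH: "group H" using H by (simp add: finite_p_group_def)
  have K: "?N \<in> K" "?N' \<in> K" using kernel_in_K[OF H] f by simp_all
  then have "finite {?N, ?N'}" "{?N, ?N'} \<subseteq> K" by simp_all
  then obtain a where "a \<in> carrier G" "\<forall>N\<in>{?N, ?N'}. z N = N #> a \<and> ind \<alpha> z N = N #> \<alpha> a"
    using ind_approx[OF \<alpha> z, of "{?N, ?N'}"] by metis
  then have a: "a \<in> carrier G" "z ?N' = ?N' #> a" "ind \<alpha> z ?N = ?N #> \<alpha> a" by simp_all
  have \<alpha>a: "\<alpha> a \<in> carrier G" using \<alpha> a(1) by (rule hom_in_carrier)
  have "hat H f (ind \<alpha> z) = f (\<alpha> a)" by (rule hat_eq[of H f "\<alpha> a" "ind \<alpha> z", OF gH f(1) \<alpha>a a(3)])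
  also have "\<dots> = hat H f' z" using hat_eq[of H f' a z, OF gH f(2) a(1,2)] eq[OF a(1)] by simp
  finally show ?thesis .
qed

text \<open>\<alpha> and the identity induce two homomorphisms from \<open>G\<close> to its
  abelianization, and these coincide once they agree on generators. Normality of the derived
  subgroup translates between left and right displacements.\<close>

lemma ia_endoI:
  assumes \<alpha>: "\<alpha> \<in> hom G G" and S: "S \<subseteq> carrier G" "generate G S = carrier G"
    and gen: "\<And>s. s \<in> S \<Longrightarrow> inv s \<otimes> \<alpha> s \<in> derived G (carrier G)"
  shows "ia_endo \<alpha>"
proof -
  let ?D = "derived G (carrier G)"
  have "carrier G \<lhd> G" by (simp add: normal_inv_iff subgroup_self)
  then interpret D: normal ?D G by (rule derived_is_normal)
  have D: "subgroup ?D G" by (rule D.subgroup_axioms)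
  have \<alpha>cl: "\<And>a. a \<in> carrier G \<Longrightarrow> \<alpha> a \<in> carrier G" using \<alpha> by (rule hom_in_carrier)
  have iff: "?D #> \<alpha> a = ?D #> a \<longleftrightarrow> inv a \<otimes> \<alpha> a \<in> ?D" if a: "a \<in> carrier G" for a
  proof -
    have "inv a \<otimes> \<alpha> a \<in> ?D \<longleftrightarrow> \<alpha> a \<otimes> inv a \<in> ?D"
    proof
      assume "inv a \<otimes> \<alpha> a \<in> ?D"
      then have "a \<otimes> (inv a \<otimes> \<alpha> a) \<otimes> inv a \<in> ?D" using D.inv_op_closed2 a by blast
      then show "\<alpha> a \<otimes> inv a \<in> ?D" using a \<alpha>cl[OF a] by (simp add: m_assoc[symmetric])
    next
      assume "\<alpha> a \<otimes> inv a \<in> ?D"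
      then have "inv a \<otimes> (\<alpha> a \<otimes> inv a) \<otimes> a \<in> ?D" using D.inv_op_closed1 a by blast
      then show "inv a \<otimes> \<alpha> a \<in> ?D" using a \<alpha>cl[OF a] by (simp add: m_assoc)
    qed
    then show ?thesis using rcos_eq_iff[OF D \<alpha>cl[OF a] a] by simp
  qed
  have "?D #> \<alpha> a = ?D #> a" if a: "a \<in> carrier G" for a
  proof (rule hom_eq_on_generate[of G "G Mod ?D" "\<lambda>a. ?D #> \<alpha> a" "\<lambda>a. ?D #> a" S a])
    show "(\<lambda>a. ?D #> \<alpha> a) \<in> hom G (G Mod ?D)"
      using Group.hom_compose[OF \<alpha> D.r_coset_hom_Mod] by (simp add: comp_def)
    show "?D #> \<alpha> s = ?D #> s" if "s \<in> S" for s using iff gen that S by blast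
  qed (use S a D.factorgroup_is_group D.r_coset_hom_Mod is_group in simp_all)
  then show ?thesis using iff \<alpha> by (simp add: ia_endo_def)
qed

end

section \<open>The free action and its detection in wreath products\<close>

locale free_construction = fg_pro_p_group G p for G :: "('a, 'b) monoid_scheme" (structure) and p +
  fixes n :: nat and x :: "nat \<Rightarrow> 'a" and r :: nat
  assumes basis: "free_basis G n x" and n: "2 \<le> n"
begin

lemma x_closed: "i < n \<Longrightarrow> x i \<in> carrier G"
  using basis by (simp add: free_basis_def)

lemma x_subset: "x ` {..<n} \<subseteq> carrier G"
  using x_closed by auto

lemma hom_eqI:
  assumes "group H" "f \<in> hom G H" "g \<in> hom G H" "\<And>i. i < n \<Longrightarrow> f (x i) = g (x i)" "a \<in> carrier G"
  shows "f a = g a"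
  using hom_eq_on_generate[OF is_group assms(1-3) x_subset, of a] assms(4,5) free_basis_generate[OF basis]
  by auto

definition \<alpha> :: "nat \<Rightarrow> 'a \<Rightarrow> 'a"
  where "\<alpha> j = (SOME f. f \<in> hom G G \<and>
    (\<forall>i<n. f (x i) = (if i = 1 then x 1 \<otimes> shifted_comm G j (x 0) (x 1) else x i)))"

lemma \<alpha>_hom: "\<alpha> j \<in> hom G G"
  and \<alpha>_x: "i < n \<Longrightarrow> \<alpha> j (x i) = (if i = 1 then x 1 \<otimes> shifted_comm G j (x 0) (x 1) else x i)"
proof -
  have "\<exists>f\<in>hom G G. \<forall>i<n. f (x i) = (if i = 1 then x 1 \<otimes> shifted_comm G j (x 0) (x 1) else x i)"
    using n x_closed by (intro free_basis_hom[OF basis is_group]) auto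
  then have ex: "\<exists>f. f \<in> hom G G \<and>
      (\<forall>i<n. f (x i) = (if i = 1 then x 1 \<otimes> shifted_comm G j (x 0) (x 1) else x i))" by blast
  show "\<alpha> j \<in> hom G G" using someI_ex[OF ex] by (simp add: \<alpha>_def)
  show "\<alpha> j (x i) = (if i = 1 then x 1 \<otimes> shifted_comm G j (x 0) (x 1) else x i)" if "i < n"
    using someI_ex[OF ex] that by (simp add: \<alpha>_def)
qed

lemma ia_\<alpha>: "ia_endo (\<alpha> j)"
proof (rule ia_endoI[OF \<alpha>_hom x_subset free_basis_generate[OF basis]])
  interpret D: subgroup "derived G (carrier G)" G by (rule derived_is_subgroup) simp
  fix s assume "s \<in> x ` {..<n}"
  then obtain i where i: "i < n" "s = x i" by auto
  have x01: "x 0 \<in> carrier G" "x 1 \<in> carrier G" using n x_closed by simp_all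
  show "inv s \<otimes> \<alpha> j s \<in> derived G (carrier G)"
  proof (cases "i = 1")
    case True
    have "inv s \<otimes> \<alpha> j s = shifted_comm G j (x 0) (x 1)"
      using i True \<alpha>_x[OF i(1), of j] x01 by (simp add: m_assoc[symmetric])
    then show ?thesis using shifted_comm_derived[OF x01] by simp
  next
    case False then show ?thesis using i \<alpha>_x[OF i(1), of j] x_closed[OF i(1)] by simp
  qed
qed

abbreviation "R \<equiv> free_group {..<r}"

definition \<rho> :: "(nat \<times> bool) list \<Rightarrow> ('a set \<Rightarrow> 'a set) \<Rightarrow> 'a set \<Rightarrow> 'a set"
  where "\<rho> = free_lift \<A> (\<lambda>j. ind (\<alpha> j))"

lemma ind_\<alpha>_closed: "ind (\<alpha> j) \<in> carrier \<A>"
  using ind_cont_auto[OF ia_\<alpha>] by (simp add: carrier_\<A>)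

lemma \<rho>_hom: "\<rho> \<in> hom R \<A>"
  unfolding \<rho>_def by (rule free_lift_hom[OF group_\<A> ind_\<alpha>_closed])

lemma \<rho>_letter: "\<rho> [(j, True)] = ind (\<alpha> j)"
  unfolding \<rho>_def by (rule free_lift_letter[of \<A> "\<lambda>j. ind (\<alpha> j)", OF group_\<A> ind_\<alpha>_closed])

lemma letters_subset: "(\<lambda>j. [(j, True)]) ` {..<r} \<subseteq> carrier R"
  by (auto simp: free_group_simps)

sublocale A: discrete_action G p R \<rho>
proof (intro discrete_action.intro discrete_action_axioms.intro)
  show "fg_pro_p_group G p" by (rule fg_pro_p_group_axioms)
  show "pro_p_group R p"
    by (intro pro_p_group.intro pro_p_group_axioms.intro group_free_group prime_p)
  show "\<rho> \<in> hom R \<A>" by (rule \<rho>_hom)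
  fix N assume N: "N \<in> K"
  show "{w \<in> carrier R. \<forall>z\<in>carrier P. \<rho> w z (core N) = z (core N)} \<in> p_quotient_kernels p R"
    by (rule trivial_in_K_if_ia[OF group_free_group letters_subset generate_free_group \<rho>_hom _ N])
      (use ia_\<alpha> \<rho>_letter in auto)
qed

text \<open>\<open>\<Psi> a\<close> sends \<open>x 0\<close> to the shift, \<open>x 1\<close> to the
  pattern and the other basis elements to the identity. Composing with \<open>\<alpha> j\<close>
  alters only the image of \<open>x 1\<close>, and there only the entry \<open>a\<close>, so it
  amounts to a right multiplication of the parameter.\<close>

lemma wreath_homs:
  assumes Q: "finite_p_group p Q" and q: "6 \<le> p ^ m" and b: "b \<in> carrier Q" and c: "c \<in> carrier Q"
  obtains \<Psi> where "\<And>a. a \<in> carrier Q \<Longrightarrow> \<Psi> a \<in> hom G (wreath Q (p ^ m))"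
    "\<And>a. a \<in> carrier Q \<Longrightarrow> \<Psi> a (x 1) = wreath_product.base (p ^ m) (wreath_product.pattern Q a b c)"
    "\<And>a j y. a \<in> carrier Q \<Longrightarrow> y \<in> carrier G \<Longrightarrow> \<Psi> a (\<alpha> j y) = \<Psi> (a \<otimes>\<^bsub>Q\<^esub> conj_pow_comm Q j b c) y"
proof -
  have gQ: "group Q" using Q by (simp add: finite_p_group_def)
  interpret W: wreath_product Q "p ^ m"
    using q by (intro wreath_product.intro wreath_product_axioms.intro gQ) linarith
  let ?t = "\<lambda>a i. if i = 0 then W.rot 1 else if i = 1 then W.base (W.pattern a b c) else \<one>\<^bsub>W.W\<^esub>"
  have bc: "W.base (W.pattern a b c) \<in> carrier W.W" if "a \<in> carrier Q" for a
    using that b c by (intro W.base_closed) (simp add: W.pattern_def)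
  define \<Psi> where "\<Psi> a = (SOME f. f \<in> hom G W.W \<and> (\<forall>i<n. f (x i) = ?t a i))" for a
  have ex: "\<exists>f. f \<in> hom G W.W \<and> (\<forall>i<n. f (x i) = ?t a i)" if a: "a \<in> carrier Q" for a
  proof -
    have "\<exists>f\<in>hom G W.W. \<forall>i<n. f (x i) = ?t a i"
      using bc[OF a] W.rot_closed by (intro free_basis_hom[OF basis W.group_W]) simp
    then show ?thesis by blast
  qed
  have hom: "\<Psi> a \<in> hom G W.W" and val: "\<And>i. i < n \<Longrightarrow> \<Psi> a (x i) = ?t a i" if a: "a \<in> carrier Q" for a
    using someI_ex[OF ex[OF a]] by (simp_all add: \<Psi>_def)
  have x01: "x 0 \<in> carrier G" "x 1 \<in> carrier G" using n x_closed by simp_all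
  show ?thesis
  proof (rule that)
    fix a assume a: "a \<in> carrier Q"
    show "\<Psi> a \<in> hom G W.W" by (rule hom[OF a])
    show "\<Psi> a (x 1) = W.base (W.pattern a b c)" using val[OF a, of 1] n by simp
    fix j y assume y: "y \<in> carrier G"
    let ?a' = "a \<otimes>\<^bsub>Q\<^esub> conj_pow_comm Q j b c"
    have a': "?a' \<in> carrier Q" using a b c by simp
    interpret \<Psi>: group_hom G W.W "\<Psi> a"
      by (intro group_hom.intro group_hom_axioms.intro is_group W.group_W hom a)
    have comp: "(\<lambda>y. \<Psi> a (\<alpha> j y)) \<in> hom G W.W"
      using Group.hom_compose[OF \<alpha>_hom hom[OF a]] by (simp add: comp_def)
    show "\<Psi> a (\<alpha> j y) = \<Psi> ?a' y"
    proof (rule hom_eqI[OF W.group_W comp hom[OF a'] _ y])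
      fix i assume i: "i < n"
      show "\<Psi> a (\<alpha> j (x i)) = \<Psi> ?a' (x i)"
      proof (cases "i = 1")
        case True
        have "\<Psi> a (\<alpha> j (x 1)) = \<Psi> a (x 1) \<otimes>\<^bsub>W.W\<^esub> shifted_comm W.W j (\<Psi> a (x 0)) (\<Psi> a (x 1))"
          using \<alpha>_x[of 1 j] n x01 \<Psi>.hom_shifted_comm[OF x01] by simp
        also have "\<dots> = W.base (W.pattern ?a' b c)"
          using val[OF a, of 0] val[OF a, of 1] n W.pattern_mult_shifted_comm[OF q a b c] by simp
        finally show ?thesis using True val[OF a', of 1] n by simp
      next
        case False
        then show ?thesis using \<alpha>_x[OF i, of j] val[OF a i] val[OF a' i] by simp
      qed
    qed
  qed
qed

lemma detect:
  assumes L: "L \<in> A.E.K"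
  shows "\<exists>N\<in>K. \<forall>w\<in>carrier R. \<forall>c\<in>carrier P. (\<forall>z\<in>carrier P. \<rho> w z N = inner c z N) \<longrightarrow> w \<in> L"
proof -
  \<comment> \<open>As \<open>p ^ m\<close> exceeds \<open>m\<close>, this gives room for the
    pattern on \<open>{0, 1, 3}\<close> and for \<open>r\<close> positions other than 0.\<close>
  define m where "m = r + 6"
  have "1 < p" using prime_p prime_gt_1_nat by blast
  then have p0: "0 < p" and "m < p ^ m" using power_gt_expt[of p m] by simp_all
  then have q: "6 \<le> p ^ m" "r < p ^ m" by (simp_all add: m_def)
  let ?U = "R Mod L"
  have Q0: "finite_p_group p ?U" using L by (simp add: A.E.K_iff)
  have gQ0: "group ?U" by (rule A.E.K_group[OF L])
  interpret V: wreath_product ?U "p ^ m"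
    using p0 by (intro wreath_product.intro wreath_product_axioms.intro gQ0) simp
  let ?Q = "V.W"
  have Q: "finite_p_group p ?Q" by (rule finite_p_group_wreath[OF prime_p Q0])
  \<comment> \<open>Position \<open>j + 1\<close> carries the image of the generator
    \<open>j\<close>, and position 0 is trivial. Hence the commutator with the shift to the power
    \<open>j + 1\<close> has the image of this generator as its value at 0.\<close>
  define h where "h k = (if k = 0 \<or> r < k then \<one>\<^bsub>?U\<^esub> else L #>\<^bsub>R\<^esub> [(k - 1, True)])" for k
  have letter: "L #>\<^bsub>R\<^esub> [(j, True)] \<in> carrier ?U" if "j < r" for j
    using that letters_subset by (auto simp: carrier_FactGroup)
  have h: "h k \<in> carrier ?U" for k
    using letter[of "k - 1"] by (auto simp: h_def simp del: one_FactGroup)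
  let ?b = "V.rot 1" and ?c = "V.base h"
  have b: "?b \<in> carrier ?Q" and c: "?c \<in> carrier ?Q" using V.rot_closed V.base_closed h by simp_all
  let ?u = "\<lambda>j. conj_pow_comm ?Q j ?b ?c"
  define \<mu> where "\<mu> = free_lift ?Q ?u"
  have u: "?u j \<in> carrier ?Q" for j using b c by simp
  have \<mu>: "\<mu> \<in> hom R ?Q" unfolding \<mu>_def by (rule free_lift_hom[OF V.group_W u])
  interpret \<mu>: group_hom R ?Q \<mu>
    by (intro group_hom.intro group_hom_axioms.intro group_free_group V.group_W \<mu>)
  have \<mu>_letter: "\<mu> [(j, True)] = ?u j" for j
    unfolding \<mu>_def by (rule free_lift_letter[of ?Q ?u, OF V.group_W u])
  \<comment> \<open>Elements with shift component 0 multiply pointwise, so evaluation at 0 respects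
    products. The words for which the claim holds thus form a subgroup, and it contains the
    letters.\<close>
  have coord0: "\<exists>f. \<mu> w = (f, 0) \<and> f 0 = L #>\<^bsub>R\<^esub> w" if w: "w \<in> carrier R" for w
  proof -
    let ?B = "{w \<in> carrier R. \<exists>f. \<mu> w = (f, 0) \<and> f 0 = L #>\<^bsub>R\<^esub> w}"
    have LR: "L \<subseteq> carrier R" by (rule subgroup.subset[OF A.E.K_subgroup[OF L]])
    have "subgroup ?B R"
    proof (rule A.E.subgroupI)
      have "\<one>\<^bsub>R\<^esub> \<in> ?B" using p0 A.E.coset_mult_one[OF LR] by (simp add: V.one_W)
      then show "?B \<noteq> {}" by blast
    next
      fix v assume v: "v \<in> ?B"
      then obtain f where f: "v \<in> carrier R" "\<mu> v = (f, 0)" "f 0 = L #>\<^bsub>R\<^esub> v" by blast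
      obtain g i where g: "\<mu> (inv\<^bsub>R\<^esub> v) = (g, i)" "i < p ^ m" "\<forall>k<p ^ m. g k \<in> carrier ?U"
        using V.mem_W[OF \<mu>.hom_closed[of "inv\<^bsub>R\<^esub> v"]] f(1) by auto
      have "(f, 0) \<otimes>\<^bsub>?Q\<^esub> (g, i) = \<one>\<^bsub>?Q\<^esub>"
        using f g \<mu>.hom_mult[of v "inv\<^bsub>R\<^esub> v"] by simp
      then have e: "(\<lambda>k\<in>{..<p ^ m}. f k \<otimes>\<^bsub>?U\<^esub> g ((k + 0) mod p ^ m)) = (\<lambda>k\<in>{..<p ^ m}. \<one>\<^bsub>?U\<^esub>)" "i mod p ^ m = 0"
        unfolding V.mult_W V.one_W by simp_all
      have "f 0 \<otimes>\<^bsub>?U\<^esub> g 0 = \<one>\<^bsub>?U\<^esub>" using fun_cong[OF e(1), of 0] p0 by simp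
      moreover have cl: "f 0 \<in> carrier ?U" "g 0 \<in> carrier ?U" using f g p0 by (auto simp: carrier_FactGroup)
      ultimately have "g 0 = inv\<^bsub>?U\<^esub> f 0" by (metis V.inv_equality V.inv_inv)
      also have "\<dots> = L #>\<^bsub>R\<^esub> inv\<^bsub>R\<^esub> v"
        using group_hom.hom_inv[of R ?U "\<lambda>a. L #>\<^bsub>R\<^esub> a" v] f A.E.quot_hom[OF L] gQ0 A.E.is_group
        by (simp add: group_hom_def group_hom_axioms_def)
      finally show "inv\<^bsub>R\<^esub> v \<in> ?B" using f g e by simp
    next
      fix v v' assume "v \<in> ?B" "v' \<in> ?B"
      then obtain f g where fg: "v \<in> carrier R" "\<mu> v = (f, 0)" "f 0 = L #>\<^bsub>R\<^esub> v"
        "v' \<in> carrier R" "\<mu> v' = (g, 0)" "g 0 = L #>\<^bsub>R\<^esub> v'" by blast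
      have "\<mu> (v \<otimes>\<^bsub>R\<^esub> v') = (\<lambda>k\<in>{..<p ^ m}. f k \<otimes>\<^bsub>?U\<^esub> g ((k + 0) mod p ^ m), (0 + 0) mod p ^ m)"
        using \<mu>.hom_mult[OF fg(1,4)] fg(2,5) by (simp only: V.mult_W)
      then show "v \<otimes>\<^bsub>R\<^esub> v' \<in> ?B"
        using fg p0 A.E.quot_mult[OF L fg(1,4)] by simp
    qed auto
    moreover have "(\<lambda>j. [(j, True)]) ` {..<r} \<subseteq> ?B"
    proof
      fix v assume "v \<in> (\<lambda>j. [(j, True)]) ` {..<r}"
      then obtain j where j: "j < r" "v = [(j, True)]" by blast
      have "\<mu> v = V.base (\<lambda>k. h ((k + Suc j) mod p ^ m) \<otimes>\<^bsub>?U\<^esub> inv\<^bsub>?U\<^esub> h k)"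
        unfolding j(2) \<mu>_letter by (rule V.conj_pow_comm_rot_base[OF h])
      moreover have "h (Suc j mod p ^ m) \<otimes>\<^bsub>?U\<^esub> inv\<^bsub>?U\<^esub> h 0 = L #>\<^bsub>R\<^esub> v"
      proof -
        have "h (Suc j mod p ^ m) = L #>\<^bsub>R\<^esub> v" using j q by (simp add: h_def)
        moreover have "inv\<^bsub>?U\<^esub> h 0 = \<one>\<^bsub>?U\<^esub>" unfolding h_def by (simp only: V.inv_one simp_thms if_True)
        ultimately show ?thesis using V.r_one[OF letter[OF j(1)]] j(2) by simp
      qed
      ultimately show "v \<in> ?B" using j letters_subset p0 by (auto simp: V.base_def)
    qed
    ultimately have "generate R ((\<lambda>j. [(j, True)]) ` {..<r}) \<subseteq> ?B"
      by (intro A.E.generate_subgroup_incl)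
    then show ?thesis using w unfolding generate_free_group by blast
  qed
  obtain \<Psi> where \<Psi>: "\<And>a. a \<in> carrier ?Q \<Longrightarrow> \<Psi> a \<in> hom G (wreath ?Q (p ^ m))"
    "\<And>a. a \<in> carrier ?Q \<Longrightarrow> \<Psi> a (x 1) = wreath_product.base (p ^ m) (wreath_product.pattern ?Q a ?b ?c)"
    "\<And>a j y. a \<in> carrier ?Q \<Longrightarrow> y \<in> carrier G \<Longrightarrow> \<Psi> a (\<alpha> j y) = \<Psi> (a \<otimes>\<^bsub>?Q\<^esub> ?u j) y"
    using wreath_homs[OF Q q(1) b c] by metis
  interpret W: wreath_product ?Q "p ^ m"
    using p0 by (intro wreath_product.intro wreath_product_axioms.intro V.group_W) simp
  have pW: "finite_p_group p W.W" by (rule finite_p_group_wreath[OF prime_p Q])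
  let ?hat = "\<lambda>a. hat W.W (\<Psi> a)"
  \<comment> \<open>In a product \<open>v1 v2\<close> the outer map \<open>\<rho> v1\<close> is
    absorbed into the parameter first, giving \<open>a \<otimes> \<mu> v1\<close>, and
    \<open>\<rho> v2\<close> next. Since the parameter is multiplied on the right, the order of the
    factors is preserved and \<mu> is a homomorphism.\<close>
  have act: "\<forall>a\<in>carrier ?Q. \<forall>z\<in>carrier P. ?hat a (\<rho> w z) = ?hat (a \<otimes>\<^bsub>?Q\<^esub> \<mu> w) z"
    if w: "w \<in> carrier R" for w
  proof -
    have "w \<in> generate R ((\<lambda>j. [(j, True)]) ` {..<r})" using w unfolding generate_free_group .
    then show ?thesis
    proof (induction rule: generate.induct)
      case one
      then show ?case by (simp add: A.\<rho>_one)
    next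
      case (incl v)
      then obtain j where j: "v = [(j, True)]" by blast
      have "?hat a (ind (\<alpha> j) z) = ?hat (a \<otimes>\<^bsub>?Q\<^esub> ?u j) z" if a: "a \<in> carrier ?Q" and z: "z \<in> carrier P" for a z
        using a u by (intro hat_ind[OF pW \<Psi>(1) \<Psi>(1) \<alpha>_hom \<Psi>(3) z]) simp_all
      then show ?case by (simp add: j \<rho>_letter \<mu>_letter)
    next
      case (inv v)
      then obtain j where j: "v = [(j, True)]" and v: "v \<in> carrier R" using letters_subset by blast
      have "?hat a (\<rho> (inv\<^bsub>R\<^esub> v) z) = ?hat (a \<otimes>\<^bsub>?Q\<^esub> \<mu> (inv\<^bsub>R\<^esub> v)) z"
        if a: "a \<in> carrier ?Q" and z: "z \<in> carrier P" for a z
      proof -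
        \<comment> \<open>The identity for the letter is read backwards: it is applied with
          parameter \<open>?a\<close> at the point \<open>?z\<close>, where the letter leads back to
          \<open>a\<close> and to \<open>z\<close>.\<close>
        let ?a = "a \<otimes>\<^bsub>?Q\<^esub> inv\<^bsub>?Q\<^esub> ?u j" and ?z = "\<rho> (inv\<^bsub>R\<^esub> v) z"
        have z': "?z \<in> carrier P" using v z by (intro A.\<rho>_closed) simp_all
        have "\<rho> v ?z = z" using A.\<rho>_mult[of v "inv\<^bsub>R\<^esub> v" z] v z A.\<rho>_one[OF z] by simp
        then have "ind (\<alpha> j) ?z = z" by (simp add: j \<rho>_letter)
        moreover have "?hat ?a (ind (\<alpha> j) ?z) = ?hat (?a \<otimes>\<^bsub>?Q\<^esub> ?u j) ?z"
          using a u by (intro hat_ind[OF pW \<Psi>(1) \<Psi>(1) \<alpha>_hom \<Psi>(3) z']) simp_all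
        moreover have "?a \<otimes>\<^bsub>?Q\<^esub> ?u j = a" using a u[of j] by (simp add: V.W.m_assoc)
        ultimately show ?thesis using v by (simp add: j \<mu>_letter)
      qed
      then show ?case by blast
    next
      case (eng v1 v2)
      then have v: "v1 \<in> carrier R" "v2 \<in> carrier R" unfolding generate_free_group by simp_all
      then have "a \<otimes>\<^bsub>?Q\<^esub> \<mu> v1 \<in> carrier ?Q" if "a \<in> carrier ?Q" for a using that by simp
      then show ?case
        using eng.IH v by (simp add: A.\<rho>_mult A.\<rho>_closed V.W.m_assoc)
    qed
  qed
  let ?N = "kernel G W.W (\<Psi> \<one>\<^bsub>?Q\<^esub>)"
  have one: "\<one>\<^bsub>?Q\<^esub> \<in> carrier ?Q" by simp
  have N: "?N \<in> K" by (rule kernel_in_K[OF pW \<Psi>(1)[OF one]])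
  have "w \<in> L" if w: "w \<in> carrier R" and d: "d \<in> carrier P" and eq: "\<forall>z\<in>carrier P. \<rho> w z ?N = inner d z ?N" for w d
  proof -
    have x1: "x 1 \<in> carrier G" using n x_closed by simp
    \<comment> \<open>Testing at \<open>x 1\<close> is enough: there the two sides give the pattern
      with first entry \<open>\<mu> w\<close> and a conjugate of the pattern with first entry
      1.\<close>
    let ?y = "emb (x 1)"
    have y: "?y \<in> carrier P" by (rule emb_closed[OF x1])
    have \<mu>w: "\<mu> w \<in> carrier ?Q" using w by simp
    interpret H: group_hom P W.W "?hat \<one>\<^bsub>?Q\<^esub>"
      by (intro group_hom.intro group_hom_axioms.intro P_group W.group_W hat_hom[OF pW \<Psi>(1)[OF one]])
    have val: "?hat a ?y = W.base (W.pattern a ?b ?c)" if a: "a \<in> carrier ?Q" for a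
      using hat_emb[OF pW \<Psi>(1)[OF a] x1] \<Psi>(2)[OF a] by simp
    have "?hat \<one>\<^bsub>?Q\<^esub> (\<rho> w ?y) = ?hat \<one>\<^bsub>?Q\<^esub> (inner d ?y)" using bspec[OF eq y] by (simp add: hat_def)
    moreover have "?hat \<one>\<^bsub>?Q\<^esub> (\<rho> w ?y) = ?hat (\<mu> w) ?y" using act[OF w] one y \<mu>w V.W.l_one by metis
    moreover have "?hat \<one>\<^bsub>?Q\<^esub> (inner d ?y) = ?hat \<one>\<^bsub>?Q\<^esub> d \<otimes>\<^bsub>W.W\<^esub> ?hat \<one>\<^bsub>?Q\<^esub> ?y \<otimes>\<^bsub>W.W\<^esub> inv\<^bsub>W.W\<^esub> ?hat \<one>\<^bsub>?Q\<^esub> d"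
      using d y by (simp add: inner_def)
    ultimately have "W.base (W.pattern (\<mu> w) ?b ?c) =
        ?hat \<one>\<^bsub>?Q\<^esub> d \<otimes>\<^bsub>W.W\<^esub> W.base (W.pattern \<one>\<^bsub>?Q\<^esub> ?b ?c) \<otimes>\<^bsub>W.W\<^esub> inv\<^bsub>W.W\<^esub> ?hat \<one>\<^bsub>?Q\<^esub> d"
      using val[OF \<mu>w] val[OF one] by simp
    moreover have cd: "?hat \<one>\<^bsub>?Q\<^esub> d \<in> carrier W.W" by (rule H.hom_closed[OF d])
    moreover have "W.base (W.pattern \<one>\<^bsub>?Q\<^esub> ?b ?c) \<in> carrier W.W" using val[OF one] H.hom_closed[OF y] by simp
    ultimately have "W.base (W.pattern (\<mu> w) ?b ?c) \<otimes>\<^bsub>W.W\<^esub> ?hat \<one>\<^bsub>?Q\<^esub> d =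
        ?hat \<one>\<^bsub>?Q\<^esub> d \<otimes>\<^bsub>W.W\<^esub> W.base (W.pattern \<one>\<^bsub>?Q\<^esub> ?b ?c)" by (simp add: W.W.m_assoc)
    then have "\<mu> w = \<one>\<^bsub>?Q\<^esub>" by (rule W.pattern_conj_imp_one[OF q(1) \<mu>w b c cd])
    moreover obtain f where "\<mu> w = (f, 0)" "f 0 = L #>\<^bsub>R\<^esub> w" using coord0[OF w] by blast
    ultimately have "L #>\<^bsub>R\<^esub> w = L" using p0 by (simp add: V.one_W)
    then show "w \<in> L" by (rule A.E.coset_join1[OF _ w A.E.K_subgroup[OF L]])
  qed
  then show ?thesis using N by blast
qed

lemma contains_free_pro_p: "contains_free_pro_p p r Out TO"
  unfolding contains_free_pro_p_def
  using A.contains_free_pro_p_if_detected[OF detect] by blast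

end

theorem lemma8p1:
  fixes F :: "('a, 'b) monoid_scheme"
  assumes "free_of_finite_rank F"
  shows "(gen_rank F \<ge> 3 \<longrightarrow>
            (\<forall>p::nat. Factorial_Ring.prime p \<longrightarrow>
               contains_free_pro_p p (gen_rank F - 1)
                 (OutGroup (pro_p_completion p F) (pro_p_topology p F))
                 (out_topology (pro_p_completion p F) (pro_p_topology p F)))) \<and>
         (gen_rank F = 2 \<longrightarrow>
            contains_free_pro_p 2 2
              (OutGroup (pro_p_completion 2 F) (pro_p_topology 2 F))
              (out_topology (pro_p_completion 2 F) (pro_p_topology 2 F)))"
proof -
  obtain n x where B: "free_basis F n x" using free_basis_ex[OF assms] by blast
  have F: "group F" and x: "x ` {..<n} \<subseteq> carrier F" using B by (auto simp: free_basis_def)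
  have gen: "generate F (x ` {..<n}) = carrier F" by (rule free_basis_generate[OF B])
  \<comment> \<open>A basis generates, so \<open>gen_rank F\<close> is at most \<open>n\<close>. In
    both parts of the claim this provides the two basis elements \<open>x 0\<close> and
    \<open>x 1\<close> of the construction.\<close>
  have "gen_rank F \<le> card (x ` {..<n})"
    unfolding gen_rank_def by (rule Least_le) (use x gen in blast)
  also have "\<dots> \<le> n" using card_image_le[of "{..<n}" x] by simp
  finally have rank: "gen_rank F \<le> n" .
  have main: "contains_free_pro_p p r (OutGroup (pro_p_completion p F) (pro_p_topology p F))
      (out_topology (pro_p_completion p F) (pro_p_topology p F))"
    if p: "Factorial_Ring.prime p" and n: "2 \<le> n" for p r :: nat
  proof -
    interpret free_construction F p n x r
    proof (intro free_construction.intro fg_pro_p_group.intro pro_p_group.intro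
        pro_p_group_axioms.intro fg_pro_p_group_axioms.intro free_construction_axioms.intro)
      show "\<exists>S. finite S \<and> S \<subseteq> carrier F \<and> generate F S = carrier F" using x gen by blast
    qed (use F p n B in simp_all)
    show ?thesis by (rule contains_free_pro_p)
  qed
  show ?thesis using main rank two_is_prime_nat by simp
qed

end
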